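(* Let $n\ge 1$ and let $\{(\Gamma_k\backslash H_n, dist_k)\}_{k\in\mathbb{N}}$ be a sequence of compact Heisenberg manifolds, where each $\Gamma_k$ is a lattice in the Heisenberg Lie group $H_n$ of dimension $2n+1$ and each $dist_k$ is the distance on $\Gamma_k\backslash H_n$ induced by a left invariant (bracket generating) sub-Riemannian metric. Assume that this sequence converges in the Gromov--Hausdorff topology, that the diameters of $(\Gamma_k\backslash H_n,dist_k)$ are uniformly bounded above by some $D>0$, and that the total measure of $\Gamma_k\backslash H_n$ with respect to the minimal Popp's volume of the $k$-th metric converges to zero as $k\to\infty$. Then the limit space is isometric to a flat torus of lower dimension (that is, of dimension less than $2n+1$).
   Context: $H_n$ is the simply connected Lie group with Lie algebra $\mathfrak{h}_n$ having a basis $X_1,\dots,X_{2n},Z$ with $[X_i,X_{i+n}]=Z$ for $i=1,\dots,n$ and all other brackets of basis elements zero. A compact Heisenberg manifold is a quotient $\Gamma\backslash H_n$ by a lattice $\Gamma<H_n$. Left invariant sub-Riemannian metrics: let $\mathfrak{v}\subset\mathfrak{h}_n$ be a subspace which is bracket generating (here: $\mathfrak{v}+[\mathfrak{v},\mathfrak{v}]=\mathfrak{h}_n$; the case $\mathfrak{v}=\mathfrak{h}_n$, i.e. a Riemannian metric, is allowed) and $\langle\cdot,\cdot\rangle$ an inner product on $\mathfrak{v}$. Left translation gives a distribution $\mathcal{D}$ on $H_n$ with a metric $g$ on it. The distance between two points is the infimum of $\int_0^1\sqrt{g(\dot c,\dot c)}\,dt$ over absolutely continuous paths $c$ joining them with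 $\dot c(t)\in\mathcal{D}_{c(t)}$ for a.e. $t$. It is invariant under left translations, and the quotient distance on $\Gamma\backslash H_n$ is also called left invariant. Popp's volume: for a bracket generating subspace $\mathfrak{w}\subset \mathfrak{h}_n$ with an inner product, if $\mathfrak{w}=\mathfrak{h}_n$ the Popp's volume is the Riemannian volume form. If $\dim\mathfrak{w}=2n$, take an orthonormal basis $e_1,\dots,e_{2n}$ of $\mathfrak{w}$, complete it by $e_{2n+1}$ to a basis of $\mathfrak{h}_n$, write $[e_i,e_j]=\sum_l c_{ij}^l e_l$ and let $\nu^1,\dots,\nu^{2n+1}$ be the dual basis; the Popp's volume is the left invariant form $vol(\mathfrak{w},\langle\cdot,\cdot\rangle)=\big(\sum_{i,j=1}^{2n}(c_{ij}^{2n+1})^2\big)^{-1/2}\nu^1\wedge\cdots\wedge\nu^{2n+1}$ (well defined up to sign, independent of the choices). Minimal Popp's volume: for a left invariant sub-Riemannian structure $(\mathfrak{v},\langle\cdot,\cdot\rangle)$, $mvol(\mathfrak{v},\langle\cdot,\cdot\rangle)$ is the minimum of $vol(\mathfrak{w},\langle\cdot,\cdot\rangle|_{\mathfrak{w}\otimes\mathfrak{w}})$ over all bracket generating subspaces $\mathfrak{w}\subset\mathfrak{v}$, where left invariant volume forms are compared by the absolute values of their coefficients with respect to a fixed Haar volume form. It descends to $\Gamma\backslash H_n$, and the total measure is the absolute value of its integral over $\Gamma\backslash H_n$. A flat torus is a torus $\mathbb{T}^m$ with a flat Riemannian metric, with $m=0$ (a point) allowed. *)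

theory Defs
  imports "HOL-Analysis.Analysis" "HOL-Algebra.Coset"
begin

section \<open>The Heisenberg Lie algebra and the Heisenberg group\<close>

text \<open>With \<open>n = CARD('n)\<close>, the basis \<open>X\<^sub>1, \<dots>, X\<^sub>2\<^sub>n, Z\<close> of the Lie algebra is indexed by
  \<open>('n + 'n) option\<close>: \<open>axis (Some (Inl i)) 1\<close> is \<open>X\<^sub>i\<close>, \<open>axis (Some (Inr i)) 1\<close> is \<open>X\<^sub>i\<^sub>+\<^sub>n\<close>
  and \<open>axis None 1\<close> is \<open>Z\<close>.  The simply connected group is taken in exponential coordinates,
  that is, on the same vector space with the Baker--Campbell--Hausdorff product.\<close>

type_synonym 'n heis = "real ^ (('n + 'n) option)"

definition hbracket :: "'n::finite heis \<Rightarrow> 'n heis \<Rightarrow> 'n heis" where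
  "hbracket u v =
     (\<Sum>i\<in>UNIV. u $ Some (Inl i) * v $ Some (Inr i) - u $ Some (Inr i) * v $ Some (Inl i))
       *\<^sub>R axis None 1"

definition hmult :: "'n::finite heis \<Rightarrow> 'n heis \<Rightarrow> 'n heis" where
  "hmult p q = p + q + (1 / 2) *\<^sub>R hbracket p q"

definition heis_group :: "'n::finite heis monoid" where
  "heis_group = \<lparr>carrier = UNIV, monoid.mult = hmult, one = 0\<rparr>"

lemma hbracket_basis:
  fixes i j :: "'n::finite"
  shows "hbracket (axis (Some (Inl i)) 1) (axis (Some (Inr j)) 1 :: 'n heis)
           = (if i = j then axis None 1 else 0)"
    and "hbracket (axis (Some (Inl i)) 1) (axis (Some (Inl j)) 1 :: 'n heis) = 0"
    and "hbracket (axis (Some (Inr i)) 1) (axis (Some (Inr j)) 1 :: 'n heis) = 0"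
    and "hbracket (axis None 1) (v :: 'n heis) = 0"
  by (auto simp: hbracket_def axis_def if_distrib [of "\<lambda>x. x * _"] cong: if_cong)

lemma hbracket_left: "hbracket (u + u') v = hbracket u v + hbracket u' v"
  and hbracket_scale_left: "hbracket (r *\<^sub>R u) v = r *\<^sub>R hbracket u v"
  and hbracket_right: "hbracket v (u + u') = hbracket v u + hbracket v u'"
  and hbracket_scale_right: "hbracket v (r *\<^sub>R u) = r *\<^sub>R hbracket v u"
  and hbracket_skew: "hbracket u v = - hbracket v u"
  by (auto simp: hbracket_def algebra_simps sum.distrib sum_subtractf sum_distrib_left
           simp flip: scaleR_add_left scaleR_minus_left)

lemma hbracket_nilpotent: "hbracket (hbracket u v) w = 0" "hbracket w (hbracket u v) = 0"
  by (simp_all add: hbracket_def axis_def)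

lemma group_heis_group: "group (heis_group :: 'n::finite heis monoid)"
proof (rule groupI)
  fix x y z :: "'n heis"
  show "x \<otimes>\<^bsub>heis_group\<^esub> y \<otimes>\<^bsub>heis_group\<^esub> z = x \<otimes>\<^bsub>heis_group\<^esub> (y \<otimes>\<^bsub>heis_group\<^esub> z)"
    by (simp add: heis_group_def hmult_def hbracket_left hbracket_right hbracket_scale_left
        hbracket_scale_right hbracket_nilpotent algebra_simps)
  show "\<one>\<^bsub>heis_group\<^esub> \<otimes>\<^bsub>heis_group\<^esub> x = x"
    by (simp add: heis_group_def hmult_def hbracket_def)
  have "- x \<otimes>\<^bsub>heis_group\<^esub> x = \<one>\<^bsub>heis_group\<^esub>"
    by (simp add: heis_group_def hmult_def hbracket_def)
  then show "\<exists>y\<in>carrier heis_group. y \<otimes>\<^bsub>heis_group\<^esub> x = \<one>\<^bsub>heis_group\<^esub>"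
    by (auto simp: heis_group_def)
qed (auto simp: heis_group_def)


section \<open>Lattices\<close>

text \<open>The manifold \<open>\<Gamma>\H\<^sub>n\<close> is the set \<open>rcosets \<Gamma>\<close> of the cosets \<open>\<Gamma> p\<close>.  A strict fundamental
  domain meets each of them exactly once.  Lebesgue measure in exponential coordinates is the
  Haar measure of the volume form dual to \<open>X\<^sub>1, \<dots>, X\<^sub>2\<^sub>n, Z\<close>, so its value on a fundamental
  domain is the volume of \<open>\<Gamma>\H\<^sub>n\<close>, independently of the domain.\<close>

definition fundamental_domain :: "'n::finite heis set \<Rightarrow> 'n heis set \<Rightarrow> bool" where
  "fundamental_domain \<Gamma> F \<longleftrightarrow>
     F \<in> sets borel \<and> (\<forall>A \<in> rcosets\<^bsub>heis_group\<^esub> \<Gamma>. \<exists>!p. p \<in> A \<inter> F)"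

definition covolume :: "'n::finite heis set \<Rightarrow> ennreal" where
  "covolume \<Gamma> = emeasure lborel (SOME F. fundamental_domain \<Gamma> F)"

text \<open>A lattice is a discrete subgroup of finite covolume; as \<open>H\<^sub>n\<close> is nilpotent, \<open>\<Gamma>\H\<^sub>n\<close> is then
  automatically compact.\<close>

definition heis_lattice :: "'n::finite heis set \<Rightarrow> bool" where
  "heis_lattice \<Gamma> \<longleftrightarrow>
     subgroup \<Gamma> heis_group \<and> (\<forall>p\<in>\<Gamma>. p isolated_in \<Gamma>) \<and>
     (\<exists>F. fundamental_domain \<Gamma> F \<and> emeasure lborel F < \<infinity>)"


section \<open>Left invariant sub-Riemannian metrics\<close>

definition bracket_generating :: "'n::finite heis set \<Rightarrow> bool" where
  "bracket_generating v \<longleftrightarrow>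
     {x + y | x y. x \<in> v \<and> y \<in> span {hbracket a b | a b. a \<in> v \<and> b \<in> v}} = UNIV"

text \<open>The values of \<open>g\<close> outside \<open>v\<close> are irrelevant.\<close>

definition inner_product_on :: "'a::real_vector set \<Rightarrow> ('a \<Rightarrow> 'a \<Rightarrow> real) \<Rightarrow> bool" where
  "inner_product_on v g \<longleftrightarrow>
     (\<forall>x\<in>v. \<forall>y\<in>v. g x y = g y x) \<and>
     (\<forall>x\<in>v. \<forall>y\<in>v. \<forall>z\<in>v. \<forall>a b. g (a *\<^sub>R x + b *\<^sub>R y) z = a * g x z + b * g y z) \<and>
     (\<forall>x\<in>v. x \<noteq> 0 \<longrightarrow> 0 < g x x)"

definition subriemannian :: "'n::finite heis set \<Rightarrow> ('n heis \<Rightarrow> 'n heis \<Rightarrow> real) \<Rightarrow> bool" where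
  "subriemannian v g \<longleftrightarrow> subspace v \<and> bracket_generating v \<and> inner_product_on v g"

text \<open>\<open>dleft p\<close> is the differential at the identity of the left translation by \<open>p\<close>, and \<open>dleft_inv p\<close>
  its inverse.\<close>

definition dleft :: "'n::finite heis \<Rightarrow> 'n heis \<Rightarrow> 'n heis" where
  "dleft p u = u + (1 / 2) *\<^sub>R hbracket p u"

definition dleft_inv :: "'n::finite heis \<Rightarrow> 'n heis \<Rightarrow> 'n heis" where
  "dleft_inv p u = u - (1 / 2) *\<^sub>R hbracket p u"

lemma dleft_has_derivative: "(hmult p has_derivative dleft p) (at 0)"
proof -
  have "bounded_linear (dleft p)"
    by (rule linear_conv_bounded_linear [THEN iffD1], rule linearI)
       (simp_all add: dleft_def hbracket_right hbracket_scale_right algebra_simps)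
  then have "((\<lambda>q. p + dleft p q) has_derivative (\<lambda>q. 0 + dleft p q)) (at 0)"
    by (intro has_derivative_add has_derivative_const bounded_linear_imp_has_derivative)
  moreover have "(\<lambda>q. p + dleft p q) = hmult p"
    by (rule ext) (simp add: dleft_def hmult_def add.assoc)
  ultimately show ?thesis
    by simp
qed

lemma dleft_dleft_inv: "dleft p (dleft_inv p u) = u" "dleft_inv p (dleft p u) = u"
proof -
  have *: "hbracket p (hbracket p u) = 0" and "hbracket p (- x) = - hbracket p x" for x
    using hbracket_nilpotent(2) hbracket_scale_right [of p "-1" x] by auto
  then show "dleft p (dleft_inv p u) = u" "dleft_inv p (dleft p u) = u"
    using hbracket_right [of p u "- ((1 / 2) *\<^sub>R hbracket p u)"]
    by (simp_all add: dleft_def dleft_inv_def hbracket_right hbracket_scale_right)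
qed

definition distribution :: "'n::finite heis set \<Rightarrow> 'n heis \<Rightarrow> 'n heis set" where
  "distribution v p = dleft p ` v"

definition sr_metric ::
  "('n::finite heis \<Rightarrow> 'n heis \<Rightarrow> real) \<Rightarrow> 'n heis \<Rightarrow> 'n heis \<Rightarrow> 'n heis \<Rightarrow> real" where
  "sr_metric g p x y = g (dleft_inv p x) (dleft_inv p y)"

definition abs_continuous_on_unit :: "(real \<Rightarrow> 'a::real_normed_vector) \<Rightarrow> bool" where
  "abs_continuous_on_unit c \<longleftrightarrow>
     (\<forall>\<epsilon>>0. \<exists>\<delta>>0. \<forall>(N::nat) a b.
        (\<forall>i<N. 0 \<le> a i \<and> a i \<le> b i \<and> b i \<le> 1) \<and>
        disjoint_family_on (\<lambda>i. {a i<..<b i}) {..<N} \<and> (\<Sum>i<N. b i - a i) < \<delta> \<longrightarrow>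
        (\<Sum>i<N. norm (c (b i) - c (a i))) < \<epsilon>)"

abbreviation velocity :: "(real \<Rightarrow> 'n::finite heis) \<Rightarrow> real \<Rightarrow> 'n heis" where
  "velocity c t \<equiv> vector_derivative c (at t within {0..1})"

definition horizontal_path :: "'n::finite heis set \<Rightarrow> (real \<Rightarrow> 'n heis) \<Rightarrow> bool" where
  "horizontal_path v c \<longleftrightarrow>
     abs_continuous_on_unit c \<and>
     (AE t in lebesgue_on {0..1}.
        c differentiable (at t within {0..1}) \<and> velocity c t \<in> distribution v (c t))"

definition sr_length :: "('n::finite heis \<Rightarrow> 'n heis \<Rightarrow> real) \<Rightarrow> (real \<Rightarrow> 'n heis) \<Rightarrow> real" where
  "sr_length g c = integral {0..1} (\<lambda>t. sqrt (sr_metric g (c t) (velocity c t) (velocity c t)))"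

definition sr_dist ::
  "'n::finite heis set \<Rightarrow> ('n heis \<Rightarrow> 'n heis \<Rightarrow> real) \<Rightarrow> 'n heis \<Rightarrow> 'n heis \<Rightarrow> real" where
  "sr_dist v g p q = Inf {sr_length g c | c. horizontal_path v c \<and> c 0 = p \<and> c 1 = q}"

text \<open>The arguments \<open>A\<close> and \<open>B\<close> are cosets of a lattice \<open>\<Gamma>\<close>, i.e. points of \<open>\<Gamma>\H\<^sub>n\<close>.\<close>

definition quotient_dist ::
  "'n::finite heis set \<Rightarrow> ('n heis \<Rightarrow> 'n heis \<Rightarrow> real) \<Rightarrow> 'n heis set \<Rightarrow> 'n heis set \<Rightarrow> real" where
  "quotient_dist v g A B = Inf {sr_dist v g p q | p q. p \<in> A \<and> q \<in> B}"


section \<open>Popp's volume and the minimal Popp's volume\<close>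

text \<open>The dual basis \<open>\<nu>\<^sup>l\<close> of a basis \<open>e\<close>.\<close>

definition coframe ::
  "(('n + 'n) option \<Rightarrow> 'n::finite heis) \<Rightarrow> ('n + 'n) option \<Rightarrow> 'n heis \<Rightarrow> real" where
  "coframe e l x = (matrix_inv (\<chi> r m. e m $ r) *v x) $ l"

text \<open>If \<open>w\<close> is the whole Lie algebra, \<open>e\<close> is an orthonormal basis of it; otherwise
  \<open>dim w = 2n\<close>, the vectors \<open>e (Some i)\<close> are an orthonormal basis of \<open>w\<close>, and \<open>e None\<close> is the
  vector \<open>e\<^sub>2\<^sub>n\<^sub>+\<^sub>1\<close> that completes it.\<close>

definition popp_frame ::
  "'n::finite heis set \<Rightarrow> ('n heis \<Rightarrow> 'n heis \<Rightarrow> real) \<Rightarrow> (('n + 'n) option \<Rightarrow> 'n heis) \<Rightarrow> bool" where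
  "popp_frame w g e \<longleftrightarrow>
     span (range e) = UNIV \<and>
     (if w = UNIV then \<forall>l m. g (e l) (e m) = (if l = m then 1 else 0)
      else span (range (\<lambda>i. e (Some i))) = w \<and>
           (\<forall>i j. g (e (Some i)) (e (Some j)) = (if i = j then 1 else 0)))"

text \<open>Popp's volume, as an alternating form on the Lie algebra;
  \<open>(\<nu>\<^sup>1 \<and> \<dots> \<and> \<nu>\<^sup>N) (x\<^sub>1, \<dots>, x\<^sub>N) = det (\<nu>\<^sup>l (x\<^sub>m))\<close>.\<close>

definition popp_form ::
  "'n::finite heis set \<Rightarrow> (('n + 'n) option \<Rightarrow> 'n heis) \<Rightarrow> (('n + 'n) option \<Rightarrow> 'n heis) \<Rightarrow> real" where
  "popp_form w e x =
     (if w = UNIV then 1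
      else 1 / sqrt (\<Sum>i\<in>UNIV. \<Sum>j\<in>UNIV. (coframe e None (hbracket (e (Some i)) (e (Some j))))\<^sup>2))
     * det (\<chi> l m. coframe e l (x m))"

text \<open>Absolute value of the coefficient of Popp's volume with respect to the Haar volume form
  dual to \<open>X\<^sub>1, \<dots>, X\<^sub>2\<^sub>n, Z\<close>; it does not depend on the choice of \<open>e\<close>.\<close>

definition popp_coeff :: "'n::finite heis set \<Rightarrow> ('n heis \<Rightarrow> 'n heis \<Rightarrow> real) \<Rightarrow> real" where
  "popp_coeff w g = \<bar>popp_form w (SOME e. popp_frame w g e) (\<lambda>m. axis m 1)\<bar>"

text \<open>The infimum is attained.\<close>

definition mvol :: "'n::finite heis set \<Rightarrow> ('n heis \<Rightarrow> 'n heis \<Rightarrow> real) \<Rightarrow> real" where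
  "mvol v g = Inf {popp_coeff w g | w. subspace w \<and> bracket_generating w \<and> w \<subseteq> v}"

definition total_mvol ::
  "'n::finite heis set \<Rightarrow> 'n heis set \<Rightarrow> ('n heis \<Rightarrow> 'n heis \<Rightarrow> real) \<Rightarrow> ennreal" where
  "total_mvol \<Gamma> v g = ennreal (mvol v g) * covolume \<Gamma>"


section \<open>Metric geometry\<close>

definition metric_diameter :: "'a set \<Rightarrow> ('a \<Rightarrow> 'a \<Rightarrow> real) \<Rightarrow> ennreal" where
  "metric_diameter M d = (SUP x\<in>M. SUP y\<in>M. ennreal (d x y))"

definition isometric_embedding ::
  "'a set \<Rightarrow> ('a \<Rightarrow> 'a \<Rightarrow> real) \<Rightarrow> 'b set \<Rightarrow> ('b \<Rightarrow> 'b \<Rightarrow> real) \<Rightarrow> ('a \<Rightarrow> 'b) \<Rightarrow> bool" where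
  "isometric_embedding M d M' d' f \<longleftrightarrow>
     f ` M \<subseteq> M' \<and> (\<forall>x\<in>M. \<forall>y\<in>M. d' (f x) (f y) = d x y)"

definition isometric ::
  "'a set \<Rightarrow> ('a \<Rightarrow> 'a \<Rightarrow> real) \<Rightarrow> 'b set \<Rightarrow> ('b \<Rightarrow> 'b \<Rightarrow> real) \<Rightarrow> bool" where
  "isometric M d M' d' \<longleftrightarrow> (\<exists>f. isometric_embedding M d M' d' f \<and> bij_betw f M M')"

definition hausdorff_distance :: "'a metric \<Rightarrow> 'a set \<Rightarrow> 'a set \<Rightarrow> ennreal" where
  "hausdorff_distance Z A B =
     Inf {ennreal r | r. 0 < r \<and> A \<subseteq> (\<Union>b\<in>B. mball_of Z b r) \<and> B \<subseteq> (\<Union>a\<in>A. mball_of Z a r)}"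

text \<open>The infimum is over all metric spaces \<open>Z\<close> containing isometric copies of both spaces.  As
  \<open>Z\<close> may be replaced by the union of the two copies, it can be carried by the type \<open>'a + 'b\<close>.\<close>

definition gromov_hausdorff_distance ::
  "'a set \<Rightarrow> ('a \<Rightarrow> 'a \<Rightarrow> real) \<Rightarrow> 'b set \<Rightarrow> ('b \<Rightarrow> 'b \<Rightarrow> real) \<Rightarrow> ennreal" where
  "gromov_hausdorff_distance M d M' d' =
     Inf {hausdorff_distance Z (f ` M) (f' ` M') | (Z :: ('a + 'b) metric) f f'.
            isometric_embedding M d (mspace Z) (mdist Z) f \<and>
            isometric_embedding M' d' (mspace Z) (mdist Z) f'}"


section \<open>Flat tori\<close>

text \<open>\<open>T\<^sup>m = \<real>\<^sup>m / \<int>\<^sup>m\<close> with the flat Riemannian metric of constant coefficients \<open>Q\<close>.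
  As the dimension is not fixed in advance, \<open>\<real>\<^sup>m\<close> consists of the sequences that vanish from \<open>m\<close> on.\<close>

definition euclidean_carrier :: "nat \<Rightarrow> (nat \<Rightarrow> real) set" where
  "euclidean_carrier m = {x. \<forall>i\<ge>m. x i = 0}"

definition torus :: "nat \<Rightarrow> (nat \<Rightarrow> real) set set" where
  "torus m = (\<lambda>x. {y \<in> euclidean_carrier m. \<forall>i<m. y i - x i \<in> \<int>}) ` euclidean_carrier m"

definition quad_form :: "nat \<Rightarrow> (nat \<Rightarrow> nat \<Rightarrow> real) \<Rightarrow> (nat \<Rightarrow> real) \<Rightarrow> real" where
  "quad_form m Q x = (\<Sum>i<m. \<Sum>j<m. Q i j * x i * x j)"

definition flat_torus_metric :: "nat \<Rightarrow> (nat \<Rightarrow> nat \<Rightarrow> real) \<Rightarrow> bool" where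
  "flat_torus_metric m Q \<longleftrightarrow>
     (\<forall>i<m. \<forall>j<m. Q i j = Q j i) \<and>
     (\<forall>x\<in>euclidean_carrier m. x \<noteq> (\<lambda>_. 0) \<longrightarrow> 0 < quad_form m Q x)"

definition flat_torus_dist ::
  "nat \<Rightarrow> (nat \<Rightarrow> nat \<Rightarrow> real) \<Rightarrow> (nat \<Rightarrow> real) set \<Rightarrow> (nat \<Rightarrow> real) set \<Rightarrow> real" where
  "flat_torus_dist m Q A B = Inf {sqrt (quad_form m Q (\<lambda>i. x i - y i)) | x y. x \<in> A \<and> y \<in> B}"

end

(* Let L be the image of a lattice in H_n / Z = R^(2n), with the quotient norm of the metric.
   The projection shortens distances and its horizontal lifts have the same length, so the compact
   Heisenberg manifold is a circle bundle over the flat torus R^(2n) / L, and its distance exceeds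
   that of the torus by at most the diameter of a fibre. If the fibres are not short, then a
   bounded diameter keeps the nonzero vectors of L away from 0, because each of them has a
   nontrivial commutator with a lattice element of bounded projection. The translates of a ball in
   adapted coordinates are then disjoint, which bounds the Popp volume of every admissible subspace
   from below. Hence a small total minimal Popp volume makes the manifold Gromov--Hausdorff close
   to R^(2n) / L. A limit of such quotients is R^(2n) / K for a closed cocompact subgroup K, that
   is, a flat torus of dimension at most 2n. *)

theory Submission
  imports Defs
begin


section \<open>Absolutely continuous curves\<close>

text \<open>Neither the metrics nor the lattices are normalised, so every constant may depend on n,
  D and the tolerance only. Two numbers of a metric stay uncontrolled: the norm M of the bracket
  form in a g-orthonormal frame, and the length of Z, called \<open>center_norm\<close>. With c the
  infimum of the positive central coordinates of the lattice, a fibre can be short in two ways: c /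
  M is small, because a horizontal loop of length about sqrt (c / M) climbs by c, or Z is horizontal
  and c * \<open>center_norm\<close> is small. The same numbers govern volume: c / M, with D, bounds
  the Popp volume of the admissible hyperplanes from below, and c * \<open>center_norm\<close>
  enters the bound for the whole algebra. So if neither is small, every candidate in the minimum is
  bounded below. The torus may collapse along with the fibres, and then no basis of L survives in
  the limit; therefore the limit is taken of the distance functions to L, and K is the zero set of
  the limit function. Paths are merely absolutely continuous, which is why a fundamental theorem of
  calculus for them precedes all estimates of length.\<close>

lemma abs_continuous_on_unit_sum_less:
  assumes "abs_continuous_on_unit c" and "0 < (\<epsilon>::real)"
  shows "\<exists>\<delta>>0. \<forall>I a b. finite I \<and> (\<forall>i\<in>I. 0 \<le> a i \<and> a i \<le> b i \<and> b i \<le> 1) \<and>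
       disjoint_family_on (\<lambda>i. {a i<..<b i}) I \<and> (\<Sum>i\<in>I. b i - a i) < \<delta> \<longrightarrow>
       (\<Sum>i\<in>(I::'i set). norm (c (b i) - c (a i))) < \<epsilon>"
proof -
  obtain \<delta> where "0 < \<delta>" and \<delta>: "\<And>(N::nat) a b. (\<forall>i<N. 0 \<le> a i \<and> a i \<le> b i \<and> b i \<le> 1) \<Longrightarrow>
        disjoint_family_on (\<lambda>i. {a i<..<b i}) {..<N} \<Longrightarrow> (\<Sum>i<N. b i - a i) < \<delta> \<Longrightarrow>
        (\<Sum>i<N. norm (c (b i) - c (a i))) < \<epsilon>"
    using assms unfolding abs_continuous_on_unit_def by meson
  show ?thesis
  proof (intro exI [of _ \<delta>] conjI allI impI \<open>0 < \<delta>\<close>)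
    fix I :: "'i set" and a b :: "'i \<Rightarrow> real"
    assume "finite I \<and> (\<forall>i\<in>I. 0 \<le> a i \<and> a i \<le> b i \<and> b i \<le> 1) \<and>
       disjoint_family_on (\<lambda>i. {a i<..<b i}) I \<and> (\<Sum>i\<in>I. b i - a i) < \<delta>"
    then have I: "finite I" and ab: "\<And>i. i \<in> I \<Longrightarrow> 0 \<le> a i \<and> a i \<le> b i \<and> b i \<le> 1"
      and dj: "disjoint_family_on (\<lambda>i. {a i<..<b i}) I" and less: "(\<Sum>i\<in>I. b i - a i) < \<delta>"
      by auto
    \<comment> \<open>Enumerating I reduces to the index sets of the definition. Arbitrary finite
      index sets are wanted because divisions, which are sets of tagged intervals, will index the
      sums.\<close>
    obtain f where f: "bij_betw f {..<card I} I"
      using ex_bij_betw_nat_finite [OF I] by (auto simp: atLeast0LessThan)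
    have sum: "(\<Sum>i<card I. h (f i)) = (\<Sum>i\<in>I. h i)" for h :: "'i \<Rightarrow> real"
      using sum.reindex_bij_betw [OF f] .
    have "(\<Sum>i<card I. norm (c (b (f i)) - c (a (f i)))) < \<epsilon>"
    proof (rule \<delta>)
      show "\<forall>i<card I. 0 \<le> a (f i) \<and> a (f i) \<le> b (f i) \<and> b (f i) \<le> 1"
        using ab f by (auto simp: bij_betw_def)
      show "disjoint_family_on (\<lambda>i. {a (f i)<..<b (f i)}) {..<card I}"
        using dj f unfolding disjoint_family_on_def bij_betw_def inj_on_def by blast
      show "(\<Sum>i<card I. b (f i) - a (f i)) < \<delta>"
        using less sum [of "\<lambda>i. b i - a i"] by simp
    qed
    then show "(\<Sum>i\<in>I. norm (c (b i) - c (a i))) < \<epsilon>"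
      using sum [of "\<lambda>i. norm (c (b i) - c (a i))"] by simp
  qed
qed

text \<open>The form of absolute continuity suited to gauge integrals: the interiors of the
  intervals of a partial division are disjoint, so their total length is at most the measure of any
  U that contains them. Smallness is then asked of U alone.\<close>

lemma abs_continuous_on_unit_sum_tagged_less:
  assumes "abs_continuous_on_unit c" and "0 < (\<epsilon>::real)"
  shows "\<exists>\<delta>>0. \<forall>p U. p tagged_partial_division_of {0..1} \<and> (\<forall>x K. (x, K) \<in> p \<longrightarrow> K \<subseteq> U) \<and>
       U \<in> lmeasurable \<and> measure lebesgue U < \<delta> \<longrightarrow>
       (\<Sum>(x, K)\<in>p. norm (c (Sup K) - c (Inf K))) < \<epsilon>"
proof -
  obtain \<delta> where "0 < \<delta>" and \<delta>: "\<forall>I a b. finite I \<and> (\<forall>i\<in>I. 0 \<le> a i \<and> a i \<le> b i \<and> b i \<le> 1) \<and>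
       disjoint_family_on (\<lambda>i. {a i<..<b i}) I \<and> (\<Sum>i\<in>I. b i - a i) < \<delta> \<longrightarrow>
       (\<Sum>i\<in>(I::(real \<times> real set) set). norm (c (b i) - c (a i))) < \<epsilon>"
    using abs_continuous_on_unit_sum_less [OF assms, where 'i = "real \<times> real set"] by blast
  show ?thesis
  proof (intro exI [of _ \<delta>] conjI allI impI \<open>0 < \<delta>\<close>)
    fix p :: "(real \<times> real set) set" and U :: "real set"
    assume "p tagged_partial_division_of {0..1} \<and> (\<forall>x K. (x, K) \<in> p \<longrightarrow> K \<subseteq> U) \<and>
       U \<in> lmeasurable \<and> measure lebesgue U < \<delta>"
    then have p: "p tagged_partial_division_of {0..1}" and U: "\<And>x K. (x, K) \<in> p \<Longrightarrow> K \<subseteq> U"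
      and mU: "U \<in> lmeasurable" "measure lebesgue U < \<delta>"
      by auto
    define A where "A i = Inf (snd i)" for i :: "real \<times> real set"
    define B where "B i = Sup (snd i)" for i :: "real \<times> real set"
    have K: "snd i = {A i..B i} \<and> A i \<le> B i \<and> 0 \<le> A i \<and> B i \<le> 1" if "i \<in> p" for i
    proof -
      obtain x K where i: "i = (x, K)" by fastforce
      then have xK: "(x, K) \<in> p" using that by simp
      obtain u v where "K = cbox u v"
        using tagged_partial_division_ofD(4) [OF p xK] by blast
      then show ?thesis
        using tagged_partial_division_ofD(2,3) [OF p xK] by (auto simp: i A_def B_def)
    qed
    have fin: "finite p"
      using p by (rule tagged_partial_division_ofD)
    have dj: "disjoint_family_on (\<lambda>i. {A i<..<B i}) p"
      unfolding disjoint_family_on_def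
    proof (intro ballI impI)
      fix i j assume ij: "i \<in> p" "j \<in> p" "i \<noteq> j"
      then have "interior (snd i) \<inter> interior (snd j) = {}"
        using tagged_partial_division_ofD(5) [OF p, of "fst i" "snd i" "fst j" "snd j"] by simp
      then show "{A i<..<B i} \<inter> {A j<..<B j} = {}"
        using K [OF ij(1)] K [OF ij(2)] by simp
    qed
    have em: "emeasure lebesgue {A i<..<B i} \<noteq> \<infinity>" if "i \<in> p" for i
      using K [OF that] by simp
    have "(\<Sum>i\<in>p. B i - A i) = (\<Sum>i\<in>p. measure lebesgue {A i<..<B i})"
      using K by (intro sum.cong) auto
    also have "\<dots> = measure lebesgue (\<Union>i\<in>p. {A i<..<B i})"
      using fin dj em by (intro measure_finite_Union [symmetric]) auto
    also have "\<dots> \<le> measure lebesgue U"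
    proof (rule measure_mono_fmeasurable [OF _ _ mU(1)])
      show "(\<Union>i\<in>p. {A i<..<B i}) \<subseteq> U"
      proof (rule UN_least)
        fix i assume "i \<in> p"
        then have "snd i \<subseteq> U" using U [of "fst i" "snd i"] by simp
        then show "{A i<..<B i} \<subseteq> U" using K [OF \<open>i \<in> p\<close>] by auto
      qed
    qed (use fin in auto)
    finally have "(\<Sum>i\<in>p. norm (c (B i) - c (A i))) < \<epsilon>"
      using mU fin dj K by (intro \<delta> [rule_format]) auto
    then show "(\<Sum>(x, K)\<in>p. norm (c (Sup K) - c (Inf K))) < \<epsilon>"
      by (simp add: A_def B_def split_def)
  qed
qed

text \<open>The exceptional null set may be uncountable, so differentiability off N is not enough by
  itself. Absolute continuity handles the tags in N: N lies in an open U of small measure, the gauge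
  keeps the intervals tagged in N inside U, and there the increments of \<open>c\<close> sum to less
  than e/2. The other tags are handled by the straddle estimate.\<close>

lemma abs_continuous_has_integral_derivative:
  fixes c :: "real \<Rightarrow> 'a::banach"
  assumes ac: "abs_continuous_on_unit c" and ab: "0 \<le> a" "a \<le> b" "b \<le> 1"
    and "negligible N"
    and der: "\<And>t. t \<in> {0..1} - N \<Longrightarrow> (c has_vector_derivative c' t) (at t within {0..1})"
  shows "(c' has_integral (c b - c a)) {a..b}"
proof -
  \<comment> \<open>With value 0 on N, a tag in N contributes only the increment of
    \<open>c\<close>; the change on a null set is undone by a spike argument at the end.\<close>
  define h where "h t = (if t \<in> N then 0 else c' t)" for t
  have "(h has_integral (c b - c a)) (cbox a b)"
    unfolding has_integral
  proof (intro allI impI)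
    fix e :: real assume "0 < e"
    obtain \<delta> where "0 < \<delta>" and \<delta>: "\<forall>p U. p tagged_partial_division_of {0..1} \<and>
       (\<forall>x K. (x, K) \<in> p \<longrightarrow> K \<subseteq> U) \<and> U \<in> lmeasurable \<and> measure lebesgue U < \<delta> \<longrightarrow>
       (\<Sum>(x, K)\<in>p. norm (c (Sup K) - c (Inf K))) < e / 2"
      using abs_continuous_on_unit_sum_tagged_less [OF ac, of "e/2"] \<open>0 < e\<close> half_gt_zero by blast
    obtain U where "open U" "N \<subseteq> U" and UN: "(U - N) \<in> lmeasurable" "emeasure lebesgue (U - N) < ennreal \<delta>"
      using sets_lebesgue_outer_open [OF negligible_imp_sets [OF \<open>negligible N\<close>] \<open>0 < \<delta>\<close>] by metis
    have Uml: "U \<in> lmeasurable" and Um: "measure lebesgue U < \<delta>"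
    proof -
      have "(U - N) \<union> N \<in> lmeasurable"
        using UN(1) \<open>negligible N\<close> by (intro fmeasurable.Un) (auto simp: negligible_imp_measurable)
      moreover have "(U - N) \<union> N = U" using \<open>N \<subseteq> U\<close> by auto
      ultimately show "U \<in> lmeasurable" by simp
      have "measure lebesgue U = measure lebesgue (U - N)"
        using \<open>negligible N\<close> \<open>U \<in> lmeasurable\<close>
        by (simp add: measure_Diff_null_set negligible_iff_null_sets fmeasurableD)
      also have "\<dots> < \<delta>"
        using UN \<open>0 < \<delta>\<close> by (simp add: emeasure_eq_measure2 ennreal_less_iff)
      finally show "measure lebesgue U < \<delta>" .
    qed
    \<comment> \<open>The summand 1 keeps the denominator positive when a = b.\<close>
    define e' where "e' = e / (2 * (b - a + 1))"
    have "0 < e'" using \<open>0 < e\<close> ab by (simp add: e'_def)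
    have "\<exists>d>0. (x \<in> N \<longrightarrow> ball x d \<subseteq> U) \<and> (x \<in> {0..1} - N \<longrightarrow>
         (\<forall>y\<in>{0..1}. norm (y-x) < d \<longrightarrow> norm (c y - c x - (y-x) *\<^sub>R h x) \<le> e' * norm (y-x)))" for x
    proof (cases "x \<in> N")
      case True
      then have "\<exists>d>0. ball x d \<subseteq> U" using \<open>N \<subseteq> U\<close> \<open>open U\<close> open_contains_ball by auto
      then show ?thesis using True by auto
    next
      case False
      show ?thesis
      proof (cases "x \<in> {0..1}")
        case True
        then have "(c has_vector_derivative h x) (at x within {0..1})"
          using der [of x] False by (simp add: h_def)
        then show ?thesis
          using \<open>0 < e'\<close> False unfolding has_vector_derivative_def has_derivative_within_alt by blast
      next
        case F: False
        then show ?thesis using False by (intro exI [of _ 1]) auto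
      qed
    qed
    then obtain d where d0: "\<And>x. 0 < d x" and dN: "\<And>x. x \<in> N \<Longrightarrow> ball x (d x) \<subseteq> U"
      and d: "\<And>x y. \<lbrakk>x \<in> {0..1} - N; y \<in> {0..1}; norm (y-x) < d x\<rbrakk>
                 \<Longrightarrow> norm (c y - c x - (y-x) *\<^sub>R h x) \<le> e' * norm (y-x)"
      by metis
    show "\<exists>\<gamma>. gauge \<gamma> \<and> (\<forall>p. p tagged_division_of cbox a b \<and> \<gamma> fine p \<longrightarrow>
            norm ((\<Sum>(x, K)\<in>p. measure lborel K *\<^sub>R h x) - (c b - c a)) < e)"
    proof (intro exI conjI allI impI)
      show "gauge (\<lambda>x. ball x (d x))"
        using d0 by (rule gauge_ball_dependent [rule_format])
      fix p assume "p tagged_division_of cbox a b \<and> (\<lambda>x. ball x (d x)) fine p"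
      then have p: "p tagged_division_of {a..b}" and fine: "(\<lambda>x. ball x (d x)) fine p"
        by auto
      have fin: "finite p" using p by blast
      define q where "q = {(x, K) \<in> p. x \<in> N}"
      have fq: "finite q" "q \<subseteq> p" using fin by (auto simp: q_def intro: finite_subset)
      have cba: "c b - c a = (\<Sum>(x,K)\<in>p. c (Sup K) - c (Inf K))" "b - a = (\<Sum>(x,K)\<in>p. Sup K - Inf K)"
        using additive_tagged_division_1 [of a b p c] additive_tagged_division_1 [of a b p "\<lambda>x. x"] ab p by auto
      have Kp: "\<exists>u v. K = {u..v} \<and> u \<le> x \<and> x \<le> v \<and> a \<le> u \<and> v \<le> b \<and> K \<subseteq> ball x (d x)"
        if xK: "(x, K) \<in> p" for x K
      proof -
        obtain u v where "K = cbox u v"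
          using tagged_division_ofD(4) [OF p xK] by blast
        moreover have "x \<in> K" "K \<subseteq> {a..b}"
          using tagged_division_ofD(2,3) [OF p xK] by auto
        moreover have "K \<subseteq> ball x (d x)" using fine xK by (auto simp: fine_def)
        ultimately show ?thesis by auto
      qed
      have eq: "(\<Sum>(x, K)\<in>p. measure lborel K *\<^sub>R h x) - (c b - c a)
         = (\<Sum>(x, K)\<in>p. measure lborel K *\<^sub>R h x - (c (Sup K) - c (Inf K)))"
        unfolding cba by (simp add: sum_subtractf split_def)
      also have "\<dots> = (\<Sum>(x, K)\<in>q. measure lborel K *\<^sub>R h x - (c (Sup K) - c (Inf K)))
                    + (\<Sum>(x, K)\<in>p - q. measure lborel K *\<^sub>R h x - (c (Sup K) - c (Inf K)))"
        using sum.subset_diff [OF fq(2) fin] by (simp add: add.commute)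
      finally have "norm ((\<Sum>(x, K)\<in>p. measure lborel K *\<^sub>R h x) - (c b - c a)) \<le>
          norm (\<Sum>(x, K)\<in>q. measure lborel K *\<^sub>R h x - (c (Sup K) - c (Inf K))) +
          norm (\<Sum>(x, K)\<in>p - q. measure lborel K *\<^sub>R h x - (c (Sup K) - c (Inf K)))"
        by (simp only: norm_triangle_ineq)
      moreover have "norm (\<Sum>(x, K)\<in>q. measure lborel K *\<^sub>R h x - (c (Sup K) - c (Inf K))) < e / 2"
      proof -
        have "norm (\<Sum>(x, K)\<in>q. measure lborel K *\<^sub>R h x - (c (Sup K) - c (Inf K)))
          \<le> (\<Sum>(x, K)\<in>q. norm (c (Sup K) - c (Inf K)))"
          by (rule sum_norm_le) (auto simp: q_def h_def norm_minus_commute)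
        also have "\<dots> < e / 2"
        proof (rule \<delta> [rule_format], intro conjI allI impI)
          have "{a..b} \<subseteq> {0..1}" using ab by auto
          moreover have "p tagged_partial_division_of {a..b}"
            using p by (simp add: tagged_division_of_def)
          then have "q tagged_partial_division_of {a..b}"
            using tagged_partial_division_subset fq(2) by blast
          ultimately show "q tagged_partial_division_of {0..1}"
            unfolding tagged_partial_division_of_def by (meson subset_trans)
          show "K \<subseteq> U" if "(x, K) \<in> q" for x K
            using that Kp [of x K] dN [of x] by (auto simp: q_def)
        qed (fact Uml Um)+
        finally show ?thesis .
      qed
      moreover have "norm (\<Sum>(x, K)\<in>p - q. measure lborel K *\<^sub>R h x - (c (Sup K) - c (Inf K))) \<le> e / 2"
      proof -
        have "norm (\<Sum>(x, K)\<in>p - q. measure lborel K *\<^sub>R h x - (c (Sup K) - c (Inf K)))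
          \<le> (\<Sum>(x, K)\<in>p - q. e' * (Sup K - Inf K))"
        proof (rule sum_norm_le, clarify)
          fix x K assume xK: "(x, K) \<in> p" "(x, K) \<notin> q"
          then have "x \<notin> N" by (auto simp: q_def)
          obtain u v where K: "K = {u..v}" "u \<le> x" "x \<le> v" "a \<le> u" "v \<le> b" and sub: "K \<subseteq> ball x (d x)"
            using Kp [OF xK(1)] by auto
          have x: "x \<in> {0..1} - N" using K ab \<open>x \<notin> N\<close> by auto
          have "u \<in> K" "v \<in> K" using K by auto
          then have "u \<in> ball x (d x)" "v \<in> ball x (d x)" using sub by blast+
          then have "norm (u - x) < d x" "norm (v - x) < d x" by (auto simp: dist_real_def)
          then have 1: "norm (c u - c x - (u-x) *\<^sub>R h x) \<le> e' * norm (u-x)"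
            and 2: "norm (c v - c x - (v-x) *\<^sub>R h x) \<le> e' * norm (v-x)"
            using d [OF x, of u] d [OF x, of v] K ab by auto
          \<comment> \<open>The tag splits the interval into [u, x] and [x, v]; since u \<le> x
            \<le> v, the two one-sided errors add up to exactly e' (v - u).\<close>
          have "norm ((v - u) *\<^sub>R h x - (c v - c u))
             = norm ((c u - c x - (u-x) *\<^sub>R h x) - (c v - c x - (v-x) *\<^sub>R h x))"
            by (simp add: algebra_simps)
          also have "\<dots> \<le> e' * norm (u-x) + e' * norm (v-x)"
            using 1 2 norm_triangle_ineq4 by (smt (verit))
          also have "\<dots> = e' * (v - u)" using K by (simp add: algebra_simps)
          finally show "norm (measure lborel K *\<^sub>R h x - (c (Sup K) - c (Inf K))) \<le> e' * (Sup K - Inf K)"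
            using K by simp
        qed
        also have "\<dots> \<le> (\<Sum>(x, K)\<in>p. e' * (Sup K - Inf K))"
        proof (rule sum_mono2)
          show "0 \<le> (case i of (x, K) \<Rightarrow> e' * (Sup K - Inf K))" if ip: "i \<in> p - (p - q)" for i
          proof -
            obtain x K where i: "i = (x, K)" by fastforce
            then have "(x, K) \<in> p" using ip by simp
            from Kp [OF this] obtain u v where "K = {u..v}" "u \<le> x" "x \<le> v" by blast
            then show ?thesis using \<open>0 < e'\<close> i by simp
          qed
        qed (use fin in auto)
        also have "\<dots> = e' * (b - a)"
          by (simp add: cba(2) sum_distrib_left split_def)
        also have "\<dots> \<le> e / 2"
        proof -
          have "e' * (b - a) \<le> e' * (b - a + 1)" using \<open>0 < e'\<close> by simp
          also have "\<dots> = e / 2"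
          proof -
            have "b - a + 1 \<noteq> 0" using ab by simp
            then show ?thesis unfolding e'_def by (simp add: divide_simps)
          qed
          finally show ?thesis .
        qed
        finally show ?thesis .
      qed
      ultimately show "norm ((\<Sum>(x, K)\<in>p. measure lborel K *\<^sub>R h x) - (c b - c a)) < e"
        by linarith
    qed
  qed
  then have "(h has_integral (c b - c a)) {a..b}" by simp
  then show ?thesis
    by (rule has_integral_spike [OF \<open>negligible N\<close>, rotated]) (auto simp: h_def)
qed

text \<open>Wanted because \<open>integral\<close> is 0 on functions that are not integrable: a
  lower bound for \<open>sr_length\<close> must first make its integrand integrable. On an interval
  shorter than the \<delta> that belongs to \<epsilon> = 1 the variation is at most 1, and finitely
  many such intervals cover [0, 1].\<close>

lemma abs_continuous_derivative_absolutely_integrable: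
  fixes c :: "real \<Rightarrow> 'a::euclidean_space"
  assumes ac: "abs_continuous_on_unit c" and "negligible N"
    and der: "\<And>t. t \<in> {0..1} - N \<Longrightarrow> (c has_vector_derivative c' t) (at t within {0..1})"
  shows "c' absolutely_integrable_on {0..1}"
proof -
  obtain \<delta> where "0 < \<delta>" and \<delta>: "\<forall>p U. p tagged_partial_division_of {0..1} \<and>
     (\<forall>x K. (x, K) \<in> p \<longrightarrow> K \<subseteq> U) \<and> U \<in> lmeasurable \<and> measure lebesgue U < \<delta> \<longrightarrow>
     (\<Sum>(x, K)\<in>p. norm (c (Sup K) - c (Inf K))) < 1"
    using abs_continuous_on_unit_sum_tagged_less [OF ac zero_less_one] by blast
  have short: "c' absolutely_integrable_on {a..b}"
    if ab: "0 \<le> a" "a \<le> b" "b \<le> 1" "b - a < \<delta>" for a b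
  proof -
    have "c' absolutely_integrable_on cbox a b"
    proof (rule bounded_variation_absolutely_integrable_interval [where B = 1])
      show "c' integrable_on cbox a b"
        using abs_continuous_has_integral_derivative [OF ac ab(1-3) assms(2) der] by auto
      fix d assume d: "d division_of cbox a b"
      \<comment> \<open>Tagging each interval by its left endpoint makes the division fit the tagged
        estimate.\<close>
      define p where "p = (\<lambda>K. (Inf K, K)) ` d"
      have K: "\<exists>u v. K = {u..v} \<and> u \<le> v \<and> a \<le> u \<and> v \<le> b" if Kd: "K \<in> d" for K
      proof -
        obtain u v where "K = cbox u v"
          using division_ofD(4) [OF d Kd] by blast
        then show ?thesis
          using division_ofD(2,3) [OF d Kd] by auto
      qed
      have "(\<Sum>K\<in>d. norm (integral K c')) = (\<Sum>K\<in>d. norm (c (Sup K) - c (Inf K)))"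
      proof (rule sum.cong [OF refl])
        fix K assume "K \<in> d"
        then obtain u v where uv: "K = {u..v}" "u \<le> v" "a \<le> u" "v \<le> b" using K by blast
        then have "integral K c' = c v - c u"
          using abs_continuous_has_integral_derivative [OF ac _ _ _ assms(2) der, of u v] ab by auto
        then show "norm (integral K c') = norm (c (Sup K) - c (Inf K))" using uv by simp
      qed
      also have "\<dots> = (\<Sum>(x, K)\<in>p. norm (c (Sup K) - c (Inf K)))"
        unfolding p_def by (subst sum.reindex) (auto simp: inj_on_def)
      also have "\<dots> < 1"
      proof (rule \<delta> [rule_format, where U = "{a..b}"], intro conjI allI impI)
        show "p tagged_partial_division_of {0..1}"
          unfolding tagged_partial_division_of_def p_def
        proof (intro conjI allI impI)
          show "finite ((\<lambda>K. (Inf K, K)) ` d)" using d by auto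
          fix x K assume "(x, K) \<in> (\<lambda>K. (Inf K, K)) ` d"
          then have x: "x = Inf K" "K \<in> d" by auto
          then obtain u v where uv: "K = {u..v}" "u \<le> v" "a \<le> u" "v \<le> b" using K by blast
          show "x \<in> K" "K \<subseteq> {0..1}" "\<exists>a b. K = cbox a b" using x uv ab by auto
        next
          fix x K x' K'
          assume "(x, K) \<in> (\<lambda>K. (Inf K, K)) ` d \<and> (x', K') \<in> (\<lambda>K. (Inf K, K)) ` d \<and> (x, K) \<noteq> (x', K')"
          then show "interior K \<inter> interior K' = {}"
            using division_ofD(5) [OF d] by blast
        qed
        show "K \<subseteq> {a..b}" if "(x, K) \<in> p" for x K
          using that K by (fastforce simp: p_def)
      qed (use ab in auto)
      finally show "(\<Sum>K\<in>d. norm (integral K c')) \<le> 1" by simp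
    qed
    then show ?thesis by simp
  qed
  obtain n :: nat where n1: "1 / \<delta> < real n"
    using reals_Archimedean2 [of "1 / \<delta>"] by blast
  moreover have "0 < 1 / \<delta>" using \<open>0 < \<delta>\<close> by simp
  ultimately have "0 < real n" by linarith
  then have n: "1 / \<delta> < real n" "0 < n" using n1 by auto
  have "c' absolutely_integrable_on {0..real k / real n}" if "k \<le> n" for k
    using that
  proof (induction k)
    case 0
    show ?case using short [of 0 0] \<open>0 < \<delta>\<close> by simp
  next
    case (Suc k)
    have "1 / real n < \<delta>" using n \<open>0 < \<delta>\<close> by (simp add: field_simps)
    moreover have "real (Suc k) / real n - real k / real n = 1 / real n"
      by (simp add: diff_divide_distrib [symmetric])
    moreover have "real (Suc k) / real n \<le> 1" using Suc.prems n by simp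
    ultimately have "c' absolutely_integrable_on {real k / real n..real (Suc k) / real n}"
      using n by (intro short) (auto simp: divide_right_mono)
    moreover have "c' absolutely_integrable_on {0..real k / real n}"
      using Suc by simp
    moreover have "{0..real (Suc k) / real n} = {0..real k / real n} \<union> {real k / real n..real (Suc k) / real n}"
      by (intro ivl_disj_un_two_touch(4) [symmetric]) (auto simp: divide_right_mono)
    ultimately show ?case
      by (metis absolutely_integrable_Un)
  qed
  from this [of n] show ?thesis using n by simp
qed


section \<open>The alternating form of the bracket and orthonormal frames\<close>

text \<open>The symplectic form of R^(2n), extended so that the center is its kernel. Being scalar
  valued, it allows areas and norms to replace brackets.\<close>

definition hform :: "'n::finite heis \<Rightarrow> 'n heis \<Rightarrow> real" where
  "hform u v = (\<Sum>i\<in>UNIV. u $ Some (Inl i) * v $ Some (Inr i) - u $ Some (Inr i) * v $ Some (Inl i))"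

abbreviation hcenter :: "'n::finite heis" where
  "hcenter \<equiv> axis None 1"

lemma hbracket_eq: "hbracket u v = hform u v *\<^sub>R hcenter"
  by (simp add: hbracket_def hform_def)

lemma hcenter_nonzero: "hcenter \<noteq> (0 :: 'n::finite heis)"
  by (simp add: axis_eq_0_iff)

lemma hform_simps:
  "hform (u + u') v = hform u v + hform u' v" "hform u (v + v') = hform u v + hform u v'"
  "hform (r *\<^sub>R u) v = r * hform u v" "hform u (r *\<^sub>R v) = r * hform u v"
  "hform hcenter v = 0" "hform u hcenter = 0" "hform u u = 0" "hform 0 v = 0" "hform u 0 = 0"
  by (simp_all add: hform_def axis_def algebra_simps sum.distrib sum_subtractf sum_distrib_left)

lemma hform_skew: "hform u v = - hform v u"
  by (simp add: hform_def sum_negf [symmetric] algebra_simps)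

lemma hmult_eq: "hmult p q = p + q + (hform p q / 2) *\<^sub>R hcenter"
  by (simp add: hmult_def hbracket_eq)

lemma hform_hmult: "hform (hmult p q) r = hform p r + hform q r" "hform r (hmult p q) = hform r p + hform r q"
  by (simp_all add: hmult_eq hform_simps)

lemma hmult_assoc: "hmult (hmult p q) r = hmult p (hmult q r)"
  by (simp add: hmult_eq hform_simps hform_hmult algebra_simps add_divide_distrib)

lemma hmult_zero [simp]: "hmult 0 p = p" "hmult p 0 = p"
  by (simp_all add: hmult_eq hform_simps)

lemma hform_minus [simp]: "hform (- u) v = - hform u v" "hform u (- v) = - hform u v"
  using hform_simps(3) [of "-1" u v] hform_simps(4) [of u "-1" v] by simp_all

lemma hform_diff [simp]: "hform (u - u') v = hform u v - hform u' v" "hform u (v - v') = hform u v - hform u v'"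
  using hform_simps(1) [of u "- u'" v] hform_simps(2) [of u v "- v'"] by simp_all

lemma hmult_minus [simp]: "hmult p (- p) = 0" "hmult (- p) p = 0"
  by (simp_all add: hmult_eq hform_simps)

lemma hmult_minus_cancel [simp]: "hmult p (hmult (- p) q) = q" "hmult (- p) (hmult p q) = q"
  by (simp_all flip: hmult_assoc)

lemma dleft_eq: "dleft p u = u + (hform p u / 2) *\<^sub>R hcenter"
  and dleft_inv_eq: "dleft_inv p u = u - (hform p u / 2) *\<^sub>R hcenter"
  by (simp_all add: dleft_def dleft_inv_def hbracket_eq)

lemma span_hbracket:
  "span {hbracket a b | a b. a \<in> w \<and> b \<in> w} \<subseteq> range (\<lambda>t. t *\<^sub>R (hcenter :: 'n::finite heis))"
proof (rule span_minimal)
  show "subspace (range (\<lambda>t. t *\<^sub>R (hcenter :: 'n heis)))"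
    using subspace_span [of "{hcenter :: 'n heis}"] by (simp add: span_singleton)
qed (auto simp: hbracket_eq)

text \<open>All brackets are multiples of Z, so a bracket generating w meets every line parallel to
  the center.\<close>

lemma bracket_generating_decomp:
  assumes "bracket_generating w"
  obtains x t where "x \<in> w" "u = x + t *\<^sub>R hcenter"
proof -
  have "u \<in> {x + y | x y. x \<in> w \<and> y \<in> span {hbracket a b | a b. a \<in> w \<and> b \<in> w}}"
    using assms by (simp add: bracket_generating_def)
  then obtain x y where "x \<in> w" "u = x + y" "y \<in> span {hbracket a b | a b. a \<in> w \<and> b \<in> w}"
    by blast
  moreover then obtain t where "y = t *\<^sub>R hcenter" using span_hbracket by blast
  ultimately show thesis using that by blast
qed

text \<open>The dichotomy behind the two cases of Popp's volume: an admissible subspace is the whole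
  algebra or a hyperplane complementary to the center.\<close>

lemma bracket_generating_UNIV_iff:
  assumes "bracket_generating w" "subspace w"
  shows "hcenter \<in> w \<longleftrightarrow> w = UNIV"
proof
  assume z: "hcenter \<in> w"
  have "u \<in> w" for u
  proof -
    obtain x t where "x \<in> w" "u = x + t *\<^sub>R hcenter" by (rule bracket_generating_decomp [OF assms(1)])
    then show ?thesis using z assms(2) by (simp add: subspace_add subspace_scale)
  qed
  then show "w = UNIV" by auto
qed simp

section \<open>Gram--Schmidt for an inner product that is given only on a subspace\<close>

locale inner_product_subspace =
  fixes w :: "'a::euclidean_space set" and g :: "'a \<Rightarrow> 'a \<Rightarrow> real"
  assumes subspace_w: "subspace w" and ip: "inner_product_on w g"
begin

lemma ip_sym: "x \<in> w \<Longrightarrow> y \<in> w \<Longrightarrow> g x y = g y x"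
  using ip by (simp add: inner_product_on_def)

lemma ip_lin: "x \<in> w \<Longrightarrow> y \<in> w \<Longrightarrow> z \<in> w \<Longrightarrow> g (a *\<^sub>R x + b *\<^sub>R y) z = a * g x z + b * g y z"
  using ip by (simp add: inner_product_on_def)

lemma ip_pos: "x \<in> w \<Longrightarrow> x \<noteq> 0 \<Longrightarrow> 0 < g x x"
  using ip by (simp add: inner_product_on_def)

lemma ip_add: "x \<in> w \<Longrightarrow> y \<in> w \<Longrightarrow> z \<in> w \<Longrightarrow> g (x + y) z = g x z + g y z"
  using ip_lin [of x y z 1 1] by simp

lemma ip_diff: "x \<in> w \<Longrightarrow> y \<in> w \<Longrightarrow> z \<in> w \<Longrightarrow> g (x - y) z = g x z - g y z"
  using ip_lin [of x y z 1 "-1"] by simp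

lemma ip_scale: "x \<in> w \<Longrightarrow> z \<in> w \<Longrightarrow> g (a *\<^sub>R x) z = a * g x z"
  using ip_lin [of x x z a 0] by simp

lemma ip_scale_right: "x \<in> w \<Longrightarrow> z \<in> w \<Longrightarrow> g z (a *\<^sub>R x) = a * g z x"
  using ip_scale [of x z a] ip_sym subspace_w by (simp add: subspace_scale)

lemma ip_zero: "z \<in> w \<Longrightarrow> g 0 z = 0"
  using ip_scale [of 0 z 0] subspace_w by (simp add: subspace_0)

lemma ip_add_right: "x \<in> w \<Longrightarrow> y \<in> w \<Longrightarrow> z \<in> w \<Longrightarrow> g z (x + y) = g z x + g z y"
  using ip_add [of x y z] ip_sym subspace_w by (simp add: subspace_add)

lemma ip_sum: "(\<And>i. i \<in> I \<Longrightarrow> x i \<in> w) \<Longrightarrow> z \<in> w \<Longrightarrow> g (\<Sum>i\<in>I. c i *\<^sub>R x i) z = (\<Sum>i\<in>I. c i * g (x i) z)"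
proof (induction I rule: infinite_finite_induct)
  case (insert i I)
  then show ?case
    using subspace_w by (simp add: ip_add ip_scale subspace_sum subspace_scale)
qed (auto simp: ip_zero)

lemma orthonormal_sum:
  assumes "\<And>i. e i \<in> w" "\<And>i j. g (e i) (e j) = (if i = j then 1 else 0)"
  shows "g (\<Sum>i\<in>UNIV. c i *\<^sub>R e i) (e j) = c (j::'i::finite)"
  by (simp add: ip_sum assms if_distrib [of "(*) _"] cong: if_cong)

lemma orthonormal_sum_square:
  assumes "\<And>i. e i \<in> w" "\<And>i j. g (e i) (e j) = (if i = j then 1 else 0)"
  shows "g (\<Sum>i\<in>UNIV. c i *\<^sub>R e i) (\<Sum>i\<in>UNIV. c i *\<^sub>R e i) = (\<Sum>i\<in>UNIV. (c (i::'i::finite))\<^sup>2)"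
proof -
  have W: "(\<Sum>i\<in>UNIV. c i *\<^sub>R e i) \<in> w"
    using subspace_w assms by (intro subspace_sum subspace_scale) auto
  have "g (e i) (\<Sum>i\<in>UNIV. c i *\<^sub>R e i) = c i" for i
    using orthonormal_sum [of e c i] assms W ip_sym by simp
  then show ?thesis
    using assms W by (simp add: ip_sum power2_eq_square)
qed

text \<open>As long as fewer than dim w vectors have been found, some vector of w lies outside their
  span, and its component orthogonal to them is nonzero and can be normalised.\<close>

lemma orthonormal_sequence_exists:
  "k \<le> dim w \<Longrightarrow> \<exists>e::nat \<Rightarrow> 'a. (\<forall>i<k. e i \<in> w) \<and> (\<forall>i<k. \<forall>j<k. g (e i) (e j) = (if i = j then 1 else 0))"
proof (induction k)
  case 0
  show ?case by simp
next
  case (Suc k)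
  then obtain e where e: "\<And>i. i < k \<Longrightarrow> e i \<in> w"
    and on: "\<And>i j. i < k \<Longrightarrow> j < k \<Longrightarrow> g (e i) (e j) = (if i = j then 1 else 0)"
    by auto
  have "card (e ` {..<k}) < dim w"
    using Suc.prems card_image_le [of "{..<k}" e] by simp
  then have "dim (e ` {..<k}) < dim w"
    using dim_le_card' [of "e ` {..<k}"] by simp
  then have "\<not> w \<subseteq> span (e ` {..<k})"
    using dim_subset [of w "span (e ` {..<k})"] by auto
  then obtain x where x: "x \<in> w" "x \<notin> span (e ` {..<k})" by blast
  define y where "y = x + (\<Sum>i<k. (- g x (e i)) *\<^sub>R e i)"
  have s: "(\<Sum>i<k. (- g x (e i)) *\<^sub>R e i) \<in> w"
    using subspace_w e by (intro subspace_sum subspace_scale) auto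
  then have yw: "y \<in> w" using x subspace_w by (simp add: y_def subspace_add)
  have "y \<noteq> 0"
  proof
    assume "y = 0"
    then have "x = (\<Sum>i<k. g x (e i) *\<^sub>R e i)" by (simp add: y_def sum_negf)
    also have "\<dots> \<in> span (e ` {..<k})" by (intro span_sum span_scale span_base) auto
    finally show False using x by simp
  qed
  then have gy: "0 < g y y" using yw ip_pos by blast
  have ye: "g y (e j) = 0" if "j < k" for j
  proof -
    have "g (\<Sum>i<k. (- g x (e i)) *\<^sub>R e i) (e j) = (\<Sum>i<k. - g x (e i) * g (e i) (e j))"
      by (rule ip_sum) (use e that in auto)
    also have "\<dots> = - g x (e j)"
      using that by (simp add: on sum_negf if_distrib [of "(*) _"] cong: if_cong)
    finally show ?thesis
      by (simp only: y_def ip_add [OF x(1) s e [OF that]])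
  qed
  define u where "u = (1 / sqrt (g y y)) *\<^sub>R y"
  have uw: "u \<in> w" using yw subspace_w by (simp add: u_def subspace_scale)
  have uu: "g u u = 1"
    using gy yw uw by (simp add: u_def ip_scale ip_scale_right subspace_scale subspace_w real_sqrt_mult_self flip: power2_eq_square)
  have ue: "g u (e j) = 0" "g (e j) u = 0" if "j < k" for j
    using ye [OF that] e [OF that] yw by (simp_all add: u_def ip_scale ip_scale_right ip_sym [of "e j" y])
  show ?case
    by (rule exI [of _ "e(k := u)"]) (auto simp: less_Suc_eq e on uw uu ue)
qed

lemma orthonormal_basis_exists:
  assumes "dim w = CARD('i::finite)"
  shows "\<exists>e::'i \<Rightarrow> 'a. (\<forall>i. e i \<in> w) \<and> (\<forall>i j. g (e i) (e j) = (if i = j then 1 else 0))"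
proof -
  obtain e :: "nat \<Rightarrow> 'a" where e: "\<forall>i<CARD('i). e i \<in> w"
    "\<forall>i<CARD('i). \<forall>j<CARD('i). g (e i) (e j) = (if i = j then 1 else 0)"
    using orthonormal_sequence_exists [of "CARD('i)"] assms by auto
  obtain h where h: "bij_betw h (UNIV :: 'i set) {0..<CARD('i)}"
    using ex_bij_betw_finite_nat [of "UNIV :: 'i set"] by auto
  then have "h i < CARD('i)" "h i = h j \<longleftrightarrow> i = j" for i j
    by (auto simp: bij_betw_def inj_on_def)
  with e show ?thesis by (intro exI [of _ "\<lambda>i. e (h i)"]) auto
qed

lemma orthonormal_span:
  assumes "\<And>i. e i \<in> w" "\<And>i j. g (e i) (e j) = (if i = j then 1 else 0)" "dim w = CARD('i::finite)"
  shows "span (range (e :: 'i \<Rightarrow> 'a)) = w"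
proof -
  have inj: "inj e"
  proof (rule injI)
    fix i j assume "e i = e j"
    then show "i = j" using assms(2) [of i j] assms(2) [of i i] by (auto split: if_splits)
  qed
  have "independent (range e)"
  proof (rule independent_if_scalars_zero)
    fix f x assume s: "(\<Sum>x\<in>range e. f x *\<^sub>R x) = 0" and "x \<in> range e"
    then obtain j where x: "x = e j" by blast
    have "(\<Sum>i\<in>UNIV. f (e i) *\<^sub>R e i) = 0" using s by (simp add: sum.reindex [OF inj])
    then have "g 0 (e j) = f (e j)" using orthonormal_sum [OF assms(1,2), of "\<lambda>i. f (e i)" j] by simp
    then show "f x = 0" using ip_zero assms(1) x by simp
  qed simp
  moreover have "card (range e) = dim w" using card_image [OF inj] assms(3) by simp
  moreover have "range e \<subseteq> w" using assms(1) by auto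
  ultimately have "w \<subseteq> span (range e)" by (intro card_ge_dim_independent) auto
  moreover have "span (range e) \<subseteq> w"
    using \<open>range e \<subseteq> w\<close> subspace_w by (simp add: span_minimal)
  ultimately show ?thesis by simp
qed

end

text \<open>If Z is horizontal, the frame spans the g-orthogonal complement of Z; otherwise it spans
  v. Both are complements of the center, of dimension 2n, so the Riemannian and the properly
  sub-Riemannian case share one type of frame.\<close>

lemma frame_exists:
  fixes v :: "'n::finite heis set"
  assumes "subriemannian v g"
  obtains e :: "'n + 'n \<Rightarrow> 'n heis" where "\<And>i. e i \<in> v"
    "\<And>i j. g (e i) (e j) = (if i = j then 1 else 0)" "\<And>i. hcenter \<in> v \<Longrightarrow> g (e i) hcenter = 0"
proof -
  have v: "subspace v" "bracket_generating v" "inner_product_on v g"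
    using assms by (auto simp: subriemannian_def)
  interpret inner_product_subspace v g using v by unfold_locales
  define v0 where "v0 = {u \<in> v. hcenter \<in> v \<longrightarrow> g u hcenter = 0}"
  have sub0: "subspace v0"
    unfolding v0_def using v(1)
    by (intro subspaceI) (auto simp: subspace_0 subspace_add subspace_scale ip_zero ip_add ip_scale)
  have "v0 \<subseteq> v" by (auto simp: v0_def)
  have int: "v0 \<inter> span {hcenter} = {0}"
  proof -
    have "u = 0" if "u \<in> v0" "u = t *\<^sub>R hcenter" for u t
    proof (rule ccontr)
      assume "u \<noteq> 0"
      then have "t \<noteq> 0" using that by auto
      have "(1 / t) *\<^sub>R u \<in> v" using that \<open>v0 \<subseteq> v\<close> v(1) by (blast intro: subspace_scale)
      moreover have "(1 / t) *\<^sub>R u = hcenter" using that \<open>t \<noteq> 0\<close> by simp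
      ultimately have c: "hcenter \<in> v" by simp
      then have "t * g hcenter hcenter = 0" using that by (simp add: v0_def ip_scale)
      then show False using ip_pos [OF c hcenter_nonzero] \<open>t \<noteq> 0\<close> by simp
    qed
    then show ?thesis using sub0 by (auto simp: span_singleton subspace_0)
  qed
  have sum: "{x + y |x y. x \<in> v0 \<and> y \<in> span {hcenter}} = UNIV"
  proof -
    have "\<exists>x y. u = x + y \<and> x \<in> v0 \<and> y \<in> span {hcenter}" for u
    proof (cases "hcenter \<in> v")
      case True
      then have "v = UNIV" using bracket_generating_UNIV_iff v by blast
      have c: "0 < g hcenter hcenter" using ip_pos [OF True hcenter_nonzero] .
      let ?y = "(g u hcenter / g hcenter hcenter) *\<^sub>R hcenter"
      have "u - ?y \<in> v0" using c \<open>v = UNIV\<close> by (simp add: v0_def ip_diff ip_scale)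
      then show ?thesis by (intro exI [of _ "u - ?y"] exI [of _ ?y]) (auto simp: span_singleton)
    next
      case False
      obtain x t where "x \<in> v" "u = x + t *\<^sub>R hcenter" by (rule bracket_generating_decomp [OF v(2)])
      then show ?thesis using False by (auto simp: v0_def span_singleton)
    qed
    then show ?thesis by auto
  qed
  have "dim v0 + dim (span {hcenter :: 'n heis}) = DIM('n heis)"
    using dim_sums_Int [OF sub0 subspace_span [of "{hcenter}"]] sum int by (simp add: dim_UNIV)
  moreover have "dim (span {hcenter :: 'n heis}) = 1"
    using hcenter_nonzero by (simp add: dim_span dim_insert)
  moreover have "DIM('n heis) = CARD('n + 'n) + 1"
    by (simp add: card_option)
  ultimately have dim: "dim v0 = CARD('n + 'n)" by simp
  interpret v0: inner_product_subspace v0 g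
  proof
    show "inner_product_on v0 g"
      using v(3) \<open>v0 \<subseteq> v\<close> unfolding inner_product_on_def by blast
  qed (rule sub0)
  obtain e :: "'n + 'n \<Rightarrow> 'n heis" where "\<forall>i. e i \<in> v0" "\<forall>i j. g (e i) (e j) = (if i = j then 1 else 0)"
    using v0.orthonormal_basis_exists [OF dim] by blast
  then show thesis using that [of e] by (auto simp: v0_def)
qed

text \<open>\<open>base\<close> is the projection \<open>H\<^sub>n \<longrightarrow> H\<^sub>n / Z\<close> in the coordinates in which it does not
  increase \<open>g\<close>-lengths, \<open>lift\<close> is its isometric horizontal section, and \<open>develop\<close> turns \<open>g\<close> into
  the Euclidean inner product, with \<open>center_norm = 0\<close> recording that the center is not horizontal.\<close>

locale sr_frame =
  fixes v :: "'n::finite heis set" and g :: "'n heis \<Rightarrow> 'n heis \<Rightarrow> real" and e :: "'n + 'n \<Rightarrow> 'n heis"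
  assumes sr: "subriemannian v g" and e_in: "\<And>i. e i \<in> v"
    and e_orthonormal: "\<And>i j. g (e i) (e j) = (if i = j then 1 else 0)"
    and e_center: "\<And>i. hcenter \<in> v \<Longrightarrow> g (e i) hcenter = 0"
begin

sublocale inner_product_subspace v g
  using sr by unfold_locales (auto simp: subriemannian_def)

definition lift :: "real ^ ('n + 'n) \<Rightarrow> 'n heis" where
  "lift x = (\<Sum>i\<in>UNIV. x $ i *\<^sub>R e i)"

definition frame_map :: "'n heis \<Rightarrow> 'n heis" where
  "frame_map y = lift (\<chi> i. y $ Some i) + y $ None *\<^sub>R hcenter"

definition frame_coords :: "'n heis \<Rightarrow> 'n heis" where
  "frame_coords = inv_into UNIV frame_map"

definition base :: "'n heis \<Rightarrow> real ^ ('n + 'n)" where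
  "base u = (\<chi> i. frame_coords u $ Some i)"

text \<open>The coordinate along Z relative to the frame. It differs from the component
  \<open>None\<close>, since the frame vectors may have Z-components in the standard basis.\<close>

definition height :: "'n heis \<Rightarrow> real" where
  "height u = frame_coords u $ None"

definition center_norm :: real where
  "center_norm = (if hcenter \<in> v then sqrt (g hcenter hcenter) else 0)"

definition develop :: "'n heis \<Rightarrow> 'n heis" where
  "develop u = (\<chi> k. case k of None \<Rightarrow> center_norm * height u | Some i \<Rightarrow> base u $ i)"

lemma linear_lift: "linear lift"
  by (rule linearI) (auto simp: lift_def algebra_simps sum.distrib scaleR_sum_right)

lemma lift_in: "lift x \<in> v"
  unfolding lift_def using subspace_w e_in by (intro subspace_sum subspace_scale) auto

lemma lift_square: "g (lift x) (lift x) = (norm x)\<^sup>2"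
  unfolding lift_def
  by (subst orthonormal_sum_square [OF e_in e_orthonormal]) (simp add: norm_vec_def L2_set_def sum_nonneg)

lemma lift_center: "hcenter \<in> v \<Longrightarrow> g (lift x) hcenter = 0"
  unfolding lift_def by (simp add: ip_sum e_in e_center)

lemma linear_frame_map: "linear frame_map"
proof (rule linearI)
  have *: "(\<chi> i. (x + y) $ Some i) = (\<chi> i. x $ Some i) + (\<chi> i. y $ Some i)"
    "(\<chi> i. (r *\<^sub>R x) $ Some i) = r *\<^sub>R (\<chi> i. x $ Some i)" for x y :: "'n heis" and r
    by (simp_all add: vec_eq_iff)
  show "frame_map (x + y) = frame_map x + frame_map y" "frame_map (r *\<^sub>R x) = r *\<^sub>R frame_map x" for x y r
    unfolding frame_map_def * linear_add [OF linear_lift] linear_scale [OF linear_lift]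
    by (simp_all add: algebra_simps)
qed

text \<open>A relation lift x = - t Z with t nonzero would put Z into v, where the frame is
  orthogonal to it, so that g Z Z = 0. With t = 0, \<open>lift_square\<close> gives x = 0.\<close>

lemma inj_frame_map: "inj frame_map"
proof (rule linear_injective_0 [OF linear_frame_map, THEN iffD2], intro allI impI)
  fix y assume y0: "frame_map y = 0"
  let ?x = "\<chi> i. y $ Some i"
  have eq: "lift ?x = (- (y $ None)) *\<^sub>R hcenter"
    using y0 by (simp add: frame_map_def add_eq_0_iff)
  have "y $ None = 0"
  proof (rule ccontr)
    assume ne: "y $ None \<noteq> 0"
    then have "hcenter = (- 1 / (y $ None)) *\<^sub>R lift ?x" by (simp add: eq)
    then have c: "hcenter \<in> v" using lift_in subspace_w by (metis subspace_scale)
    have "(- (y $ None)) * g hcenter hcenter = g (lift ?x) hcenter"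
      unfolding eq by (simp only: ip_scale [OF c c])
    then have "g hcenter hcenter = 0" using lift_center [OF c] ne by simp
    then show False using ip_pos [OF c hcenter_nonzero] by simp
  qed
  moreover from this have "(norm ?x)\<^sup>2 = 0"
    using lift_square [of ?x] eq ip_zero [OF subspace_0 [OF subspace_w]] by simp
  then have "y $ Some i = 0" for i by (simp add: vec_eq_iff)
  ultimately show "y = 0" by (auto simp: vec_eq_iff split_option_all)
qed

lemma frame_map_coords: "frame_map (frame_coords u) = u" "frame_coords (frame_map u) = u"
  using linear_injective_imp_surjective [OF linear_frame_map inj_frame_map] inj_frame_map
  by (simp_all add: frame_coords_def surj_f_inv_f)

lemma linear_frame_coords: "linear (frame_coords)"
proof (rule linearI)
  show "frame_coords (x + y) = frame_coords x + frame_coords y" for x y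
    by (metis frame_map_coords linear_add [OF linear_frame_map])
  show "frame_coords (r *\<^sub>R x) = r *\<^sub>R frame_coords x" for r x
    by (metis frame_map_coords linear_scale [OF linear_frame_map])
qed

lemma linear_base: "linear base"
  by (rule linearI)
    (simp_all add: base_def vec_eq_iff linear_add [OF linear_frame_coords] linear_scale [OF linear_frame_coords])

lemma linear_height: "linear height"
  by (rule linearI)
    (simp_all add: height_def linear_add [OF linear_frame_coords] linear_scale [OF linear_frame_coords])

lemmas base_simps = linear_add [OF linear_base] linear_scale [OF linear_base] linear_0 [OF linear_base]
  linear_diff [OF linear_base] linear_neg [OF linear_base]

lemmas height_simps = linear_add [OF linear_height] linear_scale [OF linear_height] linear_0 [OF linear_height]
  linear_diff [OF linear_height] linear_neg [OF linear_height]

lemmas lift_simps = linear_add [OF linear_lift] linear_scale [OF linear_lift] linear_0 [OF linear_lift]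
  linear_diff [OF linear_lift] linear_neg [OF linear_lift]

lemma lift_base: "lift (base u) + height u *\<^sub>R hcenter = u"
  using frame_map_coords(1) [of u] by (simp add: frame_map_def base_def height_def)

lemma base_lift_center [simp]: "base (lift x + t *\<^sub>R hcenter) = x" "height (lift x + t *\<^sub>R hcenter) = t"
proof -
  define y :: "'n heis" where "y = (\<chi> k. case k of None \<Rightarrow> t | Some i \<Rightarrow> x $ i)"
  have "frame_map y = lift x + t *\<^sub>R hcenter"
    by (simp add: frame_map_def y_def)
  then have "frame_coords (lift x + t *\<^sub>R hcenter) = y" using frame_map_coords(2) by metis
  then show "base (lift x + t *\<^sub>R hcenter) = x" "height (lift x + t *\<^sub>R hcenter) = t"
    by (simp_all add: base_def height_def y_def)
qed

lemma base_lift [simp]: "base (lift x) = x" "height (lift x) = 0"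
  using base_lift_center [of x 0] by simp_all

lemma base_center [simp]: "base hcenter = 0" "height hcenter = 1"
  using base_lift_center [of 0 1] by (simp_all add: lift_simps)

lemma base_eq_0: "base u = 0 \<Longrightarrow> u = height u *\<^sub>R hcenter"
  using lift_base [of u] by (simp add: lift_simps)

lemma base_hmult [simp]: "base (hmult p q) = base p + base q"
  by (simp add: hmult_eq base_simps)

lemma base_dleft [simp]: "base (dleft p u) = base u" "base (dleft_inv p u) = base u"
  by (simp_all add: dleft_eq dleft_inv_eq base_simps)

text \<open>The vertical part of u is a difference of two vectors of v; if it were a nonzero
  multiple of Z, rescaling it would put Z into v.\<close>

lemma height_eq_0: "u \<in> v \<Longrightarrow> hcenter \<notin> v \<Longrightarrow> height u = 0"
proof (rule ccontr)
  assume u: "u \<in> v" "hcenter \<notin> v" "height u \<noteq> 0"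
  have "u - lift (base u) \<in> v" using u lift_in subspace_w by (simp add: subspace_diff)
  then have "(1 / height u) *\<^sub>R (u - lift (base u)) \<in> v" using subspace_w by (rule subspace_scale [rotated])
  moreover have "u - lift (base u) = height u *\<^sub>R hcenter"
    using lift_base [of u] by (metis add_diff_cancel_left')
  ultimately show False using u by simp
qed

lemma linear_develop: "linear develop"
  by (rule linearI)
    (auto simp: develop_def vec_eq_iff base_simps height_simps algebra_simps split: option.split)

lemma norm_develop: "(norm (develop u))\<^sup>2 = (norm (base u))\<^sup>2 + (center_norm * height u)\<^sup>2"
proof -
  have "(norm (develop u))\<^sup>2 = (\<Sum>k\<in>UNIV. (develop u $ k)\<^sup>2)"
    by (simp add: norm_vec_def L2_set_def sum_nonneg)
  also have "\<dots> = (\<Sum>i\<in>UNIV. (base u $ i)\<^sup>2) + (center_norm * height u)\<^sup>2"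
    by (simp add: UNIV_option_conv sum.reindex develop_def)
  finally show ?thesis by (simp add: norm_vec_def L2_set_def sum_nonneg)
qed

lemma norm_base_le: "norm (base u) \<le> norm (develop u)"
  by (rule power2_le_imp_le) (simp_all add: norm_develop)

text \<open>An inner product that is controlled only on v becomes the squared norm of a linear map
  on the whole algebra, so integrability of speeds follows from linearity. If Z is not horizontal,
  heights vanish on v, which agrees with the default \<open>center_norm\<close> = 0.\<close>

lemma ip_develop:
  assumes "u \<in> v"
  shows "g u u = (norm (develop u))\<^sup>2"
proof (cases "hcenter \<in> v")
  case True
  let ?x = "lift (base u)" and ?y = "height u *\<^sub>R (hcenter :: 'n heis)"
  have "g (?x + ?y) (?x + ?y) = g ?x ?x + 2 * (height u * g ?x hcenter) + (height u)\<^sup>2 * g hcenter hcenter"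
    using True lift_in subspace_w ip_sym [OF True lift_in]
    by (simp add: ip_add ip_add_right ip_scale ip_scale_right subspace_scale subspace_add power2_eq_square algebra_simps)
  also have "\<dots> = (norm (base u))\<^sup>2 + (center_norm * height u)\<^sup>2"
    using True ip_pos [OF True hcenter_nonzero]
    by (simp add: lift_square lift_center center_norm_def power_mult_distrib)
  finally show ?thesis by (simp add: lift_base norm_develop)
next
  case False
  then have "u = lift (base u)" using lift_base [of u] height_eq_0 [OF assms] by simp
  then have "g u u = (norm (base u))\<^sup>2" by (metis lift_square)
  then show ?thesis using False by (simp add: norm_develop center_norm_def)
qed

lemma sqrt_ip_develop: "u \<in> v \<Longrightarrow> sqrt (g u u) = norm (develop u)"
  by (simp add: ip_develop)

lemma develop_lift [simp]: "norm (develop (lift x)) = norm x"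
  using norm_develop [of "lift x"] by (metis (no_types) add.right_neutral base_lift mult_zero_right norm_ge_zero power2_eq_iff_nonneg zero_power2)

end


section \<open>Lengths of horizontal paths\<close>

lemma abs_continuous_on_unit_imp_continuous:
  assumes "abs_continuous_on_unit c"
  shows "continuous_on {0..1} c"
  unfolding continuous_on_iff
proof (intro ballI allI impI)
  fix t :: real and \<epsilon> :: real assume "t \<in> {0..1}" "0 < \<epsilon>"
  obtain \<delta> where "0 < \<delta>" and \<delta>: "\<And>(N::nat) a b. (\<forall>i<N. 0 \<le> a i \<and> a i \<le> b i \<and> b i \<le> 1) \<and>
        disjoint_family_on (\<lambda>i. {a i<..<b i}) {..<N} \<and> (\<Sum>i<N. b i - a i) < \<delta> \<Longrightarrow>
        (\<Sum>i<N. norm (c (b i) - c (a i))) < \<epsilon>"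
    using assms \<open>0 < \<epsilon>\<close> unfolding abs_continuous_on_unit_def by blast
  have *: "norm (c b - c a) < \<epsilon>" if "0 \<le> a" "a \<le> b" "b \<le> 1" "b - a < \<delta>" for a b
    using \<delta> [of 1 "\<lambda>_. a" "\<lambda>_. b"] that by (simp add: disjoint_family_on_def)
  have "dist (c s) (c t) < \<epsilon>" if "s \<in> {0..1}" "dist s t < \<delta>" for s
    using * [of s t] * [of t s] that \<open>t \<in> {0..1}\<close>
    by (cases "s \<le> t") (auto simp: dist_norm norm_minus_commute)
  then show "\<exists>d>0. \<forall>s\<in>{0..1}. dist s t < d \<longrightarrow> dist (c s) (c t) < \<epsilon>"
    using \<open>0 < \<delta>\<close> by blast
qed

lemma lipschitz_imp_abs_continuous_on_unit:
  assumes "\<And>s t. 0 \<le> s \<Longrightarrow> s \<le> t \<Longrightarrow> t \<le> 1 \<Longrightarrow> norm (c t - c s) \<le> L * (t - s)"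
  shows "abs_continuous_on_unit c"
  unfolding abs_continuous_on_unit_def
proof (intro allI impI)
  fix \<epsilon> :: real assume "0 < \<epsilon>"
  define \<delta> where "\<delta> = \<epsilon> / (\<bar>L\<bar> + 1)"
  have "0 < \<delta>" using \<open>0 < \<epsilon>\<close> by (simp add: \<delta>_def)
  show "\<exists>\<delta>>0. \<forall>(N::nat) a b.
        (\<forall>i<N. 0 \<le> a i \<and> a i \<le> b i \<and> b i \<le> 1) \<and>
        disjoint_family_on (\<lambda>i. {a i<..<b i}) {..<N} \<and> (\<Sum>i<N. b i - a i) < \<delta> \<longrightarrow>
        (\<Sum>i<N. norm (c (b i) - c (a i))) < \<epsilon>"
  proof (intro exI [of _ \<delta>] conjI allI impI \<open>0 < \<delta>\<close>)
    fix N :: nat and a b :: "nat \<Rightarrow> real"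
    assume A: "(\<forall>i<N. 0 \<le> a i \<and> a i \<le> b i \<and> b i \<le> 1) \<and>
        disjoint_family_on (\<lambda>i. {a i<..<b i}) {..<N} \<and> (\<Sum>i<N. b i - a i) < \<delta>"
    have "(\<Sum>i<N. norm (c (b i) - c (a i))) \<le> (\<Sum>i<N. (\<bar>L\<bar> + 1) * (b i - a i))"
    proof (rule sum_mono)
      fix i assume "i \<in> {..<N}"
      then have i: "0 \<le> a i" "a i \<le> b i" "b i \<le> 1" using A by auto
      have "norm (c (b i) - c (a i)) \<le> L * (b i - a i)" by (rule assms [OF i])
      also have "\<dots> \<le> (\<bar>L\<bar> + 1) * (b i - a i)" using i by (intro mult_right_mono) auto
      finally show "norm (c (b i) - c (a i)) \<le> (\<bar>L\<bar> + 1) * (b i - a i)" .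
    qed
    also have "\<dots> = (\<bar>L\<bar> + 1) * (\<Sum>i<N. b i - a i)" by (simp add: sum_distrib_left)
    also have "\<dots> < (\<bar>L\<bar> + 1) * \<delta>" using A by (intro mult_strict_left_mono) auto
    also have "\<dots> = \<epsilon>" by (simp add: \<delta>_def)
    finally show "(\<Sum>i<N. norm (c (b i) - c (a i))) < \<epsilon>" .
  qed
qed

context sr_frame
begin

lemma horizontal_path_velocity:
  assumes "horizontal_path v c"
  shows "\<exists>N. negligible N \<and> (\<forall>t\<in>{0..1} - N. (c has_vector_derivative velocity c t) (at t within {0..1})
    \<and> dleft_inv (c t) (velocity c t) \<in> v)"
proof -
  have iff: "(AE t in lebesgue_on {0..1}. Q t) \<longleftrightarrow> (AE t in lebesgue. t \<in> {0..1} \<longrightarrow> Q t)" for Q :: "real \<Rightarrow> bool"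
    by (rule AE_restrict_space_iff) simp
  have "AE t in lebesgue. t \<in> {0..1} \<longrightarrow>
      c differentiable (at t within {0..1}) \<and> velocity c t \<in> distribution v (c t)"
    using assms by (simp only: horizontal_path_def iff)
  then obtain N where N: "N \<in> null_sets lebesgue" "{t \<in> space lebesgue. \<not> (t \<in> {0..1} \<longrightarrow>
      c differentiable (at t within {0..1}) \<and> velocity c t \<in> distribution v (c t))} \<subseteq> N"
    unfolding eventually_ae_filter by blast
  show ?thesis
  proof (intro exI [of _ N] conjI ballI)
    show "negligible N" using N by (simp add: negligible_iff_null_sets)
    fix t :: real assume t: "t \<in> {0..1} - N"
    then have *: "c differentiable (at t within {0..1})" "velocity c t \<in> distribution v (c t)"
      using N(2) by auto
    show "(c has_vector_derivative velocity c t) (at t within {0..1})"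
      by (rule vector_derivative_works [THEN iffD1, OF *(1)])
    show "dleft_inv (c t) (velocity c t) \<in> v"
      using *(2) by (auto simp: distribution_def dleft_dleft_inv)
  qed
qed

text \<open>Left translation does not change \<open>base\<close>, and \<open>base\<close> does not
  increase g-norms. The base component of the velocity, which integrates to the difference of the
  endpoints, is therefore bounded pointwise by the speed.\<close>

lemma sr_length_ge:
  assumes "horizontal_path v c"
  shows "norm (base (c 1) - base (c 0)) \<le> sr_length g c"
proof -
  obtain N where N: "negligible N" and *: "\<forall>t\<in>{0..1} - N.
      (c has_vector_derivative velocity c t) (at t within {0..1}) \<and> dleft_inv (c t) (velocity c t) \<in> v"
    using horizontal_path_velocity [OF assms] by blast
  then have der: "\<And>t. t \<in> {0..1} - N \<Longrightarrow> (c has_vector_derivative velocity c t) (at t within {0..1})"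
    and hor: "\<And>t. t \<in> {0..1} - N \<Longrightarrow> dleft_inv (c t) (velocity c t) \<in> v"
    by blast+
  have ac: "abs_continuous_on_unit c" using assms by (simp add: horizontal_path_def)
  have int: "(velocity c has_integral (c 1 - c 0)) {0..1}"
    using abs_continuous_has_integral_derivative [OF ac _ _ _ N der, of 0 1] by simp
  have "((base \<circ> velocity c) has_integral base (c 1 - c 0)) {0..1}"
    by (rule has_integral_linear [OF int linear_conv_bounded_linear [THEN iffD1, OF linear_base]])
  then have int_base: "((\<lambda>t. base (velocity c t)) has_integral (base (c 1) - base (c 0))) {0..1}"
    by (simp add: o_def base_simps)
  \<comment> \<open>Translating the velocity back to the identity costs a term bilinear in position
    and velocity, a bounded measurable function times an absolutely integrable one. This is what
    makes the speed integrable.\<close>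
  define h where "h p u = develop (hbracket p u)" for p u
  have "bilinear h"
    unfolding bilinear_def h_def hbracket_eq
    by (auto intro!: linearI simp: hform_simps linear_add [OF linear_develop] linear_scale [OF linear_develop]
        scaleR_add_left)
  have ai: "velocity c absolutely_integrable_on {0..1}"
    by (rule abs_continuous_derivative_absolutely_integrable [OF ac N der])
  have cont: "continuous_on {0..1} c" by (rule abs_continuous_on_unit_imp_continuous [OF ac])
  have ai1: "(\<lambda>t. h (c t) (velocity c t)) absolutely_integrable_on {0..1}"
  proof (rule absolutely_integrable_bounded_measurable_product [OF \<open>bilinear h\<close> _ _ _ ai])
    show "c \<in> borel_measurable (lebesgue_on {0..1})"
      using cont by (intro continuous_imp_measurable_on_sets_lebesgue) auto
    show "bounded (c ` {0..1})"
      using compact_continuous_image [OF cont] compact_imp_bounded by blast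
  qed simp
  have "(develop \<circ> velocity c) absolutely_integrable_on {0..1}"
    by (rule absolutely_integrable_linear [OF ai linear_conv_bounded_linear [THEN iffD1, OF linear_develop]])
  then have ai2: "(\<lambda>t. develop (velocity c t)) absolutely_integrable_on {0..1}"
    unfolding comp_def .
  have "(\<lambda>t. develop (velocity c t) - (1/2) *\<^sub>R h (c t) (velocity c t)) absolutely_integrable_on {0..1}"
    by (rule set_integral_diff(1) [OF ai2 absolutely_integrable_scaleR_left [OF ai1]])
  moreover have "develop (dleft_inv p u) = develop u - (1/2) *\<^sub>R h p u" for p u
    by (simp add: dleft_inv_def h_def linear_diff [OF linear_develop] linear_scale [OF linear_develop])
  ultimately have "(\<lambda>t. develop (dleft_inv (c t) (velocity c t))) absolutely_integrable_on {0..1}"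
    by simp
  then have ni: "(\<lambda>t. norm (develop (dleft_inv (c t) (velocity c t)))) integrable_on {0..1}"
    by (rule absolutely_integrable_on_def [THEN iffD1, THEN conjunct2])
  have "norm (base (c 1) - base (c 0)) = norm (integral {0..1} (\<lambda>t. base (velocity c t)))"
    using int_base by (simp add: integral_unique)
  also have "\<dots> \<le> integral {0..1} (\<lambda>t. norm (develop (dleft_inv (c t) (velocity c t))))"
  proof (rule Henstock_Kurzweil_Integration.integral_norm_bound_integral [OF _ ni])
    show "(\<lambda>t. base (velocity c t)) integrable_on {0..1}" using int_base by blast
    show "norm (base (velocity c t)) \<le> norm (develop (dleft_inv (c t) (velocity c t)))" for t
      by (metis base_dleft(2) norm_base_le)
  qed
  \<comment> \<open>The norm of the developed velocity is the speed only where the velocity is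
    horizontal, that is, off the null set N.\<close>
  also have "\<dots> = sr_length g c"
    unfolding sr_length_def
    by (rule integral_spike [OF N]) (simp add: sr_metric_def sqrt_ip_develop hor)
  finally show ?thesis .
qed

end

lemma has_vector_derivative_scaleR_const:
  "(f has_real_derivative f') (at t within S) \<Longrightarrow> ((\<lambda>t. f t *\<^sub>R u) has_vector_derivative f' *\<^sub>R u) (at t within S)"
  using has_vector_derivative_scaleR [of f f' t S "\<lambda>_. u" 0] by simp

context sr_frame
begin

text \<open>Curves are prescribed by a control \<xi>, the velocity translated back to the identity.
  Horizontality is then membership of \<xi> in v, and a continuous control bounds the velocity, so
  the curve is Lipschitz and hence absolutely continuous.\<close>

lemma horizontal_curve:
  assumes der: "\<And>t. t \<in> {0..1} \<Longrightarrow> (c has_vector_derivative dleft (c t) (\<xi> t)) (at t within {0..1})"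
    and cont: "continuous_on {0..1} \<xi>" and "\<And>t. \<xi> t \<in> v"
    and K: "\<And>t. t \<in> {0..1} \<Longrightarrow> norm (develop (\<xi> t)) \<le> K"
  shows "horizontal_path v c" "sr_length g c \<le> K"
proof -
  have vel: "velocity c t = dleft (c t) (\<xi> t)" if "t \<in> {0..1}" for t
    using vector_derivative_within_cbox [of 0 1 t c] der [OF that] that by simp
  have contc: "continuous_on {0..1} c"
    by (rule continuous_on_vector_derivative [OF der])
  have "continuous_on {0..1} (\<lambda>t. dleft (c t) (\<xi> t))"
    unfolding dleft_eq hform_def using contc cont
    by (intro continuous_intros) auto
  then have "bounded ((\<lambda>t. dleft (c t) (\<xi> t)) ` {0..1})"
    by (intro compact_imp_bounded compact_continuous_image compact_Icc)
  then obtain L where "\<forall>y\<in>(\<lambda>t. dleft (c t) (\<xi> t)) ` {0..1}. norm y \<le> L"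
    unfolding bounded_iff by blast
  then have L: "norm (dleft (c t) (\<xi> t)) \<le> L" if "t \<in> {0..1}" for t
    using that by blast
  have "norm (c t - c s) \<le> L * (t - s)" if "0 \<le> s" "s \<le> t" "t \<le> 1" for s t
  proof -
    have "norm (c t - c s) \<le> L * norm (t - s)"
    proof (rule differentiable_bound [of "{0..1}"])
      show "(c has_derivative (\<lambda>h. h *\<^sub>R dleft (c x) (\<xi> x))) (at x within {0..1})" if "x \<in> {0..1}" for x
        using der [OF that] by (simp add: has_vector_derivative_def)
      show "onorm (\<lambda>h. h *\<^sub>R dleft (c x) (\<xi> x)) \<le> L" if "x \<in> {0..1}" for x
        using L [OF that] by (intro onorm_le) (auto simp: mult.commute [of L] intro: mult_left_mono)
    qed (use that in auto)
    then show ?thesis using that by simp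
  qed
  then have "abs_continuous_on_unit c" by (rule lipschitz_imp_abs_continuous_on_unit)
  moreover have "AE t in lebesgue_on {0..1}. c differentiable (at t within {0..1}) \<and> velocity c t \<in> distribution v (c t)"
  proof (rule AE_I2)
    fix t :: real assume "t \<in> space (lebesgue_on {0..1})"
    then have t: "t \<in> {0..1}" by simp
    show "c differentiable (at t within {0..1}) \<and> velocity c t \<in> distribution v (c t)"
      using der [OF t] assms(3) vel [OF t]
      by (auto simp: distribution_def intro: differentiableI_vector)
  qed
  ultimately show "horizontal_path v c" by (simp add: horizontal_path_def)
  have "sr_length g c = integral {0..1} (\<lambda>t. norm (develop (\<xi> t)))"
    unfolding sr_length_def
    by (rule integral_cong) (simp add: sr_metric_def vel dleft_dleft_inv sqrt_ip_develop assms(3))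
  also have "\<dots> \<le> integral {0..1} (\<lambda>t::real. K)"
  proof (rule integral_le)
    show "(\<lambda>t. norm (develop (\<xi> t))) integrable_on {0..1}"
      by (intro integrable_continuous_interval continuous_on_norm
          linear_continuous_on_compose [OF cont linear_develop])
  qed (use K in auto)
  finally show "sr_length g c \<le> K" by simp
qed

text \<open>The curve projects to \<open>t w + \<alpha>(t) a + \<beta>(t) b\<close>, where \<open>\<alpha>\<close> and \<open>\<beta>\<close> vanish at \<open>0\<close> and \<open>1\<close> and
  have mean zero, so that only the area \<open>\<integral> (\<alpha> \<beta>' - \<beta> \<alpha>') / 2 = 1\<close> contributes to the height.\<close>

lemma horizontal_path_exists:
  assumes w: "w \<in> v" and a: "a \<in> v" and b: "b \<in> v"
  shows "\<exists>c. horizontal_path v c \<and> c 0 = p \<and> c 1 = hmult p (w + hform a b *\<^sub>R hcenter) \<and>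
    sr_length g c \<le> norm (develop w) + 13 * norm (develop a) + 4410 * norm (develop b)"
proof -
  \<comment> \<open>With s = t (1 - t) these are \<alpha> = s (1 - 2 t), odd about 1/2, and \<beta>
    = 350 s^2 - 70 s, even about 1/2. The ratio 350 : 70 gives \<beta> mean zero, and the common
    factor normalises the area.\<close>
  define \<alpha> :: "real \<Rightarrow> real" where "\<alpha> t = t - 3 * t^2 + 2 * t^3" for t
  define \<beta> :: "real \<Rightarrow> real" where "\<beta> t = - 70 * t + 420 * t^2 - 700 * t^3 + 350 * t^4" for t
  define \<alpha>' :: "real \<Rightarrow> real" where "\<alpha>' t = 1 - 6 * t + 6 * t^2" for t
  define \<beta>' :: "real \<Rightarrow> real" where "\<beta>' t = - 70 + 840 * t - 2100 * t^2 + 1400 * t^3" for t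
  \<comment> \<open>Antiderivatives, vanishing at 0, of \<open>t * \<alpha>' t - \<alpha> t\<close>,
    \<open>t * \<beta>' t - \<beta> t\<close> and
    \<open>\<alpha> t * \<beta>' t - \<beta> t * \<alpha>' t\<close>. At 1 their values are 0, 0 and
    2, so half of \<open>C\<close> contributes exactly \<open>hform a b\<close>.\<close>
  define A :: "real \<Rightarrow> real" where "A t = t^4 - t^3" for t
  define B :: "real \<Rightarrow> real" where "B t = 140 * t^3 - 350 * t^4 + 210 * t^5" for t
  define C :: "real \<Rightarrow> real" where "C t = 70 * t^3 - 280 * t^4 + 462 * t^5 - 350 * t^6 + 100 * t^7" for t
  \<comment> \<open>Horizontality forces this vertical coordinate: its derivative has to be half of
    \<open>hform (c t) (\<xi> t)\<close>. The terms with p come from the starting point.\<close>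
  define \<zeta> where "\<zeta> t = (A t * hform w a + B t * hform w b + C t * hform a b
      + t * hform p w + \<alpha> t * hform p a + \<beta> t * hform p b) / 2" for t
  define c where "c t = p + (t *\<^sub>R w + \<alpha> t *\<^sub>R a + \<beta> t *\<^sub>R b) + \<zeta> t *\<^sub>R hcenter" for t
  define \<xi> where "\<xi> t = w + \<alpha>' t *\<^sub>R a + \<beta>' t *\<^sub>R b" for t
  have d\<alpha>: "(\<alpha> has_real_derivative \<alpha>' t) (at t within S)" for t S
    unfolding \<alpha>_def \<alpha>'_def by (auto intro!: derivative_eq_intros)
  have d\<beta>: "(\<beta> has_real_derivative \<beta>' t) (at t within S)" for t S
    unfolding \<beta>_def \<beta>'_def by (auto intro!: derivative_eq_intros)
  have dA: "(A has_real_derivative (t * \<alpha>' t - \<alpha> t)) (at t within S)" for t S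
    unfolding A_def \<alpha>_def \<alpha>'_def
    by (auto intro!: derivative_eq_intros simp: algebra_simps power2_eq_square power3_eq_cube)
  have dB: "(B has_real_derivative (t * \<beta>' t - \<beta> t)) (at t within S)" for t S
    unfolding B_def \<beta>_def \<beta>'_def
    by (auto intro!: derivative_eq_intros simp: algebra_simps power2_eq_square power3_eq_cube eval_nat_numeral)
  have dC: "(C has_real_derivative (\<alpha> t * \<beta>' t - \<beta> t * \<alpha>' t)) (at t within S)" for t S
    unfolding C_def \<beta>_def \<beta>'_def \<alpha>_def \<alpha>'_def
    by (auto intro!: derivative_eq_intros simp: algebra_simps power2_eq_square power3_eq_cube eval_nat_numeral)
  have d\<zeta>: "(\<zeta> has_real_derivative ((t * \<alpha>' t - \<alpha> t) * hform w a + (t * \<beta>' t - \<beta> t) * hform w b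
      + (\<alpha> t * \<beta>' t - \<beta> t * \<alpha>' t) * hform a b
      + 1 * hform p w + \<alpha>' t * hform p a + \<beta>' t * hform p b) / 2) (at t within S)" for t S
    unfolding \<zeta>_def
    by (intro DERIV_cdivide DERIV_add DERIV_cmult_right dA dB dC d\<alpha> d\<beta> DERIV_ident)
  have dleft_c: "dleft (c t) (\<xi> t) = (0 + (1 *\<^sub>R w + \<alpha>' t *\<^sub>R a + \<beta>' t *\<^sub>R b)) +
     (((t * \<alpha>' t - \<alpha> t) * hform w a + (t * \<beta>' t - \<beta> t) * hform w b
      + (\<alpha> t * \<beta>' t - \<beta> t * \<alpha>' t) * hform a b
      + 1 * hform p w + \<alpha>' t * hform p a + \<beta>' t * hform p b) / 2) *\<^sub>R hcenter" for t
  proof -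
    have "hform (c t) (\<xi> t) = (t * \<alpha>' t - \<alpha> t) * hform w a + (t * \<beta>' t - \<beta> t) * hform w b
      + (\<alpha> t * \<beta>' t - \<beta> t * \<alpha>' t) * hform a b + hform p w + \<alpha>' t * hform p a + \<beta>' t * hform p b"
      unfolding c_def \<xi>_def using hform_skew [of a w] hform_skew [of b w] hform_skew [of b a]
      by (simp add: hform_simps algebra_simps)
    then show ?thesis by (simp add: dleft_eq \<xi>_def)
  qed
  have der: "(c has_vector_derivative dleft (c t) (\<xi> t)) (at t within {0..1})" for t
    unfolding dleft_c unfolding c_def
    by (intro has_vector_derivative_add has_vector_derivative_const has_vector_derivative_scaleR_const
        d\<alpha> d\<beta> d\<zeta> DERIV_ident)
  have cont: "continuous_on {0..1} \<xi>"
    unfolding \<xi>_def \<alpha>'_def \<beta>'_def by (intro continuous_intros)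
  have \<xi>: "\<xi> t \<in> v" for t
    unfolding \<xi>_def using w a b subspace_w by (simp add: subspace_add subspace_scale)
  have bound: "norm (develop (\<xi> t)) \<le> norm (develop w) + 13 * norm (develop a) + 4410 * norm (develop b)"
    if t: "t \<in> {0..1}" for t
  proof -
    have p: "0 \<le> t" "t \<le> 1" "0 \<le> t^2" "t^2 \<le> 1" "0 \<le> t^3" "t^3 \<le> 1"
      using t by (auto simp: power_le_one)
    \<comment> \<open>Sums of the absolute values of the coefficients: 13 = 1 + 6 + 6, and below
      4410 = 70 + 840 + 2100 + 1400.\<close>
    have "\<bar>\<alpha>' t\<bar> \<le> 13"
      unfolding \<alpha>'_def using p by (intro abs_leI) linarith+
    moreover have "\<bar>\<beta>' t\<bar> \<le> 4410"
      unfolding \<beta>'_def using p by (intro abs_leI) linarith+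
    ultimately have "\<bar>\<alpha>' t\<bar> * norm (develop a) \<le> 13 * norm (develop a)" "\<bar>\<beta>' t\<bar> * norm (develop b) \<le> 4410 * norm (develop b)"
      by (auto intro: mult_right_mono)
    moreover have "norm (develop (\<xi> t)) \<le> norm (develop w) + \<bar>\<alpha>' t\<bar> * norm (develop a) + \<bar>\<beta>' t\<bar> * norm (develop b)"
      unfolding \<xi>_def linear_add [OF linear_develop] linear_scale [OF linear_develop]
      by (intro norm_triangle_mono) auto
    ultimately show ?thesis by linarith
  qed
  show ?thesis
  proof (intro exI [of _ c] conjI)
    show "horizontal_path v c" "sr_length g c \<le> norm (develop w) + 13 * norm (develop a) + 4410 * norm (develop b)"
      using horizontal_curve [OF der cont \<xi> bound] by auto
    show "c 0 = p" by (simp add: c_def \<zeta>_def \<alpha>_def \<beta>_def A_def B_def C_def)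
    show "c 1 = hmult p (w + hform a b *\<^sub>R hcenter)"
      by (simp add: c_def \<zeta>_def \<alpha>_def \<beta>_def A_def B_def C_def hmult_eq hform_simps algebra_simps add_divide_distrib)
  qed
qed

end


section \<open>Bounds for the distances\<close>

lemma hform_nondegenerate:
  assumes "\<And>v. hform u v = 0"
  shows "u = u $ None *\<^sub>R hcenter"
proof -
  have "u $ Some (Inl i) = 0" for i
    using assms [of "axis (Some (Inr i)) 1"] by (simp add: hform_def axis_def if_distrib [of "(*) _"] cong: if_cong)
  moreover have "u $ Some (Inr i) = 0" for i
    using assms [of "axis (Some (Inl i)) 1"]
    by (simp add: hform_def axis_def if_distrib [of "(*) _"] sum_negf cong: if_cong)
  ultimately have "u $ Some k = 0" for k
    by (cases k) auto
  then have "u $ k = (u $ None *\<^sub>R (hcenter :: 'a heis)) $ k" for k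
    by (cases k) (auto simp: axis_def)
  then show ?thesis unfolding vec_eq_iff by (rule allI)
qed

context sr_frame
begin

text \<open>Z lies in the kernel of the form, so the form lives on the base; commutators can then be
  estimated by base norms.\<close>

lemma hform_lift_base: "hform (lift (base u)) (lift (base u')) = hform u u'"
proof -
  have "hform u u' = hform (lift (base u) + height u *\<^sub>R hcenter) (lift (base u') + height u' *\<^sub>R hcenter)"
    by (simp only: lift_base)
  then show ?thesis by (simp add: hform_simps)
qed

text \<open>The skew endomorphism that represents the bracket form in the Euclidean structure of the
  frame.\<close>

definition dual :: "real ^ ('n + 'n) \<Rightarrow> real ^ ('n + 'n)" where
  "dual x = (\<chi> i. hform (lift x) (e i))"

lemma hform_lift: "hform (lift x) (lift y) = dual x \<bullet> y"
proof -
  have lin: "linear (hform (lift x))"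
    by (rule linearI) (simp_all add: hform_simps)
  have "hform (lift x) (lift y) = (\<Sum>i\<in>UNIV. y $ i * hform (lift x) (e i))"
    by (simp add: lift_def [of y] linear_sum [OF lin] linear_scale [OF lin])
  then show ?thesis by (simp add: inner_vec_def dual_def mult.commute)
qed

lemma dual_nonzero: "dual x = 0 \<Longrightarrow> x = 0"
proof -
  assume "dual x = 0"
  then have "hform (lift x) u = 0" for u
    using hform_lift [of x "base u"] hform_lift_base [of "lift x" u] by simp
  then have "lift x = (lift x $ None) *\<^sub>R hcenter"
    by (rule hform_nondegenerate)
  then have "base (lift x) = base ((lift x $ None) *\<^sub>R hcenter)" by simp
  then show "x = 0" by (simp only: base_simps base_lift base_center scaleR_zero_right)
qed

text \<open>M is the operator norm of \<open>dual\<close>. The upper bound will control commutators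
  of lattice elements, while the pair x, y spans loops that climb at low cost; using one M for both
  purposes lets c / M measure fibres and lattice vectors at once. Asking for M / 2 only avoids
  finding a maximiser.\<close>

lemma form_bound_exists:
  "\<exists>M>0. (\<forall>u u'. \<bar>hform u u'\<bar> \<le> M * norm (base u) * norm (base u')) \<and>
     (\<exists>x y. norm x \<le> 1 \<and> norm y \<le> 1 \<and> M / 2 \<le> hform (lift x) (lift y))"
proof -
  have "linear dual"
    by (rule linearI) (auto simp: dual_def vec_eq_iff lift_simps hform_simps)
  then have bl: "bounded_linear dual" by (rule linear_conv_bounded_linear [THEN iffD1])
  define M where "M = onorm dual"
  have le: "norm (dual x) \<le> M * norm x" for x
    unfolding M_def by (rule onorm [OF bl])
  have "0 < M"
  proof -
    obtain x :: "real ^ ('n + 'n)" where "x \<noteq> 0"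
      by (metis axis_eq_0_iff zero_neq_one)
    then have "0 < norm (dual x)" using dual_nonzero by auto
    with le [of x] have "0 < M * norm x" by linarith
    then show ?thesis using \<open>x \<noteq> 0\<close> by (simp add: zero_less_mult_iff)
  qed
  have "\<bar>hform u u'\<bar> \<le> M * norm (base u) * norm (base u')" for u u'
  proof -
    have "\<bar>hform u u'\<bar> = \<bar>dual (base u) \<bullet> base u'\<bar>"
      by (simp add: hform_lift_base flip: hform_lift)
    also have "\<dots> \<le> norm (dual (base u)) * norm (base u')" by (rule Cauchy_Schwarz_ineq2)
    also have "\<dots> \<le> M * norm (base u) * norm (base u')" by (intro mult_right_mono le) simp
    finally show ?thesis .
  qed
  moreover have "\<exists>x y. norm x \<le> 1 \<and> norm y \<le> 1 \<and> M / 2 \<le> hform (lift x) (lift y)"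
  proof -
    have "\<exists>x. M / 2 * norm x < norm (dual x)"
    proof (rule ccontr)
      assume "\<not> ?thesis"
      then have "norm (dual x) \<le> M / 2 * norm x" for x by (simp add: not_less)
      then have "M \<le> M / 2" unfolding M_def using onorm_le by blast
      then show False using \<open>0 < M\<close> by simp
    qed
    then obtain x where x: "M / 2 * norm x < norm (dual x)" by blast
    have "0 \<le> M / 2 * norm x" using \<open>0 < M\<close> by simp
    then have "dual x \<noteq> 0" using x by auto
    then have "x \<noteq> 0" using \<open>linear dual\<close> linear_0 by blast
    let ?x = "(1 / norm x) *\<^sub>R x" and ?y = "(1 / norm (dual x)) *\<^sub>R dual x"
    have "hform (lift ?x) (lift ?y) = norm (dual x) / norm x"
    proof -
      have "dual x \<bullet> dual x = norm (dual x) * norm (dual x)"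
        by (simp add: dot_square_norm power2_eq_square)
      then show ?thesis
        using \<open>dual x \<noteq> 0\<close> by (simp add: lift_simps hform_simps hform_lift)
    qed
    moreover have "M / 2 \<le> norm (dual x) / norm x"
      using x \<open>x \<noteq> 0\<close> by (intro mult_imp_le_div_pos) auto
    ultimately have "M / 2 \<le> hform (lift ?x) (lift ?y)" by simp
    moreover have "norm ?x \<le> 1" "norm ?y \<le> 1" by simp_all
    ultimately show ?thesis by blast
  qed
  ultimately show ?thesis using \<open>0 < M\<close> by blast
qed

lemma hform_positive_exists: "\<exists>x y. 0 < hform (lift x) (lift y)"
proof -
  obtain M x y where "0 < M" "M / 2 \<le> hform (lift x) (lift y)"
    using form_bound_exists by (elim exE conjE)
  then have "0 < hform (lift x) (lift y)" by linarith
  then show ?thesis by blast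
qed

lemma sr_length_nonneg: "horizontal_path v c \<Longrightarrow> 0 \<le> sr_length g c"
  using sr_length_ge [of c] norm_ge_zero order_trans by blast

text \<open>The infimum in \<open>sr_dist\<close> has to range over a nonempty set before it can be
  bounded below. A single plane on which the form is positive supplies every height, by
  scaling.\<close>

lemma horizontal_path_connects:
  shows "\<exists>c. horizontal_path v c \<and> c 0 = p \<and> c 1 = q"
proof -
  obtain x y where xy: "0 < hform (lift x) (lift y)"
    using hform_positive_exists by (elim exE)
  define r where "r = hmult (- p) q"
  define a where "a = (height r / hform (lift x) (lift y)) *\<^sub>R lift x"
  have "a \<in> v" unfolding a_def using subspace_w lift_in by (simp add: subspace_scale)
  have "hform a (lift y) = height r" using xy by (simp add: a_def hform_simps)
  then have "lift (base r) + hform a (lift y) *\<^sub>R hcenter = r"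
    by (simp only: lift_base)
  then have "hmult p (lift (base r) + hform a (lift y) *\<^sub>R hcenter) = q"
    by (simp only: r_def hmult_minus_cancel)
  then show ?thesis
    using horizontal_path_exists [OF lift_in \<open>a \<in> v\<close> lift_in, where p = p] by metis
qed

lemma sr_dist_ge: "norm (base q - base p) \<le> sr_dist v g p q"
  unfolding sr_dist_def
proof (rule cInf_greatest)
  show "{sr_length g c |c. horizontal_path v c \<and> c 0 = p \<and> c 1 = q} \<noteq> {}"
    using horizontal_path_connects by auto
  show "norm (base q - base p) \<le> l" if "l \<in> {sr_length g c |c. horizontal_path v c \<and> c 0 = p \<and> c 1 = q}" for l
    using that sr_length_ge by auto
qed

lemma sr_dist_le_length:
  assumes "horizontal_path v c" "c 0 = p" "c 1 = q"
  shows "sr_dist v g p q \<le> sr_length g c"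
  unfolding sr_dist_def
proof (rule cInf_lower)
  show "bdd_below {sr_length g c |c. horizontal_path v c \<and> c 0 = p \<and> c 1 = q}"
    using sr_length_nonneg by (auto intro!: bdd_belowI [of _ 0])
qed (use assms in auto)

lemma sr_dist_le:
  assumes "w \<in> v" "a \<in> v" "b \<in> v"
  shows "sr_dist v g p (hmult p (w + hform a b *\<^sub>R hcenter))
    \<le> norm (develop w) + 13 * norm (develop a) + 4410 * norm (develop b)"
  using horizontal_path_exists [OF assms, of p] sr_dist_le_length order_trans by blast

text \<open>Areas scale quadratically: a loop of size s in a plane that nearly maximises the form
  climbs by about M s^2, so a height z costs a multiple of sqrt (|z| / M). The constant is 4423 = 13
  + 4410.\<close>

lemma sr_dist_le_form:
  assumes "0 < M" "norm x0 \<le> 1" "norm y0 \<le> 1" "M / 2 \<le> hform (lift x0) (lift y0)"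
  shows "sr_dist v g p (hmult p (lift x + z *\<^sub>R hcenter)) \<le> norm x + 4423 * sqrt (2 * \<bar>z\<bar> / M)"
proof -
  define h where "h = hform (lift x0) (lift y0)"
  have h: "0 < h" "M / 2 \<le> h" using assms by (auto simp: h_def)
  define s where "s = sqrt (\<bar>z\<bar> / h)"
  have "0 \<le> s" "s\<^sup>2 = \<bar>z\<bar> / h" using h by (auto simp: s_def)
  have "s \<le> sqrt (2 * \<bar>z\<bar> / M)"
    unfolding s_def
  proof (rule real_sqrt_le_mono)
    have "\<bar>z\<bar> / h \<le> \<bar>z\<bar> / (M / 2)" using h assms(1) by (intro divide_left_mono) auto
    then show "\<bar>z\<bar> / h \<le> 2 * \<bar>z\<bar> / M" by (simp add: mult.commute)
  qed
  \<comment> \<open>The sign of z goes into one of the two directions, which reverses the loop when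
    z is negative.\<close>
  have "(sgn z * s) * s * h = z"
    using \<open>s\<^sup>2 = _\<close> h by (simp add: power2_eq_square mult.assoc sgn_if)
  then have "hform (lift ((sgn z * s) *\<^sub>R x0)) (lift (s *\<^sub>R y0)) = z"
    by (simp add: lift_simps hform_simps h_def ac_simps)
  then have "sr_dist v g p (hmult p (lift x + z *\<^sub>R hcenter))
    \<le> norm x + 13 * norm ((sgn z * s) *\<^sub>R x0) + 4410 * norm (s *\<^sub>R y0)"
    using sr_dist_le [OF lift_in lift_in lift_in, of p x "(sgn z * s) *\<^sub>R x0" "s *\<^sub>R y0"] by simp
  also have "\<dots> \<le> norm x + 13 * s + 4410 * s"
  proof -
    have "norm ((sgn z * s) *\<^sub>R x0) \<le> s * 1"
      unfolding norm_scaleR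
      using \<open>0 \<le> s\<close> assms(2) by (intro mult_mono) (auto simp: abs_mult abs_sgn_eq)
    moreover have "norm (s *\<^sub>R y0) \<le> s * 1"
      unfolding norm_scaleR using \<open>0 \<le> s\<close> assms(3) by (intro mult_mono) auto
    ultimately show ?thesis by simp
  qed
  finally show ?thesis using \<open>s \<le> _\<close> by simp
qed

lemma center_norm_nonneg: "0 \<le> center_norm"
  using ip_pos [OF _ hcenter_nonzero] by (auto simp: center_norm_def intro: less_imp_le)

text \<open>A horizontal Z allows the constant control lift x + z Z, so no loop is added: a = b =
  0.\<close>

lemma sr_dist_le_center:
  assumes "hcenter \<in> v"
  shows "sr_dist v g p (hmult p (lift x + z *\<^sub>R hcenter)) \<le> norm x + center_norm * \<bar>z\<bar>"
proof -
  have w: "lift x + z *\<^sub>R hcenter \<in> v"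
    using assms lift_in subspace_w by (simp add: subspace_add subspace_scale)
  have "(norm (develop (z *\<^sub>R hcenter)))\<^sup>2 = (center_norm * \<bar>z\<bar>)\<^sup>2"
    unfolding norm_develop by (simp add: base_simps height_simps power_mult_distrib)
  then have "norm (develop (z *\<^sub>R hcenter)) = center_norm * \<bar>z\<bar>"
    by (rule power2_eq_imp_eq) (simp_all add: center_norm_nonneg)
  moreover have "norm (develop (lift x + z *\<^sub>R hcenter)) \<le> norm (develop (lift x)) + norm (develop (z *\<^sub>R hcenter))"
    unfolding linear_add [OF linear_develop] by (rule norm_triangle_ineq)
  ultimately show ?thesis
    using sr_dist_le [OF w subspace_0 [OF subspace_w] subspace_0 [OF subspace_w], of p]
    by (simp add: hform_simps linear_0 [OF linear_develop])
qed

end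

section \<open>Lattices in coordinates and the distance on the quotient\<close>

lemma heis_group_simps [simp]:
  "carrier heis_group = UNIV" "mult heis_group = hmult" "one heis_group = 0"
  by (simp_all add: heis_group_def)

lemma inv_heis_group: "m_inv heis_group p = - (p :: 'n::finite heis)"
  by (rule group.inv_equality [OF group_heis_group]) simp_all

lemma heis_subgroup:
  assumes "subgroup \<Gamma> (heis_group :: 'n::finite heis monoid)"
  shows "0 \<in> \<Gamma>" "p \<in> \<Gamma> \<Longrightarrow> q \<in> \<Gamma> \<Longrightarrow> hmult p q \<in> \<Gamma>" "p \<in> \<Gamma> \<Longrightarrow> - p \<in> \<Gamma>"
  using subgroup.one_closed [OF assms] subgroup.m_closed [OF assms, of p q]
    subgroup.m_inv_closed [OF assms, of p] by (simp_all add: inv_heis_group)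

lemma r_coset_heis_group: "r_coset heis_group \<Gamma> p = (\<lambda>\<gamma>. hmult \<gamma> p) ` \<Gamma>"
  by (auto simp: r_coset_def)

lemma rcosets_heis_group: "RCOSETS heis_group \<Gamma> = range (\<lambda>p. (\<lambda>\<gamma>. hmult \<gamma> p) ` \<Gamma>)"
  by (auto simp: RCOSETS_def r_coset_heis_group)

lemma hmult_add_center:
  "hmult p (q + s *\<^sub>R hcenter) = hmult p q + s *\<^sub>R hcenter"
  "hmult (p + s *\<^sub>R hcenter) q = hmult p q + s *\<^sub>R hcenter"
  "hmult (s *\<^sub>R hcenter) q = q + s *\<^sub>R hcenter"
  by (simp_all add: hmult_eq hform_simps)

lemma hmult_commutator: "hmult (hmult p q) (hmult (- p) (- q)) = hform p q *\<^sub>R hcenter"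
proof -
  have "hmult (hmult p q) (hmult (- p) (- q))
      = hmult (p + q) (- (p + q)) + (hform p q / 2) *\<^sub>R hcenter + (hform p q / 2) *\<^sub>R hcenter"
    unfolding hmult_eq [of p q] hmult_eq [of "- p" "- q"] by (simp add: hmult_add_center)
  also have "\<dots> = (hform p q / 2 + hform p q / 2) *\<^sub>R hcenter"
    unfolding scaleR_add_left by (simp only: hmult_minus add_0)
  finally show ?thesis by simp
qed

lemma center_multiples:
  assumes "subgroup \<Gamma> heis_group" "t *\<^sub>R hcenter \<in> \<Gamma>"
  shows "(of_int k * t) *\<^sub>R hcenter \<in> \<Gamma>"
proof -
  have nat: "(of_nat m * t) *\<^sub>R hcenter \<in> \<Gamma>" for m
  proof (induction m)
    case (Suc m)
    have eq: "(of_nat (Suc m) * t) *\<^sub>R hcenter = hmult (t *\<^sub>R hcenter) ((of_nat m * t) *\<^sub>R hcenter)"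
      by (simp add: hmult_eq hform_simps algebra_simps)
    show ?case unfolding eq by (rule heis_subgroup(2) [OF assms(1) assms(2) Suc])
  qed (use heis_subgroup(1) [OF assms(1)] in simp)
  show ?thesis
  proof (cases "0 \<le> k")
    case True
    then show ?thesis using nat [of "nat k"] by simp
  next
    case False
    then show ?thesis using heis_subgroup(3) [OF assms(1) nat [of "nat (- k)"]] by simp
  qed
qed

context sr_frame
begin

abbreviation orbit :: "'n heis set \<Rightarrow> 'n heis \<Rightarrow> 'n heis set" where
  "orbit \<Gamma> p \<equiv> (\<lambda>\<gamma>. hmult \<gamma> p) ` \<Gamma>"

lemma sr_dist_nonneg: "0 \<le> sr_dist v g p q"
  using sr_dist_ge [of q p] norm_ge_zero order_trans by blast

text \<open>\<Gamma> acts on the base by translations, so the base displacement between any two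
  representatives is \<open>base q - base p\<close> up to a vector of the projected lattice; each
  such pair is bounded by \<open>sr_dist_ge\<close>.\<close>

lemma quotient_dist_ge:
  assumes \<Gamma>: "subgroup \<Gamma> heis_group"
  shows "infdist (base q - base p) (base ` \<Gamma>) \<le> quotient_dist v g (orbit \<Gamma> p) (orbit \<Gamma> q)"
  unfolding quotient_dist_def
proof (rule cInf_greatest)
  show "{sr_dist v g p' q' |p' q'. p' \<in> orbit \<Gamma> p \<and> q' \<in> orbit \<Gamma> q} \<noteq> {}"
    using heis_subgroup(1) [OF \<Gamma>] by blast
  fix l assume "l \<in> {sr_dist v g p' q' |p' q'. p' \<in> orbit \<Gamma> p \<and> q' \<in> orbit \<Gamma> q}"
  then obtain \<gamma> \<delta> where gd: "\<gamma> \<in> \<Gamma>" "\<delta> \<in> \<Gamma>" and l: "l = sr_dist v g (hmult \<gamma> p) (hmult \<delta> q)"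
    by blast
  have "infdist (base q - base p) (base ` \<Gamma>) \<le> dist (base q - base p) (base (hmult \<gamma> (- \<delta>)))"
    by (intro infdist_le imageI heis_subgroup(2,3) [OF \<Gamma>] gd)
  also have "\<dots> = norm (base (hmult \<delta> q) - base (hmult \<gamma> p))"
    by (simp add: dist_norm base_simps algebra_simps)
  also have "\<dots> \<le> l" unfolding l by (rule sr_dist_ge)
  finally show "infdist (base q - base p) (base ` \<Gamma>) \<le> l" .
qed

text \<open>For each lattice element the base displacement is followed horizontally, and what
  remains is an error in height. The central lattice element t Z reduces this error to at most t in
  absolute value, and F is the price of correcting it.\<close>

lemma quotient_dist_le:
  assumes \<Gamma>: "subgroup \<Gamma> heis_group" and t: "0 < t" "t *\<^sub>R hcenter \<in> \<Gamma>"
    and F: "\<And>p x z. \<bar>z\<bar> \<le> t \<Longrightarrow> sr_dist v g p (hmult p (lift x + z *\<^sub>R hcenter)) \<le> norm x + F"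
  shows "quotient_dist v g (orbit \<Gamma> p) (orbit \<Gamma> q) \<le> infdist (base q - base p) (base ` \<Gamma>) + F"
proof -
  have "quotient_dist v g (orbit \<Gamma> p) (orbit \<Gamma> q) - F \<le> dist (base q - base p) l" if l: "l \<in> base ` \<Gamma>" for l
  proof -
    obtain \<gamma> where \<gamma>: "\<gamma> \<in> \<Gamma>" "l = base \<gamma>" using l by blast
    \<comment> \<open>r leads from p to q moved by the inverse of \<gamma>. Multiplying by - k t Z,
      with k the floor of height r / t, leaves a height in [0, t).\<close>
    define r where "r = hmult (- p) (hmult (- \<gamma>) q)"
    define k where "k = \<lfloor>height r / t\<rfloor>"
    define s where "s = of_int (- k) * t"
    define \<delta> where "\<delta> = hmult (s *\<^sub>R hcenter) (- \<gamma>)"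
    have \<delta>: "\<delta> \<in> \<Gamma>"
      unfolding \<delta>_def s_def
      by (intro heis_subgroup(2) [OF \<Gamma>] center_multiples [OF \<Gamma> t(2)] heis_subgroup(3) [OF \<Gamma>] \<gamma>)
    have z: "\<bar>height r + s\<bar> \<le> t"
    proof -
      have "of_int k \<le> height r / t" "height r / t < of_int k + 1"
        unfolding k_def by linarith+
      then have "of_int k * t \<le> height r" "height r < (of_int k + 1) * t"
        using t(1) by (simp_all add: pos_le_divide_eq pos_divide_less_eq)
      then show ?thesis by (simp add: abs_le_iff algebra_simps s_def)
    qed
    have "lift (base r) + (height r + s) *\<^sub>R hcenter = r + s *\<^sub>R hcenter"
      using lift_base [of r] by (simp add: scaleR_add_left flip: add.assoc)
    then have "hmult p (lift (base r) + (height r + s) *\<^sub>R hcenter) = hmult \<delta> q"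
      by (simp only: \<delta>_def r_def hmult_add_center hmult_minus_cancel hmult_assoc)
    then have "sr_dist v g p (hmult \<delta> q) \<le> norm (base r) + F"
      using F [OF z, of p "base r"] by simp
    moreover have "quotient_dist v g (orbit \<Gamma> p) (orbit \<Gamma> q) \<le> sr_dist v g p (hmult \<delta> q)"
      unfolding quotient_dist_def
    proof (rule cInf_lower)
      have "p \<in> orbit \<Gamma> p" by (rule image_eqI [of _ _ 0]) (simp_all add: heis_subgroup(1) [OF \<Gamma>])
      then show "sr_dist v g p (hmult \<delta> q) \<in> {sr_dist v g p' q' |p' q'. p' \<in> orbit \<Gamma> p \<and> q' \<in> orbit \<Gamma> q}"
        using \<delta> by blast
      show "bdd_below {sr_dist v g p' q' |p' q'. p' \<in> orbit \<Gamma> p \<and> q' \<in> orbit \<Gamma> q}"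
        using sr_dist_nonneg by (auto intro!: bdd_belowI [of _ 0])
    qed
    moreover have "norm (base r) = dist (base q - base p) l"
      by (simp add: r_def dist_norm \<gamma> base_simps algebra_simps)
    ultimately show ?thesis by linarith
  qed
  then have "quotient_dist v g (orbit \<Gamma> p) (orbit \<Gamma> q) - F \<le> infdist (base q - base p) (base ` \<Gamma>)"
    using heis_subgroup(1) [OF \<Gamma>] by (subst infdist_notempty) (auto intro!: cINF_greatest)
  then show ?thesis by simp
qed

text \<open>The diameter bounds distances on the torus by D; the additional 1 turns the infimum over
  the projected lattice into an actual lattice element.\<close>

lemma lattice_covering:
  assumes \<Gamma>: "subgroup \<Gamma> heis_group" and D: "0 < D"
    and diam: "metric_diameter (rcosets\<^bsub>heis_group\<^esub> \<Gamma>) (quotient_dist v g) \<le> ennreal D"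
  shows "\<exists>\<gamma>\<in>\<Gamma>. norm (x - base \<gamma>) \<le> D + 1"
proof -
  have "ennreal (quotient_dist v g (orbit \<Gamma> 0) (orbit \<Gamma> (lift x)))
      \<le> metric_diameter (rcosets\<^bsub>heis_group\<^esub> \<Gamma>) (quotient_dist v g)"
    unfolding metric_diameter_def rcosets_heis_group
    using SUP_upper [of "orbit \<Gamma> (lift x)" "range (orbit \<Gamma>)" "\<lambda>B. ennreal (quotient_dist v g (orbit \<Gamma> 0) B)"]
      SUP_upper [of "orbit \<Gamma> 0" "range (orbit \<Gamma>)"
        "\<lambda>A. SUP B\<in>range (orbit \<Gamma>). ennreal (quotient_dist v g A B)"]
    by (meson order_trans rangeI)
  also have "\<dots> \<le> ennreal D" by (rule diam)
  finally have "quotient_dist v g (orbit \<Gamma> 0) (orbit \<Gamma> (lift x)) \<le> D" using D by simp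
  then have "infdist x (base ` \<Gamma>) \<le> D"
    using quotient_dist_ge [OF \<Gamma>, of "lift x" 0] by (simp add: base_simps)
  moreover have "base ` \<Gamma> \<noteq> {}" using heis_subgroup(1) [OF \<Gamma>] by blast
  ultimately have "(INF l\<in>base ` \<Gamma>. dist x l) < D + 1" by (simp add: infdist_notempty)
  then have "\<exists>l\<in>base ` \<Gamma>. dist x l < D + 1"
    using \<open>base ` \<Gamma> \<noteq> {}\<close> by (subst (asm) cINF_less_iff) auto
  then show ?thesis by (auto simp: dist_norm intro: less_imp_le)
qed

text \<open>In the base, the elements that commute with \<gamma> lie in the hyperplane orthogonal to
  \<open>dual (base \<gamma>)\<close>. The vector y along this normal has distance 3 D' from that
  hyperplane, so a lattice element within D' of y does not commute with \<gamma>.\<close>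

lemma lattice_partner:
  assumes "0 < D'" and cov: "\<And>x. \<exists>\<gamma>\<in>\<Gamma>. norm (x - base \<gamma>) \<le> D'" and "base \<gamma> \<noteq> 0"
  shows "\<exists>\<delta>\<in>\<Gamma>. hform \<gamma> \<delta> \<noteq> 0 \<and> norm (base \<delta>) \<le> 4 * D'"
proof -
  define a where "a = dual (base \<gamma>)"
  have a: "0 < norm a" using dual_nonzero assms(3) by (auto simp: a_def)
  define y where "y = (3 * D' / norm a) *\<^sub>R a"
  have ny: "norm y = 3 * D'" using a assms(1) by (simp add: y_def)
  obtain \<delta> where \<delta>: "\<delta> \<in> \<Gamma>" "norm (y - base \<delta>) \<le> D'" using cov by blast
  have "norm (base \<delta>) \<le> norm y + norm (y - base \<delta>)"
    using norm_triangle_ineq2 [of "base \<delta>" y] by (simp add: norm_minus_commute)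
  then have "norm (base \<delta>) \<le> 4 * D'" using ny \<delta>(2) by simp
  moreover have "hform \<gamma> \<delta> \<noteq> 0"
  proof
    assume "hform \<gamma> \<delta> = 0"
    then have "a \<bullet> base \<delta> = 0"
      using hform_lift [of "base \<gamma>" "base \<delta>"] by (simp add: hform_lift_base a_def)
    then have "a \<bullet> (y - base \<delta>) = norm a * (3 * D')"
      using a by (simp add: inner_diff_right y_def dot_square_norm power2_eq_square)
    moreover have "a \<bullet> (y - base \<delta>) \<le> norm a * norm (y - base \<delta>)" by (rule norm_cauchy_schwarz)
    moreover have "norm a * norm (y - base \<delta>) \<le> norm a * D'" using \<delta>(2) by (intro mult_left_mono) auto
    ultimately have "norm a * (3 * D') \<le> norm a * D'" by linarith
    moreover have "0 < norm a * D'" using a assms(1) by simp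
    ultimately show False by linarith
  qed
  ultimately show ?thesis using \<delta>(1) by blast
qed

text \<open>The commutator of \<gamma> with its partner is a nonzero central element, hence at least
  c in absolute value, and it is at most M * norm (base \<gamma>) * 4 D'. This is where bounded
  diameter turns the spacing of the center into a lower bound for all base vectors. Discreteness
  makes c positive, and the factor 2 avoids showing that the infimum is attained.\<close>

lemma lattice_center:
  assumes \<Gamma>: "subgroup \<Gamma> heis_group" "\<And>p. p \<in> \<Gamma> \<Longrightarrow> p isolated_in \<Gamma>"
    and "0 < D'" and cov: "\<And>x. \<exists>\<gamma>\<in>\<Gamma>. norm (x - base \<gamma>) \<le> D'"
    and M: "0 < M" "\<And>u u'. \<bar>hform u u'\<bar> \<le> M * norm (base u) * norm (base u')"
  shows "\<exists>c>0. (\<forall>t. t *\<^sub>R hcenter \<in> \<Gamma> \<longrightarrow> t \<noteq> 0 \<longrightarrow> c \<le> \<bar>t\<bar>) \<and> (\<exists>t. t *\<^sub>R hcenter \<in> \<Gamma> \<and> 0 < t \<and> t \<le> 2 * c) \<and>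
    (\<forall>\<gamma>\<in>\<Gamma>. base \<gamma> \<noteq> 0 \<longrightarrow> c / (4 * D' * M) \<le> norm (base \<gamma>))"
proof -
  define T where "T = {t. 0 < t \<and> t *\<^sub>R (hcenter :: 'n heis) \<in> \<Gamma>}"
  have T: "\<bar>t\<bar> \<in> T" if "t *\<^sub>R hcenter \<in> \<Gamma>" "t \<noteq> 0" for t
    using that heis_subgroup(3) [OF \<Gamma>(1) that(1)] by (auto simp: T_def abs_if)
  have comm: "\<bar>hform \<gamma> \<delta>\<bar> \<in> T" if "\<gamma> \<in> \<Gamma>" "\<delta> \<in> \<Gamma>" "hform \<gamma> \<delta> \<noteq> 0" for \<gamma> \<delta>
  proof (rule T)
    show "hform \<gamma> \<delta> *\<^sub>R hcenter \<in> \<Gamma>"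
      unfolding hmult_commutator [symmetric]
      by (intro heis_subgroup(2,3) [OF \<Gamma>(1)] that)
  qed (rule that)
  have "T \<noteq> {}"
  proof -
    \<comment> \<open>A lattice element within D' of a vector of length 2 D' has nonzero projection,
      so it has a partner and T contains a commutator.\<close>
    obtain x :: "real ^ ('n + 'n)" where x: "norm x = 2 * D'"
      using vector_choose_size [of "2 * D'"] \<open>0 < D'\<close> by auto
    obtain \<gamma> where "\<gamma> \<in> \<Gamma>" "norm (x - base \<gamma>) \<le> D'" using cov by blast
    moreover then have "base \<gamma> \<noteq> 0" using x \<open>0 < D'\<close> by auto
    ultimately show ?thesis
      using lattice_partner [OF \<open>0 < D'\<close> cov] comm by blast
  qed
  obtain U where "open U" and U: "U \<inter> \<Gamma> = {0}"
    using \<Gamma>(2) [OF heis_subgroup(1) [OF \<Gamma>(1)]] unfolding isolated_in_def by (elim conjE exE) (rule that)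
  have "0 \<in> U" using U by blast
  obtain \<epsilon> where "0 < \<epsilon>" and \<epsilon>: "ball 0 \<epsilon> \<subseteq> U"
    by (rule openE [OF \<open>open U\<close> \<open>0 \<in> U\<close>])
  have T\<epsilon>: "\<epsilon> \<le> t" if "t \<in> T" for t
  proof (rule ccontr)
    assume "\<not> \<epsilon> \<le> t"
    then have "t *\<^sub>R (hcenter :: 'n heis) \<in> ball 0 \<epsilon>" using that by (simp add: T_def)
    then have "t *\<^sub>R (hcenter :: 'n heis) \<in> U" by (rule subsetD [OF \<epsilon>])
    moreover have "t *\<^sub>R (hcenter :: 'n heis) \<in> \<Gamma>" using that by (simp add: T_def)
    ultimately have "t *\<^sub>R (hcenter :: 'n heis) \<in> U \<inter> \<Gamma>" by (rule IntI)
    then have "t *\<^sub>R (hcenter :: 'n heis) = 0" unfolding U by blast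
    then show False using that hcenter_nonzero by (simp add: T_def)
  qed
  have bdd: "bdd_below T" by (rule bdd_belowI [OF T\<epsilon>])
  define c where "c = Inf T"
  have "\<epsilon> \<le> c" unfolding c_def using \<open>T \<noteq> {}\<close> T\<epsilon> by (rule cInf_greatest)
  then have "0 < c" using \<open>0 < \<epsilon>\<close> by simp
  have c: "c \<le> t" if "t \<in> T" for t unfolding c_def using that bdd by (rule cInf_lower)
  have "\<exists>t\<in>T. t < 2 * c"
    using cInf_lessD [OF \<open>T \<noteq> {}\<close>, of "2 * c"] \<open>0 < c\<close> by (auto simp: c_def)
  moreover have "c / (4 * D' * M) \<le> norm (base \<gamma>)" if \<gamma>: "\<gamma> \<in> \<Gamma>" "base \<gamma> \<noteq> 0" for \<gamma>
  proof -
    obtain \<delta> where \<delta>: "\<delta> \<in> \<Gamma>" "hform \<gamma> \<delta> \<noteq> 0" "norm (base \<delta>) \<le> 4 * D'"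
      using lattice_partner [OF \<open>0 < D'\<close> cov \<gamma>(2)] by blast
    have "c \<le> \<bar>hform \<gamma> \<delta>\<bar>" by (rule c [OF comm [OF \<gamma>(1) \<delta>(1,2)]])
    also have "\<dots> \<le> M * norm (base \<gamma>) * norm (base \<delta>)" by (rule M(2))
    also have "\<dots> \<le> M * norm (base \<gamma>) * (4 * D')" using \<delta>(3) M(1) by (intro mult_left_mono) auto
    finally show ?thesis using M(1) \<open>0 < D'\<close> by (simp add: divide_simps mult.commute mult.left_commute)
  qed
  ultimately show ?thesis using \<open>0 < c\<close> c T by (intro exI [of _ c]) (auto simp: T_def intro: less_imp_le)
qed

end


section \<open>Volume and fundamental domains\<close>

lemma det_matrix_shear:
  fixes m n :: "'k::finite"
  assumes "m \<noteq> n"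
  shows "det (matrix (\<lambda>v::real^'k. \<chi> i. if i = m then v $ m + v $ n else v $ i)) = 1"
proof -
  have "matrix (\<lambda>v::real^'k. \<chi> i. if i = m then v $ m + v $ n else v $ i) =
     (\<chi> k. if k = m then row m (mat 1 :: real^'k^'k) + 1 *s row n (mat 1) else row k (mat 1))"
    by (auto simp: matrix_def row_def mat_def axis_def vec_eq_iff)
  then show ?thesis
    using det_row_operation [OF assms, of "mat 1 :: real^'k^'k" 1] by simp
qed

text \<open>The library states this under a well-order on the index type, which \<open>('n + 'n) option\<close>
  does not have.\<close>

lemma measure_linear_image_finite:
  fixes f :: "real^'k::finite \<Rightarrow> real^'k"
  assumes "linear f" "S \<in> lmeasurable"
  shows "f ` S \<in> lmeasurable \<and> measure lebesgue (f ` S) = \<bar>det (matrix f)\<bar> * measure lebesgue S"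
proof -
  define Q where "Q f \<longleftrightarrow> (\<forall>S \<in> lmeasurable. f ` S \<in> lmeasurable \<and>
    measure lebesgue (f ` S) = \<bar>det (matrix f)\<bar> * measure lebesgue S)" for f :: "real^'k \<Rightarrow> real^'k"
  have cboxI: "Q f" if "linear f"
    "\<And>a b. cbox a b \<noteq> {} \<Longrightarrow> measure lebesgue (f ` cbox a b) = \<bar>det (matrix f)\<bar> * measure lebesgue (cbox a b)"
    for f :: "real^'k \<Rightarrow> real^'k"
    unfolding Q_def
  proof
    fix S :: "(real^'k) set" assume S: "S \<in> lmeasurable"
    have "measure lebesgue (f ` cbox a b) = \<bar>det (matrix f)\<bar> * measure lebesgue (cbox a b)" for a b
      using that(2) [of a b] by (cases "cbox a b = {}") auto
    from measure_linear_sufficient [OF that(1) S this]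
    show "f ` S \<in> lmeasurable \<and> measure lebesgue (f ` S) = \<bar>det (matrix f)\<bar> * measure lebesgue S"
      by simp
  qed
  have "Q f"
  proof (rule induct_linear_elementary [OF \<open>linear f\<close>])
    fix f g :: "real^'k \<Rightarrow> real^'k"
    assume "linear f" "linear g" "Q f" "Q g"
    have "(f \<circ> g) ` S = f ` (g ` S)" for S :: "(real^'k) set"
      by (simp only: image_comp)
    with \<open>Q f\<close> \<open>Q g\<close> matrix_compose [OF \<open>linear g\<close> \<open>linear f\<close>] show "Q (f \<circ> g)"
      by (simp only: Q_def det_mul abs_mult mult.assoc) simp
  next
    fix f :: "real^'k \<Rightarrow> real^'k" and i
    assume f: "linear f" and 0: "\<And>x. f x $ i = 0"
    have "\<not> surj f"
    proof
      assume "surj f"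
      then obtain x where "axis i 1 = f x" by (rule surjE)
      with 0 [of x] have "axis i 1 $ i = (0::real)" by simp
      then show False by simp
    qed
    then have "\<not> inj f"
      using linear_injective_imp_surjective [OF f] by blast
    then have "det (matrix f) = 0" and "negligible (f ` S)" for S
      using det_nz_iff_inj [OF f] negligible_linear_singular_image [OF f] by auto
    then show "Q f"
      by (simp add: Q_def negligible_imp_measurable negligible_imp_measure0)
  next
    fix c :: "'k \<Rightarrow> real"
    have "det (matrix (\<lambda>x::real^'k. \<chi> i. c i * x $ i)) = prod c UNIV"
      by (subst det_diagonal) (auto simp: matrix_def axis_def)
    then show "Q (\<lambda>x. \<chi> i. c i * x $ i)"
      by (simp add: Q_def measurable_stretch measure_stretch)
  next
    fix m n :: 'k assume "m \<noteq> n"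
    let ?p = "Transposition.transpose m n"
    let ?h = "\<lambda>v::real^'k. \<chi> i. v $ ?p i"
    have lin: "linear ?h"
      by (rule linearI) (simp_all add: vec_eq_iff)
    have "matrix ?h = (\<chi> i. mat 1 $ ?p i)"
      by (auto simp: matrix_def mat_def axis_def vec_eq_iff)
    then have d: "\<bar>det (matrix ?h)\<bar> = 1"
      by (simp add: det_permute_rows permutes_swap_id sign_swap_id abs_mult)
    show "Q ?h"
    proof (rule cboxI [OF lin])
      fix a b :: "real^'k" assume ne: "cbox a b \<noteq> {}"
      have inv: "?h (?h x) = x" for x by (simp add: vec_eq_iff)
      have mem: "?h x \<in> cbox (?h a) (?h b)" if "x \<in> cbox a b" for x a b
        using that by (simp add: mem_box_cart)
      have eq: "?h ` cbox a b = cbox (?h a) (?h b)"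
      proof
        show "?h ` cbox a b \<subseteq> cbox (?h a) (?h b)" using mem by blast
        show "cbox (?h a) (?h b) \<subseteq> ?h ` cbox a b"
        proof
          fix x assume "x \<in> cbox (?h a) (?h b)"
          from mem [OF this] have "?h x \<in> cbox a b" by (simp only: inv)
          then show "x \<in> ?h ` cbox a b" by (rule image_eqI [rotated]) (simp only: inv)
        qed
      qed
      moreover have "cbox (?h a) (?h b) \<noteq> {}" using eq ne by auto
      moreover have "(\<Prod>i\<in>UNIV. b $ ?p i - a $ ?p i) = (\<Prod>i\<in>UNIV. b $ i - a $ i)"
        using prod.permute [OF permutes_swap_id, where S=UNIV and g="\<lambda>i. b $ i - a $ i"]
        by (simp add: o_def)
      ultimately show "measure lebesgue (?h ` cbox a b) = \<bar>det (matrix ?h)\<bar> * measure lebesgue (cbox a b)"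
        using ne by (simp add: d content_cbox_cart)
    qed
  next
    fix m n :: 'k assume "m \<noteq> n"
    let ?h = "\<lambda>v::real^'k. \<chi> i. if i = m then v $ m + v $ n else v $ i"
    have lin: "linear ?h"
      by (rule linearI) (auto simp: vec_eq_iff algebra_simps)
    show "Q ?h"
    proof (rule cboxI [OF lin])
      fix a b :: "real^'k" assume ne: "cbox a b \<noteq> {}"
      \<comment> \<open>The shear formula for boxes asks for a nonnegative lower bound in the
        coordinate n; translating by v makes this bound 0.\<close>
      define v :: "real^'k" where "v = (\<chi> i. if i = n then - a $ n else 0)"
      have "?h ` (+) v ` cbox a b = (+) (?h v) ` ?h ` cbox a b"
        using linear_add [OF lin] by (auto simp: image_image)
      then have "measure lebesgue (?h ` cbox a b) = measure lebesgue (?h ` (+) v ` cbox a b)"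
        by (simp only: measure_translation)
      also have "\<dots> = measure lebesgue (?h ` cbox (v + a) (v + b))"
        by (simp only: cbox_translation)
      also have "\<dots> = measure lebesgue (cbox (v + a) (v + b))"
      proof (rule measure_shear_interval [OF \<open>m \<noteq> n\<close>])
        show "cbox (v + a) (v + b) \<noteq> {}"
          using ne cbox_translation [of v a b] by auto
      qed (simp add: v_def)
      also have "\<dots> = measure lebesgue (cbox a b)"
        unfolding cbox_translation by (rule measure_translation)
      finally show "measure lebesgue (?h ` cbox a b) = \<bar>det (matrix ?h)\<bar> * measure lebesgue (cbox a b)"
        using det_matrix_shear [OF \<open>m \<noteq> n\<close>] by simp
    qed
  qed
  then show ?thesis using assms by (simp add: Q_def)
qed

text \<open>Each point is singled out by a member of a countable basis, which injects S into that
  basis.\<close>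

lemma isolated_imp_countable:
  fixes S :: "'a::second_countable_topology set"
  assumes "\<And>x. x \<in> S \<Longrightarrow> x isolated_in S"
  shows "countable S"
proof -
  obtain \<B> :: "'a set set" where \<B>: "countable \<B>" "topological_basis \<B>"
    using ex_countable_basis by blast
  have "\<exists>b. b \<in> \<B> \<and> b \<inter> S = {x}" if xS: "x \<in> S" for x
  proof -
    obtain T where T: "open T" "T \<inter> S = {x}" by (rule isolated_inE [OF assms [OF xS]])
    then have "x \<in> T" by blast
    obtain b where "b \<in> \<B>" "x \<in> b" "b \<subseteq> T" by (rule topological_basisE [OF \<B>(2) T(1) \<open>x \<in> T\<close>])
    then have "b \<in> \<B>" "b \<inter> S = {x}" using T(2) xS by auto
    then show ?thesis by blast
  qed
  then have "\<forall>x\<in>S. \<exists>b. b \<in> \<B> \<and> b \<inter> S = {x}" by blast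
  from bchoice [OF this] obtain f where f: "\<forall>x\<in>S. f x \<in> \<B> \<and> f x \<inter> S = {x}" by blast
  have "inj_on f S"
  proof (rule inj_onI)
    fix x y assume "x \<in> S" "y \<in> S" "f x = f y"
    then have "{x} = {y}" using f by force
    then show "x = y" by simp
  qed
  moreover have "countable (f ` S)" using f \<B>(1) by (intro countable_subset [of "f ` S" \<B>]) auto
  ultimately show ?thesis using countable_image_inj_on by blast
qed

section \<open>Lebesgue measure as Haar measure, and comparison of fundamental domains\<close>

lemma linear_dleft: "linear (dleft p)"
  by (rule linearI) (simp_all add: dleft_eq hform_simps algebra_simps add_divide_distrib)

text \<open>The matrix differs from the identity only in the row of Z, and there by a combination of
  the other rows, because \<open>hform p\<close> vanishes on Z. Left translations therefore preserve
  Lebesgue measure.\<close>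

lemma det_dleft: "det (matrix (dleft (p :: 'n::finite heis))) = 1"
proof -
  let ?I = "mat 1 :: real^(('n + 'n) option)^(('n + 'n) option)"
  define x :: "'n heis" where "x = (\<chi> j. hform p (axis j 1) / 2)"
  have "x $ None = 0" by (simp add: x_def hform_simps)
  have "x = (\<Sum>j\<in>UNIV. x $ j *s axis j 1)"
    by (simp add: vec_eq_iff axis_def if_distrib [of "(*) _"] cong: if_cong)
  also have "\<dots> = (\<Sum>j\<in>UNIV - {None}. x $ j *s axis j 1)"
    by (subst sum.remove [of _ None]) (simp_all add: \<open>x $ None = 0\<close>)
  also have "\<dots> \<in> vec.span {row j ?I |j. j \<noteq> None}"
  proof (intro vec.span_sum vec.span_scale vec.span_base)
    fix j :: "('n + 'n) option" assume "j \<in> UNIV - {None}"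
    moreover have "axis j 1 = row j ?I" by (auto simp: row_def mat_def axis_def vec_eq_iff)
    ultimately show "axis j 1 \<in> {row j ?I |j. j \<noteq> None}" by blast
  qed
  finally have "det (\<chi> k. if k = None then row None ?I + x else row k ?I) = det ?I"
    by (rule det_row_span)
  moreover have "matrix (dleft p) = (\<chi> k. if k = None then row None ?I + x else row k ?I)"
    by (auto simp: matrix_def row_def mat_def axis_def vec_eq_iff dleft_eq x_def)
  ultimately show ?thesis by simp
qed

lemma hmult_image: "hmult p ` S = (\<lambda>x. p + x) ` dleft p ` S"
  by (simp add: image_image hmult_eq dleft_eq add.assoc)

lemma emeasure_hmult_image:
  assumes "S \<in> sets borel" "bounded S"
  shows "hmult p ` S \<in> sets borel" "emeasure lborel (hmult p ` S) = emeasure lborel S"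
proof -
  have "hmult p ` S = hmult (- p) -` S"
  proof
    show "hmult p ` S \<subseteq> hmult (- p) -` S" by auto
    show "hmult (- p) -` S \<subseteq> hmult p ` S"
    proof
      fix x assume "x \<in> hmult (- p) -` S"
      then have "hmult p (hmult (- p) x) \<in> hmult p ` S" by blast
      then show "x \<in> hmult p ` S" by simp
    qed
  qed
  moreover have "hmult (- p) \<in> borel_measurable borel"
    unfolding hmult_eq [abs_def] hform_def by measurable
  ultimately show b: "hmult p ` S \<in> sets borel"
    using assms(1) measurable_sets_borel by metis
  have S: "S \<in> lmeasurable" using assms by (intro bounded_set_imp_lmeasurable) auto
  from measure_linear_image_finite [OF linear_dleft S, of p]
  have D: "dleft p ` S \<in> lmeasurable" "measure lebesgue (dleft p ` S) = measure lebesgue S"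
    by (simp_all add: det_dleft)
  then have "hmult p ` S \<in> lmeasurable" "measure lebesgue (hmult p ` S) = measure lebesgue S"
    unfolding hmult_image by (simp_all add: measurable_translation measure_translation)
  then have "emeasure lebesgue (hmult p ` S) = emeasure lebesgue S"
    using S by (simp add: emeasure_eq_measure2)
  then show "emeasure lborel (hmult p ` S) = emeasure lborel S"
    using b assms(1) by simp
qed

lemma fundamental_domain_transversal:
  assumes \<Gamma>: "subgroup \<Gamma> heis_group" and F: "fundamental_domain \<Gamma> F"
  shows "\<exists>\<gamma>\<in>\<Gamma>. hmult \<gamma> q \<in> F"
    and "\<gamma> \<in> \<Gamma> \<Longrightarrow> q \<in> F \<Longrightarrow> hmult \<gamma> q \<in> F \<Longrightarrow> \<gamma> = 0"
proof -
  have "(\<lambda>\<gamma>. hmult \<gamma> q) ` \<Gamma> \<in> rcosets\<^bsub>heis_group\<^esub> \<Gamma>" by (simp add: rcosets_heis_group)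
  then have ex1: "\<exists>!p. p \<in> (\<lambda>\<gamma>. hmult \<gamma> q) ` \<Gamma> \<inter> F"
    using F by (auto simp: fundamental_domain_def)
  then show "\<exists>\<gamma>\<in>\<Gamma>. hmult \<gamma> q \<in> F" by blast
  assume \<gamma>: "\<gamma> \<in> \<Gamma>" "q \<in> F" "hmult \<gamma> q \<in> F"
  have "q = hmult 0 q" by simp
  then have "q \<in> (\<lambda>\<gamma>. hmult \<gamma> q) ` \<Gamma>" using heis_subgroup(1) [OF \<Gamma>] by blast
  with \<gamma> ex1 have "hmult \<gamma> q = q" by blast
  then have "hmult (hmult \<gamma> q) (- q) = hmult q (- q)" by simp
  then show "\<gamma> = 0" by (simp add: hmult_assoc)
qed

text \<open>A set that embeds in the quotient is cut into pieces by the translates of F, and the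
  pieces are moved into F one by one. Uniqueness of representatives in F makes the pieces disjoint;
  injectivity on B makes their images disjoint.\<close>

lemma fundamental_domain_measure:
  assumes \<Gamma>: "subgroup \<Gamma> heis_group" "countable \<Gamma>" and F: "fundamental_domain \<Gamma> F"
    and B: "B \<in> sets borel" "bounded B"
    and inj: "\<And>\<gamma> b. \<gamma> \<in> \<Gamma> \<Longrightarrow> b \<in> B \<Longrightarrow> hmult \<gamma> b \<in> B \<Longrightarrow> \<gamma> = 0"
  shows "emeasure lborel B \<le> emeasure lborel F"
proof -
  have Fb: "F \<in> sets borel" using F by (simp add: fundamental_domain_def)
  define X where "X \<gamma> = B \<inter> hmult (- \<gamma>) -` F" for \<gamma>
  have Xb: "X \<gamma> \<in> sets borel" for \<gamma>
  proof -
    have "hmult (- \<gamma>) \<in> borel_measurable borel"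
      unfolding hmult_eq [abs_def] hform_def by measurable
    then have "hmult (- \<gamma>) -` F \<in> sets borel" using Fb by (rule measurable_sets_borel)
    then show ?thesis using B by (simp add: X_def)
  qed
  have bX: "bounded (X \<gamma>)" for \<gamma> using B(2) by (auto simp: X_def intro: bounded_subset)
  note Y = emeasure_hmult_image [OF Xb bX, of _ "- _"]
  have diff: "\<gamma> = \<delta>" if "\<gamma> \<in> \<Gamma>" "\<delta> \<in> \<Gamma>" "hmult \<gamma> (- \<delta>) = 0" for \<gamma> \<delta>
  proof -
    have "hmult (hmult \<gamma> (- \<delta>)) \<delta> = \<delta>" using that by simp
    then show ?thesis by (simp add: hmult_assoc)
  qed
  have "B = (\<Union>\<gamma>\<in>\<Gamma>. X \<gamma>)"
  proof
    show "B \<subseteq> (\<Union>\<gamma>\<in>\<Gamma>. X \<gamma>)"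
    proof
      fix b assume "b \<in> B"
      obtain \<gamma> where "\<gamma> \<in> \<Gamma>" "hmult \<gamma> b \<in> F" using fundamental_domain_transversal(1) [OF \<Gamma>(1) F] by blast
      then have "- \<gamma> \<in> \<Gamma>" "b \<in> X (- \<gamma>)" using \<open>b \<in> B\<close> heis_subgroup(3) [OF \<Gamma>(1)] by (auto simp: X_def)
      then show "b \<in> (\<Union>\<gamma>\<in>\<Gamma>. X \<gamma>)" by blast
    qed
  qed (auto simp: X_def)
  then have "emeasure lborel B = emeasure lborel (\<Union>\<gamma>\<in>\<Gamma>. X \<gamma>)" by simp
  also have "\<dots> = (\<integral>\<^sup>+\<gamma>. emeasure lborel (X \<gamma>) \<partial>count_space \<Gamma>)"
  proof (rule emeasure_UN_countable)
    show "disjoint_family_on X \<Gamma>"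
      unfolding disjoint_family_on_def
    proof (intro ballI impI, rule ccontr)
      fix \<gamma> \<delta> assume gd: "\<gamma> \<in> \<Gamma>" "\<delta> \<in> \<Gamma>" "\<gamma> \<noteq> \<delta>" "X \<gamma> \<inter> X \<delta> \<noteq> {}"
      then obtain b where b: "hmult (- \<gamma>) b \<in> F" "hmult (- \<delta>) b \<in> F" by (auto simp: X_def)
      have "hmult (hmult (- \<delta>) \<gamma>) (hmult (- \<gamma>) b) = hmult (- \<delta>) b" by (simp add: hmult_assoc)
      moreover have "hmult (- \<delta>) \<gamma> \<in> \<Gamma>" by (intro heis_subgroup(2,3) [OF \<Gamma>(1)] gd)
      ultimately have "hmult (- \<delta>) \<gamma> = 0"
        using fundamental_domain_transversal(2) [OF \<Gamma>(1) F, of "hmult (- \<delta>) \<gamma>" "hmult (- \<gamma>) b"] b by simp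
      then have "hmult \<delta> (hmult (- \<delta>) \<gamma>) = \<delta>" by simp
      then show False using gd(3) by simp
    qed
  qed (use Xb \<Gamma> in auto)
  also have "\<dots> = (\<integral>\<^sup>+\<gamma>. emeasure lborel (hmult (- \<gamma>) ` X \<gamma>) \<partial>count_space \<Gamma>)"
    using emeasure_hmult_image(2) [OF Xb bX] by simp
  also have "\<dots> = emeasure lborel (\<Union>\<gamma>\<in>\<Gamma>. hmult (- \<gamma>) ` X \<gamma>)"
  proof (rule emeasure_UN_countable [symmetric])
    show "disjoint_family_on (\<lambda>\<gamma>. hmult (- \<gamma>) ` X \<gamma>) \<Gamma>"
      unfolding disjoint_family_on_def
    proof (intro ballI impI, rule ccontr)
      fix \<gamma> \<delta> assume gd: "\<gamma> \<in> \<Gamma>" "\<delta> \<in> \<Gamma>" "\<gamma> \<noteq> \<delta>" "hmult (- \<gamma>) ` X \<gamma> \<inter> hmult (- \<delta>) ` X \<delta> \<noteq> {}"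
      then obtain b b' where b: "b \<in> B" "b' \<in> B" "hmult (- \<gamma>) b = hmult (- \<delta>) b'" by (auto simp: X_def)
      have "hmult (hmult \<gamma> (- \<delta>)) b' = hmult \<gamma> (hmult (- \<gamma>) b)" by (simp only: hmult_assoc b(3))
      then have "hmult (hmult \<gamma> (- \<delta>)) b' = b" by simp
      moreover have "hmult \<gamma> (- \<delta>) \<in> \<Gamma>" by (intro heis_subgroup(2,3) [OF \<Gamma>(1)] gd)
      ultimately have "hmult \<gamma> (- \<delta>) = 0" using inj [of "hmult \<gamma> (- \<delta>)" b'] b(1,2) by simp
      then show False using diff [OF gd(1,2)] gd(3) by simp
    qed
    show "hmult (- \<gamma>) ` X \<gamma> \<in> sets lborel" for \<gamma>
      using emeasure_hmult_image(1) [OF Xb bX] by simp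
  qed (use \<Gamma> in auto)
  also have "\<dots> \<le> emeasure lborel F"
    using Fb by (intro emeasure_mono) (auto simp: X_def)
  finally show ?thesis .
qed


section \<open>Popp's volume\<close>

definition frame_matrix :: "('k::finite \<Rightarrow> real^'k) \<Rightarrow> real^'k^'k" where
  "frame_matrix f = (\<chi> r m. f m $ r)"

lemma frame_matrix_mult: "frame_matrix f *v y = (\<Sum>m\<in>UNIV. y $ m *\<^sub>R f m)"
  by (simp add: frame_matrix_def matrix_vector_mult_def vec_eq_iff mult.commute)

lemma frame_matrix_axis: "frame_matrix f *v axis m 1 = f m"
  by (simp add: frame_matrix_def matrix_vector_mult_def vec_eq_iff axis_def if_distrib [of "(*) _"] cong: if_cong)

lemma frame_matrix_det:
  fixes f :: "'k::finite \<Rightarrow> real^'k"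
  assumes "span (range f) = UNIV"
  shows "det (frame_matrix f) \<noteq> 0"
proof -
  have lin: "linear ((*v) (frame_matrix f))" by (rule matrix_vector_mul_linear)
  have "range f \<subseteq> range ((*v) (frame_matrix f))"
    using frame_matrix_axis [of f, symmetric] by blast
  then have "span (range f) \<subseteq> range ((*v) (frame_matrix f))"
    by (rule span_minimal) (rule linear_subspace_image [OF lin subspace_UNIV])
  then have "surj ((*v) (frame_matrix f))" using assms by auto
  then have "inj ((*v) (frame_matrix f))"
    by (rule linear_surjective_imp_injective [OF lin]) simp
  then show ?thesis using det_nz_iff_inj [OF lin] by simp
qed

lemma matrix_inv_right:
  fixes A :: "real^'k^'k"
  assumes "det A \<noteq> 0"
  shows "A ** matrix_inv A = mat 1"
proof -
  have "\<exists>B. A ** B = mat 1 \<and> B ** A = mat 1"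
    using assms by (simp add: invertible_det_nz [symmetric] invertible_def)
  from someI_ex [OF this] show ?thesis by (simp add: matrix_inv_def)
qed

lemma det_coframe:
  assumes "det (frame_matrix e) \<noteq> 0"
  shows "det (\<chi> l m. coframe e l (axis m 1)) = 1 / det (frame_matrix e)"
proof -
  have "(\<chi> l m. coframe e l (axis m 1)) = matrix_inv (frame_matrix e)"
    by (simp add: coframe_def matrix_vector_mult_def vec_eq_iff axis_def frame_matrix_def
        if_distrib [of "(*) _"] cong: if_cong)
  moreover have "frame_matrix e ** matrix_inv (frame_matrix e) = mat 1"
    by (rule matrix_inv_right [OF assms])
  then have "det (frame_matrix e) * det (matrix_inv (frame_matrix e)) = 1"
    by (simp flip: det_mul)
  ultimately show ?thesis using assms by (simp add: field_simps)
qed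

context sr_frame
begin

lemma inner_product_subspace_subset:
  assumes "subspace w" "w \<subseteq> v"
  shows "inner_product_subspace w g"
proof
  show "inner_product_on w g" using ip assms(2) unfolding inner_product_on_def by blast
qed (rule assms)

text \<open>\<open>popp_coeff\<close> picks its frame by \<open>SOME\<close>, so its value can be
  computed only once a frame exists. For a hyperplane, Z completes an orthonormal basis.\<close>

lemma popp_frame_exists:
  assumes w: "subspace w" "bracket_generating w" "w \<subseteq> v"
  shows "\<exists>f. popp_frame w g f"
proof (cases "w = UNIV")
  interpret w: inner_product_subspace w g by (rule inner_product_subspace_subset [OF w(1,3)])
  case True
  have dim: "dim w = CARD(('n + 'n) option)" using True by (simp add: dim_UNIV)
  obtain f :: "('n + 'n) option \<Rightarrow> 'n heis" where f: "\<forall>i. f i \<in> w"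
      "\<forall>i j. g (f i) (f j) = (if i = j then 1 else 0)"
    using w.orthonormal_basis_exists [OF dim] by blast
  have "span (range f) = w" by (rule w.orthonormal_span [OF _ _ dim]) (use f in auto)
  then show ?thesis using f True by (auto simp: popp_frame_def)
next
  interpret w: inner_product_subspace w g by (rule inner_product_subspace_subset [OF w(1,3)])
  case False
  then have Z: "hcenter \<notin> w" using bracket_generating_UNIV_iff [OF w(2,1)] by simp
  have sum: "{x + y |x y. x \<in> w \<and> y \<in> span {hcenter}} = UNIV"
  proof -
    have "\<exists>x y. u = x + y \<and> x \<in> w \<and> y \<in> span {hcenter}" for u
    proof -
      obtain x t where "x \<in> w" "u = x + t *\<^sub>R hcenter" by (rule bracket_generating_decomp [OF w(2)])
      then show ?thesis by (auto simp: span_singleton)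
    qed
    then show ?thesis by auto
  qed
  have int: "w \<inter> span {hcenter} = {0}"
  proof -
    have "t = 0" if "t *\<^sub>R hcenter \<in> w" for t
    proof (rule ccontr)
      assume "t \<noteq> 0"
      then show False using subspace_scale [OF w(1) that, of "1 / t"] Z by simp
    qed
    then show ?thesis using subspace_0 [OF w(1)] by (auto simp: span_singleton)
  qed
  have "dim w + dim (span {hcenter :: 'n heis}) = DIM('n heis)"
    using dim_sums_Int [OF w(1) subspace_span [of "{hcenter}"]] sum int by (simp add: dim_UNIV)
  moreover have "dim (span {hcenter :: 'n heis}) = 1"
    using hcenter_nonzero by (simp add: dim_span dim_insert)
  moreover have "DIM('n heis) = CARD('n + 'n) + 1" by (simp add: card_option)
  ultimately have dim: "dim w = CARD('n + 'n)" by simp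
  obtain f :: "'n + 'n \<Rightarrow> 'n heis" where f: "\<forall>i. f i \<in> w" "\<forall>i j. g (f i) (f j) = (if i = j then 1 else 0)"
    using w.orthonormal_basis_exists [OF dim] by blast
  have span: "span (range f) = w" by (rule w.orthonormal_span [OF _ _ dim]) (use f in auto)
  define h where "h k = (case k of None \<Rightarrow> hcenter | Some i \<Rightarrow> f i)" for k
  have "u \<in> span (range h)" for u
  proof -
    obtain x t where x: "x \<in> w" "u = x + t *\<^sub>R hcenter" by (rule bracket_generating_decomp [OF w(2)])
    have "range f \<subseteq> range h" by (auto simp: h_def intro!: image_eqI [of _ _ "Some _"])
    then have "w \<subseteq> span (range h)" using span span_mono by blast
    moreover have "hcenter \<in> span (range h)"
      by (rule span_base, rule image_eqI [of _ _ None]) (simp_all add: h_def)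
    ultimately show ?thesis using x by (auto intro: span_add span_scale)
  qed
  then have "popp_frame w g h"
    using False f span by (auto simp: popp_frame_def h_def)
  then show ?thesis by blast
qed

lemma norm_base_orthonormal:
  assumes w: "subspace w" "w \<subseteq> v" and f: "\<And>i. f i \<in> w" "\<And>i j. g (f i) (f j) = (if i = j then 1 else 0)"
  shows "norm (base (\<Sum>i\<in>UNIV. a i *\<^sub>R f i)) \<le> sqrt (\<Sum>i\<in>UNIV. (a (i::'i::finite))\<^sup>2)"
proof -
  interpret w: inner_product_subspace w g by (rule inner_product_subspace_subset [OF w])
  have "(\<Sum>i\<in>UNIV. a i *\<^sub>R f i) \<in> v"
    using w f subspace_w by (intro subspace_sum subspace_scale) auto
  from ip_develop [OF this] have "(norm (develop (\<Sum>i\<in>UNIV. a i *\<^sub>R f i)))\<^sup>2 = (\<Sum>i\<in>UNIV. (a i)\<^sup>2)"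
    using w.orthonormal_sum_square [OF f, of a] by simp
  from real_sqrt_unique [OF this norm_ge_zero] show ?thesis
    using norm_base_le [of "\<Sum>i\<in>UNIV. a i *\<^sub>R f i"] by simp
qed

lemma popp_coeff_UNIV:
  assumes v: "v = UNIV"
  shows "\<exists>f. (\<forall>i j. g (f i) (f j) = (if i = j then 1 else 0)) \<and>
    det (frame_matrix f) \<noteq> 0 \<and> popp_coeff UNIV g * \<bar>det (frame_matrix f)\<bar> = 1"
proof -
  define f where "f = (SOME f. popp_frame UNIV g f)"
  have "\<exists>f. popp_frame UNIV g f"
    using popp_frame_exists [of UNIV] sr v by (auto simp: subriemannian_def)
  then have f: "popp_frame UNIV g f" unfolding f_def by (rule someI_ex)
  then have d: "det (frame_matrix f) \<noteq> 0"
    by (intro frame_matrix_det) (simp add: popp_frame_def)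
  have "popp_coeff UNIV g = \<bar>1 / det (frame_matrix f)\<bar>"
    unfolding popp_coeff_def f_def [symmetric] popp_form_def by (simp add: det_coframe [OF d])
  then show ?thesis using f d by (intro exI [of _ f]) (auto simp: popp_frame_def)
qed

text \<open>With \<zeta> the coefficient of Z along the completing vector, the structure constants
  are \<open>hform (f i) (f j) * \<zeta>\<close>, while exchanging that vector for c Z multiplies
  the determinant by c * \<zeta>. So \<zeta> cancels and c / sqrt H remains, where H is the squared
  Hilbert--Schmidt norm of the form on w; each of its (2n)^2 terms is at most M^2.\<close>

lemma popp_coeff_hyperplane:
  assumes w: "subspace w" "bracket_generating w" "w \<subseteq> v" "w \<noteq> UNIV" and "0 < c"
    and M: "0 < M" "\<And>u u'. \<bar>hform u u'\<bar> \<le> M * norm (base u) * norm (base u')"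
  shows "\<exists>f. (\<forall>i. f i \<in> w) \<and> (\<forall>i j. g (f i) (f j) = (if i = j then 1 else 0)) \<and>
    det (frame_matrix (case_option (c *\<^sub>R hcenter) f)) \<noteq> 0 \<and>
    c / (of_nat (CARD('n + 'n)) * M) \<le> popp_coeff w g * \<bar>det (frame_matrix (case_option (c *\<^sub>R hcenter) f))\<bar>"
proof -
  define h where "h = (SOME f. popp_frame w g f)"
  have "\<exists>f. popp_frame w g f" by (rule popp_frame_exists [OF w(1-3)])
  then have h: "popp_frame w g h" unfolding h_def by (rule someI_ex)
  define f where "f i = h (Some i)" for i
  have span: "span (range f) = w" and orth: "\<And>i j. g (f i) (f j) = (if i = j then 1 else 0)"
    and spanh: "span (range h) = UNIV"
    using h w(4) by (auto simp: popp_frame_def f_def)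
  have fw: "f i \<in> w" for i using span span_base [of "f i" "range f"] by auto
  define E where "E = frame_matrix h"
  have d: "det E \<noteq> 0" unfolding E_def by (rule frame_matrix_det [OF spanh])
  define z where "z = matrix_inv E *v (hcenter :: 'n heis)"
  define \<zeta> where "\<zeta> = z $ None"
  have "E ** matrix_inv E = mat 1" by (rule matrix_inv_right [OF d])
  then have Ez: "E *v z = hcenter" by (simp add: z_def matrix_vector_mul_assoc)
  \<comment> \<open>Otherwise Z would lie in the span of the f i, which is w.\<close>
  have "\<zeta> \<noteq> 0"
  proof
    assume "\<zeta> = 0"
    have "hcenter = (\<Sum>m\<in>UNIV. z $ m *\<^sub>R h m)" using Ez by (simp add: E_def frame_matrix_mult)
    also have "\<dots> = (\<Sum>i\<in>UNIV. z $ Some i *\<^sub>R f i)"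
      using \<open>\<zeta> = 0\<close> by (simp add: UNIV_option_conv sum.reindex f_def \<zeta>_def)
    also have "\<dots> \<in> w" using fw w(1) by (intro subspace_sum subspace_scale) auto
    finally show False using bracket_generating_UNIV_iff [OF w(2,1)] w(4) by simp
  qed
  define H where "H = (\<Sum>i\<in>UNIV. \<Sum>j\<in>UNIV. (hform (f i) (f j))\<^sup>2)"
  have base1: "norm (base (f i)) \<le> 1" for i
  proof -
    have "f i \<in> v" using fw w(3) by blast
    from ip_develop [OF this] have "(norm (develop (f i)))\<^sup>2 = 1"
      using orth [of i i] by simp
    then have "norm (develop (f i)) = 1" using real_sqrt_unique [of "norm (develop (f i))" 1] by simp
    then show ?thesis using norm_base_le [of "f i"] by simp
  qed
  have hf: "(hform (f i) (f j))\<^sup>2 \<le> M\<^sup>2" for i j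
  proof -
    have "\<bar>hform (f i) (f j)\<bar> \<le> M * norm (base (f i)) * norm (base (f j))" by (rule M(2))
    also have "\<dots> \<le> M * 1 * 1" using M(1) base1 by (intro mult_mono) auto
    finally show ?thesis using M(1) by (simp add: abs_le_square_iff [symmetric])
  qed
  have "H \<le> (\<Sum>i\<in>(UNIV::('n + 'n) set). \<Sum>j\<in>(UNIV::('n + 'n) set). M\<^sup>2)"
    unfolding H_def by (intro sum_mono hf)
  also have "\<dots> = (of_nat (CARD('n + 'n)) * M)\<^sup>2" by (simp add: power2_eq_square)
  finally have Hle: "sqrt H \<le> of_nat (CARD('n + 'n)) * M"
    using M(1) by (intro real_le_lsqrt) (auto simp: H_def sum_nonneg)
  have "0 \<le> H" by (simp add: H_def sum_nonneg)
  \<comment> \<open>Otherwise the form would vanish on w and, the center being in its kernel,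
    everywhere.\<close>
  moreover have "H \<noteq> 0"
  proof
    assume "H = 0"
    then have h0: "hform (f i) (f j) = 0" for i j
      unfolding H_def by (simp add: sum_nonneg_eq_0_iff sum_nonneg)
    have zero: "hform x y = 0" if "x \<in> w" "y \<in> w" for x y
    proof -
      have lin1: "linear (hform (f i))" and lin2: "linear (\<lambda>x. hform x y)" for i
        by (rule linearI; simp add: hform_simps)+
      have xy: "x \<in> span (range f)" "y \<in> span (range f)" using that by (simp_all only: span)
      have "hform (f i) y = 0" for i
        by (rule linear_eq_0_on_span [OF lin1 _ xy(2)]) (use h0 in blast)
      then show ?thesis
        by (intro linear_eq_0_on_span [OF lin2 _ xy(1)]) blast
    qed
    have "hform u u' = 0" for u u' :: "'n heis"
    proof -
      obtain x t where x: "x \<in> w" "u = x + t *\<^sub>R hcenter" by (rule bracket_generating_decomp [OF w(2)])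
      obtain x' t' where x': "x' \<in> w" "u' = x' + t' *\<^sub>R hcenter" by (rule bracket_generating_decomp [OF w(2)])
      show ?thesis using x x' zero by (simp add: hform_simps)
    qed
    moreover obtain x y where "0 < hform (lift x) (lift y)"
      using hform_positive_exists by (elim exE)
    ultimately show False by simp
  qed
  ultimately have "0 < H" by simp
  have mv: "A *v (r *\<^sub>R x) = r *\<^sub>R (A *v x)" for A :: "real^(('n + 'n) option)^(('n + 'n) option)" and r x
    by (rule linear_scale [OF matrix_vector_mul_linear])
  have co: "coframe h None (hbracket x y) = hform x y * \<zeta>" for x y
    by (simp add: coframe_def hbracket_eq \<zeta>_def z_def E_def frame_matrix_def mv)
  have "popp_coeff w g = \<bar>1 / sqrt (\<Sum>i\<in>UNIV. \<Sum>j\<in>UNIV. (hform (f i) (f j) * \<zeta>)\<^sup>2) * (1 / det E)\<bar>"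
    unfolding popp_coeff_def h_def [symmetric] popp_form_def using w(4) d
    by (simp add: det_coframe co E_def f_def)
  also have "(\<Sum>i\<in>UNIV. \<Sum>j\<in>UNIV. (hform (f i) (f j) * \<zeta>)\<^sup>2) = H * \<zeta>\<^sup>2"
    by (simp add: H_def power_mult_distrib sum_distrib_right)
  finally have popp: "popp_coeff w g = 1 / (sqrt H * \<bar>\<zeta>\<bar> * \<bar>det E\<bar>)"
    using \<open>0 < H\<close> by (simp add: real_sqrt_mult abs_mult)
  have Eij: "E $ i $ j = h j $ i" for i j by (simp add: E_def frame_matrix_def)
  \<comment> \<open>Only the column \<open>None\<close> of E is exchanged, so Cramer's rule reads
    off the factor c * \<zeta>.\<close>
  have "frame_matrix (case_option (c *\<^sub>R hcenter) f) =
      (\<chi> i j. if j = None then (E *v (c *\<^sub>R z)) $ i else E $ i $ j)"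
    by (auto simp: frame_matrix_def mv Ez vec_eq_iff Eij f_def split: option.split)
  then have det: "det (frame_matrix (case_option (c *\<^sub>R hcenter) f)) = c * \<zeta> * det E"
    using cramer_lemma [where A = E and x = "c *\<^sub>R z" and k = None] by (simp add: \<zeta>_def)
  have "c / (of_nat (CARD('n + 'n)) * M) \<le> c / sqrt H"
    using Hle \<open>0 < H\<close> \<open>0 < c\<close> M(1) by (intro divide_left_mono) auto
  also have "\<dots> = popp_coeff w g * \<bar>det (frame_matrix (case_option (c *\<^sub>R hcenter) f))\<bar>"
    using \<open>\<zeta> \<noteq> 0\<close> d \<open>0 < c\<close> by (simp add: det popp abs_mult)
  finally show ?thesis using fw orth det d \<open>0 < c\<close> \<open>\<zeta> \<noteq> 0\<close> by (intro exI [of _ f]) auto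
qed

end

lemma linear_image_ball:
  fixes f :: "'k::finite \<Rightarrow> real^'k"
  assumes d: "det (frame_matrix f) \<noteq> 0" and "0 \<le> r"
  shows "open ((*v) (frame_matrix f) ` ball 0 r)" "bounded ((*v) (frame_matrix f) ` ball 0 r)"
    "measure lborel ((*v) (frame_matrix f) ` ball 0 r) =
      \<bar>det (frame_matrix f)\<bar> * (r ^ CARD('k) * measure lborel (ball (0::real^'k) 1))"
proof -
  have lin: "linear ((*v) (frame_matrix f))" by (rule matrix_vector_mul_linear)
  have "inj ((*v) (frame_matrix f))" using d det_nz_iff_inj [OF lin] by simp
  then have "surj ((*v) (frame_matrix f))" by (rule linear_injective_imp_surjective [OF lin]) simp
  then show o: "open ((*v) (frame_matrix f) ` ball 0 r)"
    by (intro open_surjective_linear_image [OF open_ball lin])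
  show "bounded ((*v) (frame_matrix f) ` ball 0 r)"
    by (intro bounded_linear_image bounded_ball linear_conv_bounded_linear [THEN iffD1, OF lin])
  have "measure lebesgue ((*v) (frame_matrix f) ` ball 0 r) = \<bar>det (frame_matrix f)\<bar> * measure lebesgue (ball (0::real^'k) r)"
    using measure_linear_image_finite [OF lin lmeasurable_ball [of 0 r]] by simp
  moreover have "measure lborel ((*v) (frame_matrix f) ` ball 0 r) = measure lebesgue ((*v) (frame_matrix f) ` ball 0 r)"
    using borel_open [OF o] by (simp add: measure_completion)
  ultimately show "measure lborel ((*v) (frame_matrix f) ` ball 0 r) =
      \<bar>det (frame_matrix f)\<bar> * (r ^ CARD('k) * measure lborel (ball (0::real^'k) 1))"
    using content_ball_conv_unit_ball [OF assms(2), of "0::real^'k"] by simp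
qed

context sr_frame
begin

text \<open>An ellipsoid that embeds in the quotient has at most the volume of a fundamental domain;
  discreteness provides the countability behind that comparison.\<close>

lemma frame_ball_volume:
  fixes f :: "('n + 'n) option \<Rightarrow> 'n heis"
  assumes \<Gamma>: "subgroup \<Gamma> heis_group" "\<And>p. p \<in> \<Gamma> \<Longrightarrow> p isolated_in \<Gamma>"
    and F: "fundamental_domain \<Gamma> F" "emeasure lborel F < \<infinity>"
    and f: "det (frame_matrix f) \<noteq> 0" and "0 \<le> r"
    and inj: "\<And>\<gamma> y y'. \<gamma> \<in> \<Gamma> \<Longrightarrow> norm y < r \<Longrightarrow> norm y' < r \<Longrightarrow>
      hmult \<gamma> (frame_matrix f *v y) = frame_matrix f *v y' \<Longrightarrow> \<gamma> = 0"
  shows "\<bar>det (frame_matrix f)\<bar> * (r ^ CARD(('n + 'n) option) * measure lborel (ball (0::'n heis) 1)) \<le> measure lborel F"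
proof -
  define B where "B = (*v) (frame_matrix f) ` ball 0 r"
  note B = linear_image_ball [OF f \<open>0 \<le> r\<close>, folded B_def]
  have "emeasure lborel B \<le> emeasure lborel F"
  proof (rule fundamental_domain_measure [OF \<Gamma>(1) isolated_imp_countable [OF \<Gamma>(2)] F(1)])
    show "\<gamma> = 0" if b: "\<gamma> \<in> \<Gamma>" "b \<in> B" "hmult \<gamma> b \<in> B" for \<gamma> b
    proof -
      obtain y y' where "norm y < r" "norm y' < r" "b = frame_matrix f *v y" "hmult \<gamma> b = frame_matrix f *v y'"
        using b(2,3) by (auto simp: B_def)
      then show ?thesis using inj [OF b(1), of y y'] by simp
    qed
  qed (use B in auto)
  then have "measure lborel B \<le> measure lborel F"
    using F(2) by (simp add: measure_def enn2real_mono)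
  then show ?thesis using B(3) by simp
qed

text \<open>The vertical axis is measured in units of c. If \<gamma> carries one point of the ball
  to another, their base coordinates differ by less than \<epsilon>, so \<gamma> is central; their
  vertical coordinates differ by less than 1, so \<gamma> = t Z with |t| < c and hence \<gamma> = 0.
  The bound is independent of the length of Z and also serves the hyperplanes w when v is the whole
  algebra.\<close>

lemma popp_volume_hyperplane:
  assumes \<Gamma>: "subgroup \<Gamma> heis_group" "\<And>p. p \<in> \<Gamma> \<Longrightarrow> p isolated_in \<Gamma>"
    and F: "fundamental_domain \<Gamma> F" "emeasure lborel F < \<infinity>"
    and "0 < c" and center: "\<And>t. t *\<^sub>R hcenter \<in> \<Gamma> \<Longrightarrow> t \<noteq> 0 \<Longrightarrow> c \<le> \<bar>t\<bar>"
    and "0 < \<epsilon>" and short: "\<And>\<gamma>. \<gamma> \<in> \<Gamma> \<Longrightarrow> base \<gamma> \<noteq> 0 \<Longrightarrow> \<epsilon> \<le> norm (base \<gamma>)"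
    and M: "0 < M" "\<And>u u'. \<bar>hform u u'\<bar> \<le> M * norm (base u) * norm (base u')"
    and w: "subspace w" "bracket_generating w" "w \<subseteq> v" "w \<noteq> UNIV"
  shows "c / (of_nat (CARD('n + 'n)) * M) * (min (\<epsilon> / 2) (1 / 2) ^ CARD(('n + 'n) option) * measure lborel (ball (0::'n heis) 1))
    \<le> popp_coeff w g * measure lborel F"
proof -
  obtain f where f: "\<forall>i. f i \<in> w" "\<forall>i j. g (f i) (f j) = (if i = j then 1 else 0)"
    and det: "det (frame_matrix (case_option (c *\<^sub>R hcenter) f)) \<noteq> 0"
    and popp: "c / (of_nat (CARD('n + 'n)) * M) \<le> popp_coeff w g * \<bar>det (frame_matrix (case_option (c *\<^sub>R hcenter) f))\<bar>"
    using popp_coeff_hyperplane [OF w \<open>0 < c\<close> M] by (elim exE conjE)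
  define E where "E = frame_matrix (case_option (c *\<^sub>R hcenter) f)"
  define r where "r = min (\<epsilon> / 2) (1 / 2)"
  have lin: "linear ((*v) E)" by (rule matrix_vector_mul_linear)
  have injE: "inj ((*v) E)" using det det_nz_iff_inj [OF lin] by (simp add: E_def)
  have E: "E *v y = (\<Sum>i\<in>UNIV. y $ Some i *\<^sub>R f i) + (y $ None * c) *\<^sub>R hcenter" for y
    by (simp add: E_def frame_matrix_mult UNIV_option_conv sum.reindex add.commute)
  have normE: "norm (base (E *v y)) \<le> norm y" for y
  proof -
    have "base (E *v y) = base (\<Sum>i\<in>UNIV. y $ Some i *\<^sub>R f i)" by (simp add: E base_simps)
    also have "norm \<dots> \<le> sqrt (\<Sum>i\<in>UNIV. (y $ Some i)\<^sup>2)"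
      by (rule norm_base_orthonormal [OF w(1,3)]) (use f in auto)
    also have "\<dots> \<le> norm y"
      by (simp add: norm_vec_def L2_set_def UNIV_option_conv sum.reindex)
    finally show ?thesis .
  qed
  have "0 \<le> r" using \<open>0 < \<epsilon>\<close> by (simp add: r_def)
  have "\<gamma> = 0" if a: "\<gamma> \<in> \<Gamma>" "norm y < r" "norm y' < r" "hmult \<gamma> (E *v y) = E *v y'" for \<gamma> y y'
  proof -
    have "base \<gamma> = base (E *v y') - base (E *v y)"
      using arg_cong [OF a(4), of base] by (simp add: eq_diff_eq)
    then have "norm (base \<gamma>) \<le> norm (base (E *v y')) + norm (base (E *v y))"
      by (simp add: norm_triangle_ineq4)
    also have "\<dots> < r + r" using normE [of y] normE [of y'] a by simp
    also have "\<dots> \<le> \<epsilon>" by (simp add: r_def)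
    finally have "base \<gamma> = 0" using short [OF a(1)] by force
    define t where "t = height \<gamma>"
    have \<gamma>: "\<gamma> = t *\<^sub>R hcenter" unfolding t_def by (rule base_eq_0) fact
    have "t *\<^sub>R hcenter = E *v y' - E *v y"
      unfolding a(4) [symmetric] \<gamma> by (simp add: hmult_add_center)
    also have "\<dots> = E *v (y' - y)" by (simp add: linear_diff [OF lin])
    finally have "E *v (y' - y) = E *v axis None (t / c)"
      using \<open>0 < c\<close> by (simp add: E axis_def)
    then have "y' - y = axis None (t / c)" using injE by (rule injD [rotated])
    then have "\<bar>t / c\<bar> = \<bar>(y' - y) $ None\<bar>" by (simp add: axis_def)
    also have "\<dots> \<le> norm (y' - y)" by (rule component_le_norm_cart)
    also have "\<dots> \<le> norm y' + norm y" by (rule norm_triangle_ineq4)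
    also have "\<dots> < 1" using a by (simp add: r_def)
    finally have "\<bar>t\<bar> < c" using \<open>0 < c\<close> by (simp add: abs_divide)
    then have "t = 0" using center [of t] a(1) \<gamma> by force
    then show ?thesis using \<gamma> by simp
  qed
  then have "\<bar>det E\<bar> * (r ^ CARD(('n + 'n) option) * measure lborel (ball (0::'n heis) 1)) \<le> measure lborel F"
    using frame_ball_volume [OF \<Gamma> F det \<open>0 \<le> r\<close>] unfolding E_def by blast
  then have "popp_coeff w g * (\<bar>det E\<bar> * (r ^ CARD(('n + 'n) option) * measure lborel (ball (0::'n heis) 1)))
      \<le> popp_coeff w g * measure lborel F"
    by (intro mult_left_mono) (simp_all add: popp_coeff_def)
  moreover have "c / (of_nat (CARD('n + 'n)) * M) * (r ^ CARD(('n + 'n) option) * measure lborel (ball (0::'n heis) 1))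
      \<le> popp_coeff w g * \<bar>det E\<bar> * (r ^ CARD(('n + 'n) option) * measure lborel (ball (0::'n heis) 1))"
    using popp \<open>0 < \<epsilon>\<close> by (intro mult_right_mono) (simp_all add: E_def r_def)
  ultimately show ?thesis unfolding r_def by (simp only: mult.assoc)
qed

text \<open>In an orthonormal frame of the whole algebra \<open>develop\<close> preserves norms, so
  a nonzero central lattice element has length at least c * \<open>center_norm\<close>. A ball of
  half that radius meets no central translate of itself, and \<epsilon> takes care of the other
  translates.\<close>

lemma popp_volume_UNIV:
  assumes \<Gamma>: "subgroup \<Gamma> heis_group" "\<And>p. p \<in> \<Gamma> \<Longrightarrow> p isolated_in \<Gamma>"
    and F: "fundamental_domain \<Gamma> F" "emeasure lborel F < \<infinity>"
    and "0 < c" and center: "\<And>t. t *\<^sub>R hcenter \<in> \<Gamma> \<Longrightarrow> t \<noteq> 0 \<Longrightarrow> c \<le> \<bar>t\<bar>"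
    and "0 < \<epsilon>" and short: "\<And>\<gamma>. \<gamma> \<in> \<Gamma> \<Longrightarrow> base \<gamma> \<noteq> 0 \<Longrightarrow> \<epsilon> \<le> norm (base \<gamma>)"
    and v: "v = UNIV"
  shows "min (\<epsilon> / 2) (c * center_norm / 2) ^ CARD(('n + 'n) option) * measure lborel (ball (0::'n heis) 1)
    \<le> popp_coeff UNIV g * measure lborel F"
proof -
  obtain f where f: "\<forall>i j. g (f i) (f j) = (if i = j then 1 else 0)"
    and det: "det (frame_matrix f) \<noteq> 0" and popp: "popp_coeff UNIV g * \<bar>det (frame_matrix f)\<bar> = 1"
    using popp_coeff_UNIV [OF v] by (elim exE conjE)
  define E where "E = frame_matrix f"
  define r where "r = min (\<epsilon> / 2) (c * center_norm / 2)"
  have lin: "linear ((*v) E)" by (rule matrix_vector_mul_linear)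
  have devE: "norm (develop (E *v y)) = norm y" for y
  proof -
    have "(norm (develop (E *v y)))\<^sup>2 = g (E *v y) (E *v y)"
      by (rule ip_develop [symmetric]) (simp add: v)
    also have "\<dots> = (\<Sum>i\<in>UNIV. (y $ i)\<^sup>2)"
      unfolding E_def frame_matrix_mult by (rule orthonormal_sum_square) (use f v in auto)
    also have "\<dots> = (norm y)\<^sup>2" by (simp add: norm_vec_def L2_set_def sum_nonneg)
    finally show ?thesis by (rule power2_eq_imp_eq) auto
  qed
  have "0 \<le> r" using \<open>0 < \<epsilon>\<close> \<open>0 < c\<close> center_norm_nonneg by (simp add: r_def)
  have "\<gamma> = 0" if a: "\<gamma> \<in> \<Gamma>" "norm y < r" "norm y' < r" "hmult \<gamma> (E *v y) = E *v y'" for \<gamma> y y'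
  proof -
    have "base \<gamma> = base (E *v y') - base (E *v y)"
      using arg_cong [OF a(4), of base] by (simp add: eq_diff_eq)
    then have "norm (base \<gamma>) \<le> norm (base (E *v y')) + norm (base (E *v y))"
      by (simp add: norm_triangle_ineq4)
    also have "\<dots> < r + r" using norm_base_le [of "E *v y"] norm_base_le [of "E *v y'"] devE a by simp
    also have "\<dots> \<le> \<epsilon>" by (simp add: r_def)
    finally have "base \<gamma> = 0" using short [OF a(1)] by force
    define t where "t = height \<gamma>"
    have \<gamma>: "\<gamma> = t *\<^sub>R hcenter" unfolding t_def by (rule base_eq_0) fact
    have "t *\<^sub>R hcenter = E *v y' - E *v y"
      unfolding a(4) [symmetric] \<gamma> by (simp add: hmult_add_center)
    also have "\<dots> = E *v (y' - y)" by (simp add: linear_diff [OF lin])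
    finally have "norm (develop (t *\<^sub>R hcenter)) = norm (y' - y)" by (simp add: devE)
    moreover have "(norm (develop (t *\<^sub>R hcenter)))\<^sup>2 = (center_norm * \<bar>t\<bar>)\<^sup>2"
      unfolding norm_develop by (simp add: base_simps height_simps power_mult_distrib)
    then have "norm (develop (t *\<^sub>R hcenter)) = center_norm * \<bar>t\<bar>"
      by (rule power2_eq_imp_eq) (simp_all add: center_norm_nonneg)
    moreover have "norm (y' - y) \<le> norm y' + norm y" by (rule norm_triangle_ineq4)
    moreover have "norm y' + norm y < c * center_norm" using a by (simp add: r_def)
    ultimately have "center_norm * \<bar>t\<bar> < center_norm * c" by (simp add: mult.commute)
    then have "\<bar>t\<bar> < c" using center_norm_nonneg by (simp add: mult_less_cancel_left)
    then have "t = 0" using center [of t] a(1) \<gamma> by force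
    then show ?thesis using \<gamma> by simp
  qed
  then have "\<bar>det E\<bar> * (r ^ CARD(('n + 'n) option) * measure lborel (ball (0::'n heis) 1)) \<le> measure lborel F"
    using frame_ball_volume [OF \<Gamma> F det \<open>0 \<le> r\<close>] unfolding E_def by blast
  then have "popp_coeff UNIV g * (\<bar>det E\<bar> * (r ^ CARD(('n + 'n) option) * measure lborel (ball (0::'n heis) 1)))
      \<le> popp_coeff UNIV g * measure lborel F"
    by (intro mult_left_mono) (simp_all add: popp_coeff_def)
  then show ?thesis using popp unfolding r_def by (simp add: E_def flip: mult.assoc)
qed

end


section \<open>Small volume forces short fibres\<close>

text \<open>\<open>covolume\<close> measures a domain picked by \<open>SOME\<close>, while a lattice
  comes with some domain of finite measure. Exhausting the picked one by bounded sets brings it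
  under the comparison of fundamental domains.\<close>

lemma fundamental_domain_finite:
  assumes \<Gamma>: "subgroup \<Gamma> heis_group" "countable \<Gamma>"
    and F: "fundamental_domain \<Gamma> F" "emeasure lborel F < \<infinity>" and F': "fundamental_domain \<Gamma> F'"
  shows "emeasure lborel F' < \<infinity>"
proof -
  define A where "A n = F' \<inter> ball 0 (real n)" for n
  have A: "A n \<in> sets borel" "bounded (A n)" for n
    using F' by (auto simp: A_def fundamental_domain_def intro: bounded_subset [OF bounded_ball])
  have "emeasure lborel (A n) \<le> emeasure lborel F" for n
    by (rule fundamental_domain_measure [OF \<Gamma> F(1) A])
      (use fundamental_domain_transversal(2) [OF \<Gamma>(1) F'] in \<open>auto simp: A_def\<close>)
  then have "(SUP n. emeasure lborel (A n)) \<le> emeasure lborel F" by (rule SUP_least)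
  moreover have "(SUP n. emeasure lborel (A n)) = emeasure lborel (\<Union>n. A n)"
    using A by (intro SUP_emeasure_incseq) (auto simp: A_def incseq_def)
  moreover have "(\<Union>n. A n) = F'"
    using reals_Archimedean2 by (auto simp: A_def)
  ultimately show ?thesis using F(2) by (simp add: order_le_less_trans)
qed

context sr_frame
begin

text \<open>A bound common to all candidates passes to the infimum. Applied to w = v, its positivity
  also rules out K = 0, which permits dividing by K.\<close>

lemma mvol_ge:
  assumes "\<And>w. subspace w \<Longrightarrow> bracket_generating w \<Longrightarrow> w \<subseteq> v \<Longrightarrow> \<psi> \<le> popp_coeff w g * K" "0 < \<psi>" "0 \<le> K"
  shows "\<psi> \<le> mvol v g * K" "0 \<le> mvol v g"
proof -
  have v: "subspace v" "bracket_generating v" using sr by (auto simp: subriemannian_def)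
  have "\<psi> \<le> popp_coeff v g * K" using assms(1) [OF v] by simp
  with assms(2,3) have K: "0 < K" by (cases "K = 0") auto
  have ne: "{popp_coeff w g | w. subspace w \<and> bracket_generating w \<and> w \<subseteq> v} \<noteq> {}"
    using v by blast
  have "\<psi> / K \<le> mvol v g"
    unfolding mvol_def
  proof (rule cInf_greatest [OF ne])
    fix x assume "x \<in> {popp_coeff w g | w. subspace w \<and> bracket_generating w \<and> w \<subseteq> v}"
    then obtain w where "x = popp_coeff w g" "subspace w" "bracket_generating w" "w \<subseteq> v" by blast
    then show "\<psi> / K \<le> x" using assms(1) [of w] K by (simp add: pos_divide_le_eq)
  qed
  then show "\<psi> \<le> mvol v g * K" using K by (simp add: pos_divide_le_eq)
  have "0 \<le> \<psi> / K" using assms(2) K by simp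
  with \<open>\<psi> / K \<le> mvol v g\<close> show "0 \<le> mvol v g" by linarith
qed

end

text \<open>The fibres of \<open>\<Gamma>\H\<^sub>n\<close> over the flat torus \<open>E / base(\<Gamma>)\<close> are short: otherwise the injectivity
  radius, and with it the total minimal Popp volume, would be bounded below.\<close>

lemma small_volume_almost_flat:
  fixes D \<delta> :: real
  assumes D: "0 < D" and \<delta>: "0 < \<delta>"
  shows "\<exists>\<psi>>0. \<forall>(\<Gamma> :: 'n::finite heis set) v g. heis_lattice \<Gamma> \<and> subriemannian v g \<and>
    metric_diameter (rcosets\<^bsub>heis_group\<^esub> \<Gamma>) (quotient_dist v g) \<le> ennreal D \<and> total_mvol \<Gamma> v g < ennreal \<psi> \<longrightarrow>
    (\<exists>(L :: (real ^ ('n + 'n)) set) s. 0 \<in> L \<and> (\<forall>a\<in>L. \<forall>b\<in>L. a - b \<in> L) \<and>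
      (\<forall>x. s x \<in> rcosets\<^bsub>heis_group\<^esub> \<Gamma>) \<and>
      (\<forall>x y. \<bar>quotient_dist v g (s x) (s y) - infdist (y - x) L\<bar> \<le> \<delta>) \<and>
      (\<forall>A \<in> rcosets\<^bsub>heis_group\<^esub> \<Gamma>. \<exists>x. \<bar>quotient_dist v g A (s x)\<bar> \<le> \<delta>))"
proof -
  define D' where "D' = D + 1"
  define N where "N = real (CARD('n + 'n))"
  define V where "V = measure lborel (ball (0::'n heis) 1)"
  \<comment> \<open>Heights to be corrected are at most 2 c, at cost 4423 * sqrt (4 c / M); this is
    at most \<delta> once c / M \<le> \<tau>0.\<close>
  define \<tau>0 where "\<tau>0 = (\<delta> / 4423)\<^sup>2 / 4"
  \<comment> \<open>If c / M exceeds \<tau>0, the nonzero projections of lattice elements are at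
    least this long.\<close>
  define \<epsilon>0 where "\<epsilon>0 = \<tau>0 / (4 * D')"
  \<comment> \<open>The volume bounds for hyperplanes and for the whole algebra, with c / M,
    \<epsilon> and c * \<open>center_norm\<close> replaced by the thresholds \<tau>0, \<epsilon>0
    and \<delta> / 2. They depend on n, D and \<delta> alone.\<close>
  define \<psi>1 where "\<psi>1 = \<tau>0 / N * (min (\<epsilon>0 / 2) (1 / 2) ^ CARD(('n + 'n) option) * V)"
  define \<psi>2 where "\<psi>2 = min (\<epsilon>0 / 2) (\<delta> / 2 / 2) ^ CARD(('n + 'n) option) * V"
  define \<psi> where "\<psi> = min \<psi>1 \<psi>2"
  have pos: "0 < D'" "0 < N" "0 < V" "0 < \<tau>0" "0 < \<epsilon>0"
    using D \<delta> by (auto simp: D'_def N_def V_def \<tau>0_def \<epsilon>0_def content_ball_pos)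
  then have \<psi>: "0 < \<psi>" using \<delta> by (simp add: \<psi>_def \<psi>1_def \<psi>2_def)
  show ?thesis
  proof (intro exI [of _ \<psi>] conjI allI impI \<psi>)
    fix \<Gamma> :: "'n heis set" and v g
    assume A: "heis_lattice \<Gamma> \<and> subriemannian v g \<and>
      metric_diameter (rcosets\<^bsub>heis_group\<^esub> \<Gamma>) (quotient_dist v g) \<le> ennreal D \<and> total_mvol \<Gamma> v g < ennreal \<psi>"
    then have sr: "subriemannian v g"
      and diam: "metric_diameter (rcosets\<^bsub>heis_group\<^esub> \<Gamma>) (quotient_dist v g) \<le> ennreal D"
      and total: "total_mvol \<Gamma> v g < ennreal \<psi>" by auto
    have \<Gamma>: "subgroup \<Gamma> heis_group" "\<And>p. p \<in> \<Gamma> \<Longrightarrow> p isolated_in \<Gamma>"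
      and exF: "\<exists>F. fundamental_domain \<Gamma> F \<and> emeasure lborel F < \<infinity>"
      using A unfolding heis_lattice_def by blast+
    obtain F0 where F0: "fundamental_domain \<Gamma> F0" "emeasure lborel F0 < \<infinity>" using exF by blast
    define F where "F = (SOME F. fundamental_domain \<Gamma> F)"
    have F1: "fundamental_domain \<Gamma> F" unfolding F_def by (rule someI [of _ F0]) (rule F0)
    have F2: "emeasure lborel F < \<infinity>"
      by (rule fundamental_domain_finite [OF \<Gamma>(1) isolated_imp_countable [OF \<Gamma>(2)] F0 F1])
    define K where "K = measure lborel F"
    have K: "emeasure lborel F = ennreal K" "0 \<le> K"
      using F2 by (auto simp: K_def emeasure_eq_ennreal_measure)
    obtain e :: "'n + 'n \<Rightarrow> 'n heis" where e: "\<And>i. e i \<in> v"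
      "\<And>i j. g (e i) (e j) = (if i = j then 1 else 0)" "\<And>i. hcenter \<in> v \<Longrightarrow> g (e i) hcenter = 0"
      by (rule frame_exists [OF sr]) blast
    interpret sr_frame v g e by unfold_locales (rule sr e; assumption?)+
    obtain M x0 y0 where M: "0 < M" "\<And>u u'. \<bar>hform u u'\<bar> \<le> M * norm (base u) * norm (base u')"
      and xy0: "norm x0 \<le> 1" "norm y0 \<le> 1" "M / 2 \<le> hform (lift x0) (lift y0)"
      using form_bound_exists by (elim exE conjE) (rule that; blast)
    have cov: "\<exists>\<gamma>\<in>\<Gamma>. norm (x - base \<gamma>) \<le> D'" for x
      unfolding D'_def by (rule lattice_covering [OF \<Gamma>(1) D diam])
    have "\<exists>c>0. (\<forall>t. t *\<^sub>R hcenter \<in> \<Gamma> \<longrightarrow> t \<noteq> 0 \<longrightarrow> c \<le> \<bar>t\<bar>) \<and>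
        (\<exists>t. t *\<^sub>R hcenter \<in> \<Gamma> \<and> 0 < t \<and> t \<le> 2 * c) \<and>
        (\<forall>\<gamma>\<in>\<Gamma>. base \<gamma> \<noteq> 0 \<longrightarrow> c / (4 * D' * M) \<le> norm (base \<gamma>))"
      by (rule lattice_center [OF \<Gamma> pos(1) cov M])
    then obtain c t where c: "0 < c" and center: "\<forall>t. t *\<^sub>R hcenter \<in> \<Gamma> \<longrightarrow> t \<noteq> 0 \<longrightarrow> c \<le> \<bar>t\<bar>"
      and t: "t *\<^sub>R hcenter \<in> \<Gamma>" "0 < t" "t \<le> 2 * c"
      and short: "\<forall>\<gamma>\<in>\<Gamma>. base \<gamma> \<noteq> 0 \<longrightarrow> c / (4 * D' * M) \<le> norm (base \<gamma>)"
      by (elim exE conjE)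
    \<comment> \<open>The second alternative includes \<open>hcenter \<in> v\<close>, because
      \<open>center_norm\<close> is 0 by default and then carries no information on vertical
      lengths.\<close>
    have fibre: "c / M \<le> \<tau>0 \<or> (hcenter \<in> v \<and> c * center_norm \<le> \<delta> / 2)"
    proof (rule ccontr)
      assume "\<not> ?thesis"
      then have \<tau>: "\<tau>0 < c / M" and \<rho>: "hcenter \<in> v \<Longrightarrow> \<delta> / 2 < c * center_norm" by auto
      define \<epsilon> where "\<epsilon> = c / (4 * D' * M)"
      have \<epsilon>: "\<epsilon>0 \<le> \<epsilon>"
      proof -
        have "\<tau>0 / (4 * D') \<le> (c / M) / (4 * D')" using \<tau> pos(1) by (intro divide_right_mono) auto
        then show ?thesis by (simp add: \<epsilon>0_def \<epsilon>_def mult.commute)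
      qed
      have "0 < \<epsilon>" using \<epsilon> pos by linarith
      have "\<psi> \<le> popp_coeff w g * K" if w: "subspace w" "bracket_generating w" "w \<subseteq> v" for w
      proof (cases "w = UNIV")
        case False
        have "\<psi> \<le> \<psi>1" by (simp add: \<psi>_def)
        also have "\<psi>1 \<le> (c / M) / N * (min (\<epsilon> / 2) (1 / 2) ^ CARD(('n + 'n) option) * V)"
          unfolding \<psi>1_def using \<tau> \<epsilon> pos c M(1)
          by (intro mult_mono divide_right_mono power_mono) auto
        also have "\<dots> = c / (N * M) * (min (\<epsilon> / 2) (1 / 2) ^ CARD(('n + 'n) option) * V)"
          by (simp add: mult.commute)
        also have "\<dots> \<le> popp_coeff w g * K"
          unfolding N_def V_def K_def
          by (rule popp_volume_hyperplane [OF \<Gamma> F1 F2 c _ \<open>0 < \<epsilon>\<close> _ M w False])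
            (use center short in \<open>auto simp: \<epsilon>_def\<close>)
        finally show ?thesis .
      next
        case True
        then have v: "v = UNIV" using w(3) by auto
        have "\<psi> \<le> \<psi>2" by (simp add: \<psi>_def)
        also have "\<psi>2 \<le> min (\<epsilon> / 2) (c * center_norm / 2) ^ CARD(('n + 'n) option) * V"
          unfolding \<psi>2_def using \<rho> v \<epsilon> pos \<delta>
          by (intro mult_right_mono power_mono) auto
        also have "\<dots> \<le> popp_coeff w g * K"
          unfolding V_def K_def True
          by (rule popp_volume_UNIV [OF \<Gamma> F1 F2 c _ \<open>0 < \<epsilon>\<close> _ v])
            (use center short in \<open>auto simp: \<epsilon>_def\<close>)
        finally show ?thesis .
      qed
      then have mv: "\<psi> \<le> mvol v g * K" "0 \<le> mvol v g"
        using mvol_ge [of \<psi> K] \<psi> K(2) by blast+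
      \<comment> \<open>Nonnegativity of \<open>mvol\<close> matters here: \<open>ennreal\<close>
        truncates negative numbers to 0 and is multiplicative only on nonnegative ones.\<close>
      have "total_mvol \<Gamma> v g = ennreal (mvol v g * K)"
        unfolding total_mvol_def covolume_def F_def [symmetric] K(1) using mv(2) by (simp add: ennreal_mult K(2))
      then show False using total mv(1) by (simp add: ennreal_leI leD)
    qed
    have F: "sr_dist v g p (hmult p (lift x + z *\<^sub>R hcenter)) \<le> norm x + \<delta>" if z: "\<bar>z\<bar> \<le> t" for p x z
      using fibre
    proof
      assume "c / M \<le> \<tau>0"
      have "2 * \<bar>z\<bar> / M \<le> 2 * (2 * c) / M" using z t(3) M(1) by (intro divide_right_mono mult_left_mono) auto
      also have "\<dots> = 4 * (c / M)" by simp
      also have "\<dots> \<le> (\<delta> / 4423)\<^sup>2" using \<open>c / M \<le> \<tau>0\<close> unfolding \<tau>0_def by linarith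
      finally have "sqrt (2 * \<bar>z\<bar> / M) \<le> \<delta> / 4423" using \<delta> by (intro real_le_lsqrt) auto
      then show ?thesis using sr_dist_le_form [OF M(1) xy0, of p x z] by simp
    next
      assume a: "hcenter \<in> v \<and> c * center_norm \<le> \<delta> / 2"
      have "center_norm * \<bar>z\<bar> \<le> center_norm * (2 * c)"
        using z t(3) center_norm_nonneg by (intro mult_left_mono) auto
      also have "\<dots> \<le> \<delta>" using a by (simp add: ac_simps)
      finally show ?thesis using sr_dist_le_center [of p x z] a by linarith
    qed
    have close: "\<bar>quotient_dist v g (orbit \<Gamma> p) (orbit \<Gamma> q) - infdist (base q - base p) (base ` \<Gamma>)\<bar> \<le> \<delta>" for p q
    proof -
      have "quotient_dist v g (orbit \<Gamma> p) (orbit \<Gamma> q) \<le> infdist (base q - base p) (base ` \<Gamma>) + \<delta>"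
        by (rule quotient_dist_le [OF \<Gamma>(1) t(2,1) F])
      then show ?thesis
        using quotient_dist_ge [OF \<Gamma>(1), of q p] \<delta> by (simp add: abs_le_iff)
    qed
    \<comment> \<open>The torus is compared along the section of height zero. The coset of p is
      \<delta>-close to the section over \<open>base p\<close>, since the base displacement is then
      0, an element of L.\<close>
    show "\<exists>(L :: (real ^ ('n + 'n)) set) s. 0 \<in> L \<and> (\<forall>a\<in>L. \<forall>b\<in>L. a - b \<in> L) \<and>
      (\<forall>x. s x \<in> rcosets\<^bsub>heis_group\<^esub> \<Gamma>) \<and>
      (\<forall>x y. \<bar>quotient_dist v g (s x) (s y) - infdist (y - x) L\<bar> \<le> \<delta>) \<and>
      (\<forall>A \<in> rcosets\<^bsub>heis_group\<^esub> \<Gamma>. \<exists>x. \<bar>quotient_dist v g A (s x)\<bar> \<le> \<delta>)"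
    proof (intro exI [of _ "base ` \<Gamma>"] exI [of _ "\<lambda>x. orbit \<Gamma> (lift x)"] conjI allI ballI)
      show L0: "0 \<in> base ` \<Gamma>"
        by (rule image_eqI [of _ _ 0]) (simp_all add: heis_subgroup(1) [OF \<Gamma>(1)] base_simps)
      show "a - b \<in> base ` \<Gamma>" if "a \<in> base ` \<Gamma>" "b \<in> base ` \<Gamma>" for a b
      proof -
        obtain p q where pq: "p \<in> \<Gamma>" "q \<in> \<Gamma>" "a = base p" "b = base q" using \<open>a \<in> _\<close> \<open>b \<in> _\<close> by blast
        have "a - b = base (hmult p (- q))" by (simp add: pq base_simps)
        moreover have "hmult p (- q) \<in> \<Gamma>" by (intro heis_subgroup(2,3) [OF \<Gamma>(1)] pq)
        ultimately show ?thesis by blast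
      qed
      show "orbit \<Gamma> (lift x) \<in> rcosets\<^bsub>heis_group\<^esub> \<Gamma>" for x by (simp add: rcosets_heis_group)
      show "\<bar>quotient_dist v g (orbit \<Gamma> (lift x)) (orbit \<Gamma> (lift y)) - infdist (y - x) (base ` \<Gamma>)\<bar> \<le> \<delta>" for x y
        using close [of "lift x" "lift y"] by simp
      fix A assume "A \<in> rcosets\<^bsub>heis_group\<^esub> \<Gamma>"
      then obtain p where p: "A = orbit \<Gamma> p" by (auto simp: rcosets_heis_group)
      show "\<exists>x. \<bar>quotient_dist v g A (orbit \<Gamma> (lift x))\<bar> \<le> \<delta>"
        using close [of p "lift (base p)"] L0 by (intro exI [of _ "base p"]) (simp add: p)
    qed
  qed
qed


section \<open>Gromov--Hausdorff limits of Euclidean quotients\<close>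

definition ultrafilter :: "'a filter \<Rightarrow> bool" where
  "ultrafilter U \<longleftrightarrow> U \<noteq> bot \<and> (\<forall>P. eventually P U \<or> eventually (\<lambda>x. \<not> P x) U)"

text \<open>Zorn's lemma for the proper filters below F, ordered by refinement. The infimum of a
  nonempty chain is proper, because what holds eventually for it holds eventually for some
  member.\<close>

lemma ultrafilter_exists:
  assumes "F \<noteq> (bot :: 'a filter)"
  shows "\<exists>U\<le>F. ultrafilter U"
proof -
  define A where "A = {G. G \<noteq> bot \<and> G \<le> F}"
  have po: "partial_order_on A (relation_of (\<ge>) A)"
    by (rule partial_order_on_relation_ofI) auto
  have ub: "\<exists>u\<in>A. \<forall>a\<in>C. u \<le> a" if C: "C \<in> Chains (relation_of (\<ge>) A)" for C
  proof (cases "C = {}")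
    case True
    then show ?thesis using assms by (auto simp: A_def)
  next
    case False
    have CA: "C \<subseteq> A" and ch: "\<And>G H. G \<in> C \<Longrightarrow> H \<in> C \<Longrightarrow> G \<le> H \<or> H \<le> G"
      using C by (auto simp: Chains_def relation_of_def)
    have "Inf C \<noteq> bot"
    proof
      assume "Inf C = bot"
      then have "eventually (\<lambda>_. False) (Inf C)" by simp
      then have "\<exists>G\<in>C. eventually (\<lambda>_. False) G"
        by (subst (asm) eventually_Inf_base [OF False]) (use ch in \<open>metis inf.orderE inf.commute order_refl\<close>)
      then show False using CA by (auto simp: A_def eventually_False)
    qed
    moreover obtain G where "G \<in> C" using False by blast
    then have "Inf C \<le> F" using CA by (auto simp: A_def intro: Inf_lower2)
    ultimately show ?thesis by (auto simp: A_def intro: Inf_lower)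
  qed
  have "\<exists>U\<in>A. \<forall>G\<in>A. G \<le> U \<longrightarrow> G = U"
    by (rule predicate_Zorn [OF po ub])
  then obtain U where U: "U \<in> A" and max: "\<And>G. G \<in> A \<Longrightarrow> G \<le> U \<Longrightarrow> G = U"
    by blast
  \<comment> \<open>If adjoining P leaves a proper filter, minimality makes it equal to U; if it
    does not, the negation of P holds eventually.\<close>
  have "eventually P U \<or> eventually (\<lambda>x. \<not> P x) U" for P
  proof (cases "inf U (principal {x. P x}) = bot")
    case True
    then have "eventually (\<lambda>_. False) (inf U (principal {x. P x}))" by simp
    then have "eventually (\<lambda>x. \<not> P x) U" by (simp add: eventually_inf_principal)
    then show ?thesis ..
  next
    case False
    then have "inf U (principal {x. P x}) = U"
      using U by (intro max) (auto simp: A_def intro: le_infI1)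
    moreover have "eventually P (inf U (principal {x. P x}))" by (simp add: eventually_inf_principal)
    ultimately have "eventually P U" by simp
    then show ?thesis ..
  qed
  then show ?thesis using U by (auto simp: A_def ultrafilter_def)
qed

text \<open>If no point of K were a limit, each would have a neighbourhood that f avoids eventually,
  by the ultrafilter dichotomy, and finitely many of these neighbourhoods cover K.\<close>

lemma ultrafilter_limit_compact:
  fixes f :: "'b \<Rightarrow> 'a::topological_space"
  assumes U: "ultrafilter U" and "compact K" and f: "eventually (\<lambda>n. f n \<in> K) U"
  shows "\<exists>l\<in>K. (f \<longlongrightarrow> l) U"
proof (rule ccontr)
  assume "\<not> ?thesis"
  then have "\<forall>l\<in>K. \<exists>S. open S \<and> l \<in> S \<and> \<not> eventually (\<lambda>n. f n \<in> S) U"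
    unfolding tendsto_def by blast
  then obtain S where S: "\<And>l. l \<in> K \<Longrightarrow> open (S l) \<and> l \<in> S l \<and> \<not> eventually (\<lambda>n. f n \<in> S l) U" by metis
  then have "K \<subseteq> (\<Union>l\<in>K. S l)" by blast
  with \<open>compact K\<close> obtain C where C: "C \<subseteq> K" "finite C" "K \<subseteq> (\<Union>l\<in>C. S l)"
    using S by (elim compactE_image) auto
  have "eventually (\<lambda>n. \<forall>l\<in>C. f n \<notin> S l) U"
    using C S U by (intro eventually_ball_finite) (auto simp: ultrafilter_def)
  with f have "eventually (\<lambda>n. False) U"
    by eventually_elim (use C in blast)
  then show False using U by (simp add: ultrafilter_def eventually_False)
qed

context Metric_space
begin

text \<open>The covering argument again, with balls, for a metric carried by a set instead of a
  type.\<close>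

lemma ultrafilter_limit:
  assumes U: "ultrafilter U" and "compact_space mtopology" and f: "\<And>n. f n \<in> M"
  shows "\<exists>l\<in>M. ((\<lambda>n. d (f n) l) \<longlongrightarrow> 0) U"
proof (rule ccontr)
  assume "\<not> ?thesis"
  then have "\<forall>l\<in>M. \<exists>e>0. \<not> eventually (\<lambda>n. d (f n) l < e) U"
    unfolding tendsto_iff by (auto simp: dist_real_def)
  then obtain e where e: "\<And>l. l \<in> M \<Longrightarrow> 0 < e l \<and> \<not> eventually (\<lambda>n. d (f n) l < e l) U" by metis
  have "\<forall>B\<in>(\<lambda>l. mball l (e l)) ` M. openin mtopology B" by auto
  moreover have "M \<subseteq> \<Union>((\<lambda>l. mball l (e l)) ` M)" using e by auto
  ultimately have "\<exists>\<F>. finite \<F> \<and> \<F> \<subseteq> (\<lambda>l. mball l (e l)) ` M \<and> M \<subseteq> \<Union>\<F>"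
    using assms(2) [unfolded compact_space_alt topspace_mtopology, THEN spec, of "(\<lambda>l. mball l (e l)) ` M"] by simp
  then obtain \<F> where \<F>: "finite \<F>" "\<F> \<subseteq> (\<lambda>l. mball l (e l)) ` M" "M \<subseteq> \<Union>\<F>"
    by (elim exE conjE)
  obtain C where C: "C \<subseteq> M" "finite C" "\<F> = (\<lambda>l. mball l (e l)) ` C"
    using finite_subset_image [OF \<F>(1,2)] by blast
  have ev: "eventually (\<lambda>n. \<forall>l\<in>C. \<not> d (f n) l < e l) U"
    using C e U by (intro eventually_ball_finite) (auto simp: ultrafilter_def)
  have ex: "\<exists>l\<in>C. d (f n) l < e l" for n
  proof -
    have "f n \<in> \<Union>\<F>" using f \<F>(3) by blast
    then obtain l where "l \<in> C" "f n \<in> mball l (e l)" using C(3) by blast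
    then show ?thesis by (auto simp: commute)
  qed
  have "eventually (\<lambda>n. False) U"
    by (rule eventually_mono [OF ev]) (use ex in blast)
  then show False using U by (simp add: ultrafilter_def eventually_False)
qed

end

text \<open>The distance to a subgroup is the length function of the quotient group. Its
  subadditivity passes to limits and makes their zero sets subgroups.\<close>

lemma infdist_subgroup_diff:
  fixes L :: "'a::real_normed_vector set"
  assumes "0 \<in> L" and sub: "\<And>a b. a \<in> L \<Longrightarrow> b \<in> L \<Longrightarrow> a - b \<in> L"
  shows "infdist (x - y) L \<le> infdist x L + infdist y L"
proof -
  have L: "L \<noteq> {}" using assms by blast
  have 1: "infdist (x - y) L \<le> dist x a + dist y b" if "a \<in> L" "b \<in> L" for a b
  proof -
    have "infdist (x - y) L \<le> dist (x - y) (a - b)" by (intro infdist_le sub that)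
    also have "\<dots> = norm ((x - a) - (y - b))" by (simp add: dist_norm algebra_simps)
    also have "\<dots> \<le> dist x a + dist y b" unfolding dist_norm by (rule norm_triangle_ineq4)
    finally show ?thesis .
  qed
  have "infdist (x - y) L - dist y b \<le> infdist x L" if "b \<in> L" for b
    unfolding infdist_notempty [OF L, of x]
    by (rule cINF_greatest [OF L]) (use 1 [OF _ that] in \<open>simp add: diff_le_eq\<close>)
  then have 2: "infdist (x - y) L - infdist x L \<le> dist y b" if "b \<in> L" for b
    using that by (simp add: algebra_simps)
  have "infdist (x - y) L - infdist x L \<le> infdist y L"
    unfolding infdist_notempty [OF L, of y] by (rule cINF_greatest [OF L 2])
  then show ?thesis by simp
qed

lemma infdist_almost_attained:
  assumes "L \<noteq> {}" "0 < e"
  shows "\<exists>l\<in>L. dist x l < infdist x L + e"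
proof -
  have "(INF l\<in>L. dist x l) < infdist x L + e" using assms by (simp add: infdist_notempty)
  then show ?thesis using assms(1) by (subst (asm) cINF_less_iff) auto
qed

lemma (in Metric_space) dist_diff_le:
  assumes "a \<in> M" "b \<in> M" "a' \<in> M" "b' \<in> M"
  shows "\<bar>d a b - d a' b'\<bar> \<le> d a a' + d b b'"
  using triangle [OF assms(1,3,2)] triangle [OF assms(3,4,2)] triangle [OF assms(3,1,4)] triangle [OF assms(1,2,4)]
    commute [of a' a] commute [of b' b] by (simp add: abs_le_iff)

text \<open>Ultrafilter limits replace the choice of a diagonal subsequence.\<close>

lemma (in Metric_space) limit_of_quotients:
  fixes L :: "nat \<Rightarrow> 'e::euclidean_space set" and F :: "nat \<Rightarrow> 'e \<Rightarrow> 'a"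
  assumes comp: "compact_space mtopology"
    and L0: "\<And>j. 0 \<in> L j" and Lsub: "\<And>j a b. a \<in> L j \<Longrightarrow> b \<in> L j \<Longrightarrow> a - b \<in> L j"
    and FM: "\<And>j x. F j x \<in> M"
    and close: "\<And>j x y. \<bar>d (F j x) (F j y) - infdist (y - x) (L j)\<bar> \<le> inverse (real (Suc j))"
    and dense: "\<And>j p. p \<in> M \<Longrightarrow> \<exists>x. d (F j x) p \<le> inverse (real (Suc j))"
  shows "\<exists>(K :: 'e set) G. closed K \<and> 0 \<in> K \<and> (\<forall>a\<in>K. \<forall>b\<in>K. a - b \<in> K) \<and> range G = M \<and>
    (\<forall>x y. d (G x) (G y) = infdist (y - x) K)"
proof -
  obtain U :: "nat filter" where U: "U \<le> sequentially" "ultrafilter U"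
    using ultrafilter_exists [of sequentially] by auto
  have Ub: "U \<noteq> bot" using U(2) by (simp add: ultrafilter_def)
  have \<epsilon>: "((\<lambda>j. inverse (real (Suc j))) \<longlongrightarrow> 0) U"
    by (rule tendsto_mono [OF U(1) LIMSEQ_inverse_real_of_nat])
  have "\<forall>x. \<exists>l\<in>M. ((\<lambda>j. d (F j x) l) \<longlongrightarrow> 0) U"
    by (intro allI ultrafilter_limit U(2) comp FM)
  from choice [OF this [unfolded Bex_def]] obtain G
    where GM: "\<And>x. G x \<in> M" and G: "\<And>x. ((\<lambda>j. d (F j x) (G x)) \<longlongrightarrow> 0) U" by blast
  have lim: "((\<lambda>j. infdist (y - x) (L j)) \<longlongrightarrow> d (G x) (G y)) U" for x y
  proof (rule Lim_transform [OF tendsto_const])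
    have "((\<lambda>j. d (F j x) (G x) + d (F j y) (G y) + inverse (real (Suc j))) \<longlongrightarrow> 0 + 0 + 0) U"
      by (intro tendsto_add G \<epsilon>)
    then have z: "((\<lambda>j. d (F j x) (G x) + d (F j y) (G y) + inverse (real (Suc j))) \<longlongrightarrow> 0) U" by simp
    show "((\<lambda>j. infdist (y - x) (L j) - d (G x) (G y)) \<longlongrightarrow> 0) U"
    proof (rule Lim_null_comparison [OF always_eventually z], rule allI)
      fix j
      have "\<bar>d (G x) (G y) - d (F j x) (F j y)\<bar> \<le> d (F j x) (G x) + d (F j y) (G y)"
        using dist_diff_le [OF GM [of x] GM [of y] FM [of j x] FM [of j y]] by (simp add: commute)
      then show "norm (infdist (y - x) (L j) - d (G x) (G y)) \<le> d (F j x) (G x) + d (F j y) (G y) + inverse (real (Suc j))"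
        using close [of j x y] unfolding real_norm_def by linarith
    qed
  qed
  \<comment> \<open>The limit of the length functions. Distances between values of G depend on
    differences only, so \<rho> determines them all.\<close>
  define \<rho> where "\<rho> z = d (G 0) (G z)" for z
  have lim\<rho>: "((\<lambda>j. infdist z (L j)) \<longlongrightarrow> \<rho> z) U" for z
    using lim [of z 0] by (simp add: \<rho>_def)
  have dG: "d (G x) (G y) = \<rho> (y - x)" for x y
    by (rule tendsto_unique [OF Ub lim lim\<rho>])
  have \<rho>0: "0 \<le> \<rho> z" "\<rho> 0 = 0" for z by (simp_all add: \<rho>_def GM)
  have \<rho>_diff: "\<rho> (x - y) \<le> \<rho> x + \<rho> y" for x y
    by (rule tendsto_le [OF Ub tendsto_add [OF lim\<rho> lim\<rho>] lim\<rho>])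
       (intro always_eventually allI infdist_subgroup_diff L0 Lsub)
  have \<rho>_norm: "\<rho> z \<le> norm z" for z
  proof (rule tendsto_le [OF Ub tendsto_const lim\<rho>], intro always_eventually allI)
    show "infdist z (L j) \<le> norm z" for j using infdist_le [OF L0, of z j] by simp
  qed
  have \<rho>_minus: "\<rho> (- z) = \<rho> z" for z
    using \<rho>_diff [of 0 z] \<rho>_diff [of 0 "- z"] \<rho>0(2) by simp
  define K where "K = {z. \<rho> z = 0}"
  have "continuous_on UNIV \<rho>"
    unfolding continuous_on_iff
  proof (intro ballI allI impI)
    fix x and e :: real assume "0 < e"
    have "dist (\<rho> y) (\<rho> x) < e" if "dist y x < e" for y
    proof -
      have "\<rho> y \<le> \<rho> (y - x) + \<rho> x" using \<rho>_diff [of "y - x" "- x"] \<rho>_minus by simp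
      moreover have "\<rho> x \<le> \<rho> (x - y) + \<rho> y" using \<rho>_diff [of "x - y" "- y"] \<rho>_minus by simp
      moreover have "\<rho> (y - x) \<le> dist y x" "\<rho> (x - y) \<le> dist y x"
        using \<rho>_norm [of "y - x"] \<rho>_norm [of "x - y"] by (simp_all add: dist_norm norm_minus_commute)
      ultimately show ?thesis using that unfolding dist_real_def by linarith
    qed
    then show "\<exists>\<delta>>0. \<forall>y\<in>UNIV. dist y x < \<delta> \<longrightarrow> dist (\<rho> y) (\<rho> x) < e" using \<open>0 < e\<close> by blast
  qed
  then have "closed K" unfolding K_def by (intro closed_Collect_eq) auto
  have \<rho>K: "\<rho> z = infdist z K" for z
  proof (rule antisym)
    have K: "K \<noteq> {}" using \<rho>0 by (auto simp: K_def)
    show "\<rho> z \<le> infdist z K"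
      unfolding infdist_notempty [OF K]
    proof (rule cINF_greatest [OF K])
      fix l assume "l \<in> K"
      then show "\<rho> z \<le> dist z l"
        using \<rho>_diff [of "z - l" "- l"] \<rho>_minus [of l] \<rho>_norm [of "z - l"] by (simp add: K_def dist_norm)
    qed
    \<comment> \<open>Almost nearest points to z in L j stay in a fixed ball. Their ultralimit has
      \<rho> = 0, so it lies in K, and its distance to z is at most \<rho> z.\<close>
    have "\<forall>j. \<exists>l. l \<in> L j \<and> dist z l < infdist z (L j) + inverse (real (Suc j))"
    proof
      fix j
      have "L j \<noteq> {}" using L0 by blast
      from infdist_almost_attained [OF this, of "inverse (real (Suc j))" z]
      show "\<exists>l. l \<in> L j \<and> dist z l < infdist z (L j) + inverse (real (Suc j))" by auto
    qed
    from choice [OF this] obtain l where l: "\<And>j. l j \<in> L j"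
      and ld: "\<And>j. dist z (l j) < infdist z (L j) + inverse (real (Suc j))" by blast
    have u: "((\<lambda>j. infdist z (L j) + inverse (real (Suc j))) \<longlongrightarrow> \<rho> z) U"
      using tendsto_add [OF lim\<rho> \<epsilon>] by simp
    have "eventually (\<lambda>j. infdist z (L j) + inverse (real (Suc j)) < \<rho> z + 1) U"
      by (rule order_tendstoD(2) [OF u]) simp
    then have "eventually (\<lambda>j. l j \<in> cball z (\<rho> z + 1)) U"
    proof eventually_elim
      case (elim j)
      then show ?case using ld [of j] unfolding mem_cball by linarith
    qed
    from ultrafilter_limit_compact [OF U(2) compact_cball this]
    obtain l' where l': "(l \<longlongrightarrow> l') U" by blast
    have d': "((\<lambda>j. dist l' (l j)) \<longlongrightarrow> 0) U"
      using tendsto_dist [OF tendsto_const l', of l'] by simp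
    have "\<rho> l' \<le> 0"
      by (rule tendsto_le [OF Ub d' lim\<rho>]) (intro always_eventually allI infdist_le l)
    then have "l' \<in> K" using \<rho>0(1) [of l'] by (simp add: K_def)
    have "dist z l' \<le> \<rho> z"
      by (rule tendsto_le [OF Ub u tendsto_dist [OF tendsto_const l']])
        (intro always_eventually allI less_imp_le ld)
    then show "infdist z K \<le> \<rho> z" using infdist_le2 [OF \<open>l' \<in> K\<close>] by blast
  qed
  have "M \<subseteq> range G"
  proof
    fix p assume p: "p \<in> M"
    have "\<forall>j. \<exists>x. d (F j x) p \<le> inverse (real (Suc j))" using dense [OF p] by blast
    from choice [OF this] obtain x where x: "\<And>j. d (F j (x j)) p \<le> inverse (real (Suc j))" by blast
    \<comment> \<open>The points x j may escape to infinity. Subtracting an almost nearest element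
      of L j moves the image under F j by no more than the error of the model and brings the points
      into a fixed ball.\<close>
    have "\<forall>j. \<exists>l. l \<in> L j \<and> dist (x j) l < infdist (x j) (L j) + 1"
    proof
      fix j
      have "L j \<noteq> {}" using L0 by blast
      from infdist_almost_attained [OF this, of 1 "x j"]
      show "\<exists>l. l \<in> L j \<and> dist (x j) l < infdist (x j) (L j) + 1" by auto
    qed
    from choice [OF this] obtain l where l: "\<And>j. l j \<in> L j"
      and ld: "\<And>j. dist (x j) (l j) < infdist (x j) (L j) + 1" by blast
    define y where "y j = x j - l j" for j
    have e1: "inverse (real (Suc j)) \<le> 1" for j by (simp add: inverse_le_1_iff)
    have "eventually (\<lambda>j. d (F j 0) (G 0) < 1) U"
      by (rule order_tendstoD(2) [OF G]) simp
    \<comment> \<open>The 4 collects the distance below 1 from F j 0 to G 0, the closeness error,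
      the density error and the slack 1 in the choice of l.\<close>
    then have "eventually (\<lambda>j. y j \<in> cball 0 (d (G 0) p + 4)) U"
    proof eventually_elim
      case (elim j)
      have "d (F j 0) (F j (x j)) \<le> d (F j 0) (G 0) + d (G 0) p + d (F j (x j)) p"
        using triangle [OF FM [of j 0] GM [of 0] FM [of j "x j"]] triangle [OF GM [of 0] p FM [of j "x j"]]
        by (simp add: commute)
      then have "infdist (x j) (L j) \<le> d (G 0) p + 3"
        using close [of j 0 "x j"] elim x [of j] e1 [of j] by simp
      moreover have "dist 0 (y j) = dist (x j) (l j)" by (simp add: y_def dist_norm norm_minus_commute)
      ultimately show ?case using ld [of j] unfolding mem_cball by linarith
    qed
    from ultrafilter_limit_compact [OF U(2) compact_cball this]
    obtain y' where y': "(y \<longlongrightarrow> y') U" by blast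
    have b: "d (G y') p \<le> d (F j y') (G y') + dist y' (y j) + 3 * inverse (real (Suc j))" for j
    proof -
      have "infdist (y j - y') (L j) \<le> dist y' (y j)"
        using infdist_le [OF L0, of "y j - y'" j] by (simp add: dist_norm norm_minus_commute)
      then have 1: "d (F j y') (F j (y j)) \<le> dist y' (y j) + inverse (real (Suc j))"
        using close [of j y' "y j"] by linarith
      have "infdist (x j - y j) (L j) \<le> 0"
        using infdist_le [OF l, of "x j - y j" j] by (simp add: y_def)
      then have 2: "d (F j (y j)) (F j (x j)) \<le> inverse (real (Suc j))"
        using close [of j "y j" "x j"] by linarith
      show ?thesis
        using triangle [OF GM [of y'] FM [of j y'] p] triangle [OF FM [of j y'] FM [of j "y j"] p]
          triangle [OF FM [of j "y j"] FM [of j "x j"] p] 1 2 x [of j] commute [of "G y'" "F j y'"]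
        by linarith
    qed
    have "((\<lambda>j. d (F j y') (G y') + dist y' (y j) + 3 * inverse (real (Suc j))) \<longlongrightarrow> 0 + dist y' y' + 3 * 0) U"
      by (intro tendsto_add G tendsto_dist tendsto_const y' tendsto_mult \<epsilon>)
    then have "((\<lambda>j. d (F j y') (G y') + dist y' (y j) + 3 * inverse (real (Suc j))) \<longlongrightarrow> 0) U" by simp
    then have "d (G y') p \<le> 0"
      by (rule tendsto_le [OF Ub _ tendsto_const]) (intro always_eventually allI b)
    then have "d (G y') p = 0" using nonneg [of "G y'" p] by linarith
    then have "G y' = p" using zero [OF GM p, of y'] by simp
    then show "p \<in> range G" by blast
  qed
  then have "range G = M" using GM by blast
  moreover have "0 \<in> K" "\<forall>a\<in>K. \<forall>b\<in>K. a - b \<in> K"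
  proof -
    show "0 \<in> K" by (simp add: K_def \<rho>0)
    show "\<forall>a\<in>K. \<forall>b\<in>K. a - b \<in> K"
    proof (intro ballI)
      fix a b assume "a \<in> K" "b \<in> K"
      then show "a - b \<in> K" using \<rho>_diff [of a b] \<rho>0(1) [of "a - b"] by (simp add: K_def)
    qed
  qed
  moreover have "\<forall>x y. d (G x) (G y) = infdist (y - x) K" by (simp add: dG \<rho>K)
  ultimately show ?thesis using \<open>closed K\<close> by blast
qed


section \<open>Closed subgroups and flat tori\<close>

text \<open>Coefficients are sequences, to match the points of \<open>euclidean_carrier\<close>; the
  first m of them count.\<close>

definition lincomb :: "nat \<Rightarrow> (nat \<Rightarrow> 'a::real_vector) \<Rightarrow> (nat \<Rightarrow> real) \<Rightarrow> 'a" where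
  "lincomb m b c = (\<Sum>i<m. c i *\<^sub>R b i)"

lemma lincomb_add: "lincomb m b (\<lambda>i. c i + c' i) = lincomb m b c + lincomb m b c'"
  and lincomb_diff: "lincomb m b (\<lambda>i. c i - c' i) = lincomb m b c - lincomb m b c'"
  and lincomb_scale: "lincomb m b (\<lambda>i. t * c i) = t *\<^sub>R lincomb m b c"
  by (simp_all add: lincomb_def algebra_simps sum.distrib sum_subtractf scaleR_sum_right)

lemma lincomb_cong: "(\<And>i. i < m \<Longrightarrow> c i = c' i) \<Longrightarrow> lincomb m b c = lincomb m b c'"
  by (auto simp: lincomb_def intro: sum.cong)

lemma subspace_range_lincomb: "subspace (range (lincomb m b))"
proof (rule subspaceI)
  have "lincomb m b (\<lambda>_. 0) = 0" by (simp add: lincomb_def)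
  then show "0 \<in> range (lincomb m b)" by (metis rangeI)
  fix x y assume "x \<in> range (lincomb m b)" "y \<in> range (lincomb m b)"
  then show "x + y \<in> range (lincomb m b)" by (auto simp flip: lincomb_add)
next
  fix t x assume "x \<in> range (lincomb m b)"
  then show "t *\<^sub>R x \<in> range (lincomb m b)" by (auto simp flip: lincomb_scale)
qed

lemma subgroup_int_multiple:
  assumes "0 \<in> L" "\<And>a b. a \<in> L \<Longrightarrow> b \<in> L \<Longrightarrow> a - b \<in> L" "x \<in> (L :: 'a::real_vector set)"
  shows "of_int k *\<^sub>R x \<in> L"
proof -
  have neg: "- a \<in> L" if "a \<in> L" for a using assms(2) [OF assms(1) that] by simp
  have add: "a + b \<in> L" if "a \<in> L" "b \<in> L" for a b using assms(2) [OF that(1) neg [OF that(2)]] by simp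
  have nat: "of_nat n *\<^sub>R x \<in> L" for n
    by (induction n) (auto simp: algebra_simps assms(1,3) intro: add)
  show ?thesis
  proof (cases "0 \<le> k")
    case True
    then show ?thesis using nat [of "nat k"] by simp
  next
    case False
    then show ?thesis using neg [OF nat [of "nat (- k)"]] by simp
  qed
qed

text \<open>Induction on the rank: L \<inter> span B' has rank m, and together with an element of
  least positive height over span B' it generates L. The least height exists because every height in
  (0, 1] is attained, after reduction modulo that subgroup, in a bounded and hence finite part of
  L.\<close>

lemma discrete_subgroup_basis:
  fixes L :: "'e::euclidean_space set"
  assumes "dim L = m" "0 \<in> L" "\<And>a b. a \<in> L \<Longrightarrow> b \<in> L \<Longrightarrow> a - b \<in> L"
    and "0 < \<epsilon>" "\<And>x. x \<in> L \<Longrightarrow> x \<noteq> 0 \<Longrightarrow> \<epsilon> \<le> norm x"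
  shows "\<exists>b. (\<forall>c. lincomb m b c = 0 \<longrightarrow> (\<forall>i<m. c i = 0)) \<and> L = range (\<lambda>k. lincomb m b (\<lambda>i. of_int (k i)))"
  using assms(1-3,5)
proof (induction m arbitrary: L)
  case 0
  then have "L = {0}" by (auto simp: dim_eq_0)
  then show ?case by (auto simp: lincomb_def)
next
  case (Suc m)
  note L0 = Suc.prems(2) and Lsub = Suc.prems(3) and Lsep = Suc.prems(4)
  obtain B where B: "B \<subseteq> L" "independent B" "L \<subseteq> span B" "card B = dim L"
    by (rule basis_exists)
  then have "B \<noteq> {}" using Suc.prems(1) by auto
  then obtain b0 where b0: "b0 \<in> B" by blast
  define B' where "B' = B - {b0}"
  have finB: "finite B" using B(2) by (rule independent_imp_finite)
  have B': "B' \<subseteq> L" "independent B'" "card B' = m" "b0 \<notin> span B'" "B = insert b0 B'"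
    using B b0 finB Suc.prems(1) independent_mono [of B B']
    by (auto simp: B'_def dependent_def)
  define M where "M = L \<inter> span B'"
  have "dim M = m"
  proof -
    have "dim M \<le> dim (span B')" by (rule dim_subset) (simp add: M_def)
    moreover have "dim B' \<le> dim M" using B'(1) span_superset by (intro dim_subset) (auto simp: M_def)
    moreover have "dim B' = m" using dim_eq_card_independent [OF B'(2)] B'(3) by simp
    ultimately show ?thesis by simp
  qed
  moreover have M: "0 \<in> M" "a \<in> M \<Longrightarrow> b \<in> M \<Longrightarrow> a - b \<in> M" for a b
    using L0 Lsub by (auto simp: M_def span_zero span_diff)
  moreover have "\<epsilon> \<le> norm x" if "x \<in> M" "x \<noteq> 0" for x using that Lsep by (simp add: M_def)
  ultimately obtain b where indep: "\<forall>c. lincomb m b c = 0 \<longrightarrow> (\<forall>i<m. c i = 0)"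
    and Mb: "M = range (\<lambda>k. lincomb m b (\<lambda>i. of_int (k i)))"
    using Suc.IH [of M] by blast
  have spanB': "span B' \<subseteq> range (lincomb m b)"
  proof (rule span_minimal [OF _ subspace_range_lincomb])
    have "B' \<subseteq> M" using B'(1) span_superset by (auto simp: M_def)
    then show "B' \<subseteq> range (lincomb m b)" using Mb by blast
  qed
  obtain y z where yz: "y \<in> span B'" "\<And>w. w \<in> span B' \<Longrightarrow> orthogonal z w" "b0 = y + z"
    using orthogonal_subspace_decomp_exists [of B' b0] by metis
  have "z \<noteq> 0" using yz(1,3) B'(4) by auto
  \<comment> \<open>The linear functional that vanishes on span B' and is 1 at b0, written through
    the component z of b0 orthogonal to span B'.\<close>
  define h where "h x = (x \<bullet> z) / (z \<bullet> z)" for x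
  have h_lin: "h (x - x') = h x - h x'" "h (t *\<^sub>R x) = t * h x" "h (x + x') = h x + h x'" for x x' t
    by (simp_all add: h_def inner_diff_left inner_add_left diff_divide_distrib add_divide_distrib)
  have h0: "h x = 0" if "x \<in> span B'" for x
    using yz(2) [OF that] by (simp add: h_def orthogonal_def inner_commute)
  have hb0: "h b0 = 1"
  proof -
    have "h z = 1" using \<open>z \<noteq> 0\<close> by (simp add: h_def)
    then show ?thesis using h0 [OF yz(1)] unfolding yz(3) h_lin by simp
  qed
  have decomp: "x - h x *\<^sub>R b0 \<in> span B'" if xL: "x \<in> L" for x
  proof -
    have "x \<in> span B" using xL B(3) by blast
    then have "x \<in> span (insert b0 B')" by (simp only: B'(5) [symmetric])
    then obtain s where "x - s *\<^sub>R b0 \<in> span B'" using span_breakdown_eq [of x b0 B'] by blast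
    then show ?thesis using h0 [of "x - s *\<^sub>R b0"] hb0 by (simp add: h_lin)
  qed
  define R where "R = (\<Sum>i<m. norm (b i)) + norm b0"
  define T where "T = {x \<in> cball 0 R \<inter> L. 0 < h x}"
  have "finite (cball 0 R \<inter> L)"
  proof (rule finite_not_islimpt_in_compact [OF compact_cball])
    fix w
    \<comment> \<open>Two points of L close to a limit point would differ by a nonzero element of L
      shorter than \<epsilon>.\<close>
    show "\<not> w islimpt L"
    proof
      assume "w islimpt L"
      then obtain x where x: "x \<in> L" "x \<noteq> w" "dist x w < \<epsilon> / 2"
        using assms(4) by (auto simp: islimpt_approachable dest: spec [of _ "\<epsilon> / 2"])
      then have "0 < dist x w" by simp
      then obtain x' where x': "x' \<in> L" "x' \<noteq> w" "dist x' w < min (\<epsilon> / 2) (dist x w)"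
        using \<open>w islimpt L\<close> assms(4) unfolding islimpt_approachable
        by (metis half_gt_zero min_less_iff_conj)
      then have "x - x' \<noteq> 0" by auto
      then have "\<epsilon> \<le> dist x x'" using Lsep [OF Lsub [OF x(1) x'(1)]] by (simp add: dist_norm)
      also have "\<dots> \<le> dist x w + dist x' w" by (rule dist_triangle2)
      also have "\<dots> < \<epsilon>" using x x' by simp
      finally show False by simp
    qed
  qed
  then have finT: "finite T" unfolding T_def by (rule finite_subset [rotated]) auto
  have reduce: "\<exists>x'\<in>T. h x' = h x" if x: "x \<in> L" "0 < h x" "h x \<le> 1" for x
  proof -
    obtain t where t: "x - h x *\<^sub>R b0 = lincomb m b t" using decomp [OF x(1)] spanB' by blast
    \<comment> \<open>Removing the integer parts of the coordinates along M keeps the height and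
      leaves coordinates in [0, 1), which explains the radius R.\<close>
    define x' where "x' = x - lincomb m b (\<lambda>i. of_int \<lfloor>t i\<rfloor>)"
    have "lincomb m b (\<lambda>i. of_int \<lfloor>t i\<rfloor>) \<in> M" unfolding Mb by (rule range_eqI [of _ _ "\<lambda>i. \<lfloor>t i\<rfloor>"]) simp
    then have "x' \<in> L" "h x' = h x" using Lsub x(1) h0 by (auto simp: x'_def M_def h_lin)
    moreover have "norm x' \<le> R"
    proof -
      have "x' = lincomb m b (\<lambda>i. t i - of_int \<lfloor>t i\<rfloor>) + h x *\<^sub>R b0"
        using t unfolding x'_def lincomb_diff by (simp add: algebra_simps)
      then have "norm x' \<le> norm (lincomb m b (\<lambda>i. t i - of_int \<lfloor>t i\<rfloor>)) + norm (h x *\<^sub>R b0)"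
        by (simp only: norm_triangle_ineq)
      also have "norm (lincomb m b (\<lambda>i. t i - of_int \<lfloor>t i\<rfloor>)) \<le> (\<Sum>i<m. norm (b i))"
        unfolding lincomb_def
      proof (rule sum_norm_le)
        fix i
        have "\<bar>t i - of_int \<lfloor>t i\<rfloor>\<bar> \<le> 1" by linarith
        then have "\<bar>t i - of_int \<lfloor>t i\<rfloor>\<bar> * norm (b i) \<le> 1 * norm (b i)" by (intro mult_right_mono) auto
        then show "norm ((t i - of_int \<lfloor>t i\<rfloor>) *\<^sub>R b i) \<le> norm (b i)" by simp
      qed
      also have "norm (h x *\<^sub>R b0) \<le> norm b0" using x by (simp add: mult_left_le_one_le)
      finally show ?thesis by (simp add: R_def)
    qed
    ultimately show ?thesis using x(2) by (intro bexI [of _ x']) (auto simp: T_def)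
  qed
  have "b0 \<in> L" using B(1) b0 by blast
  have "\<exists>x'\<in>T. h x' = h b0" by (rule reduce [OF \<open>b0 \<in> L\<close>]) (simp_all add: hb0)
  then obtain x1 where x1: "x1 \<in> T" "h x1 = h b0" by blast
  then have "T \<noteq> {}" by blast
  then have "Min (h ` T) \<in> h ` T" using finT by (intro Min_in) auto
  then obtain l1 where l1: "Min (h ` T) = h l1" "l1 \<in> T" by (rule imageE)
  have min: "h l1 \<le> h x" if "x \<in> T" for x
    unfolding l1(1) [symmetric] using finT that by (intro Min_le) auto
  have l1L: "l1 \<in> L" "0 < h l1" using l1 by (auto simp: T_def)
  have "h l1 \<le> 1" using min [OF x1(1)] x1(2) hb0 by simp
  define b' where "b' = b(m := l1)"
  have comb': "lincomb (Suc m) b' c = lincomb m b c + c m *\<^sub>R l1" for c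
    by (simp add: lincomb_def b'_def)
  have span_comb: "lincomb m b c \<in> span B'" for c
  proof -
    have "b i \<in> span B'" if "i < m" for i
    proof -
      have "lincomb m b (\<lambda>j. of_int (if j = i then 1 else 0)) = (\<Sum>j<m. if i = j then b j else 0)"
        unfolding lincomb_def by (intro sum.cong) auto
      also have "\<dots> = b i" using that by simp
      finally have "lincomb m b (\<lambda>j. of_int (if j = i then 1 else 0)) = b i" .
      then have "b i \<in> M"
        using rangeI [of "\<lambda>k. lincomb m b (\<lambda>i. of_int (k i))" "\<lambda>j. if j = i then 1 else 0"]
        by (simp only: Mb)
      then show ?thesis by (simp add: M_def)
    qed
    then show ?thesis unfolding lincomb_def by (intro span_sum span_scale) auto
  qed
  have "\<forall>i<Suc m. c i = 0" if "lincomb (Suc m) b' c = 0" for c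
  proof -
    have eq: "lincomb m b c + c m *\<^sub>R l1 = 0" using that by (simp add: comb')
    then have "h (lincomb m b c + c m *\<^sub>R l1) = 0" by (simp add: h_def)
    then have "c m = 0" using h0 [OF span_comb] l1L(2) by (simp add: h_lin)
    then show ?thesis using eq indep by (simp add: less_Suc_eq)
  qed
  moreover have "L = range (\<lambda>k. lincomb (Suc m) b' (\<lambda>i. of_int (k i)))"
  proof
    show "range (\<lambda>k. lincomb (Suc m) b' (\<lambda>i. of_int (k i))) \<subseteq> L"
    proof (clarify)
      fix k :: "nat \<Rightarrow> int"
      have "lincomb m b (\<lambda>i. of_int (k i)) \<in> M" unfolding Mb by blast
      then have "lincomb m b (\<lambda>i. of_int (k i)) \<in> L" by (simp add: M_def)
      moreover have "- (of_int (k m) *\<^sub>R l1) \<in> L"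
        using subgroup_int_multiple [OF L0 Lsub l1L(1), of "- k m"] by simp
      ultimately have "lincomb m b (\<lambda>i. of_int (k i)) - (- (of_int (k m) *\<^sub>R l1)) \<in> L" by (rule Lsub)
      then show "lincomb (Suc m) b' (\<lambda>i. of_int (k i)) \<in> L" by (simp add: comb')
    qed
    show "L \<subseteq> range (\<lambda>k. lincomb (Suc m) b' (\<lambda>i. of_int (k i)))"
    proof
      fix x assume "x \<in> L"
      \<comment> \<open>Division with remainder by the least height: a nonzero remainder would be a
        smaller positive height.\<close>
      define q where "q = \<lfloor>h x / h l1\<rfloor>"
      define x' where "x' = x - of_int q *\<^sub>R l1"
      have x'L: "x' \<in> L" unfolding x'_def by (intro Lsub \<open>x \<in> L\<close> subgroup_int_multiple L0 l1L)
      have hx': "h x' = h x - of_int q * h l1" by (simp add: x'_def h_lin)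
      have "of_int q \<le> h x / h l1" "h x / h l1 < of_int q + 1" unfolding q_def by linarith+
      then have "of_int q * h l1 \<le> h x" "h x < (of_int q + 1) * h l1"
        using l1L(2) by (simp_all add: pos_le_divide_eq pos_divide_less_eq)
      then have range: "0 \<le> h x'" "h x' < h l1" unfolding hx' by (simp_all add: algebra_simps)
      have "h x' = 0"
      proof (rule ccontr)
        assume "h x' \<noteq> 0"
        then obtain x'' where "x'' \<in> T" "h x'' = h x'"
          using reduce [OF x'L] range \<open>h l1 \<le> 1\<close> by auto
        then show False using min [of x''] range by simp
      qed
      then have "x' \<in> M" using decomp [OF x'L] x'L by (simp add: M_def)
      then obtain k where k: "x' = lincomb m b (\<lambda>i. of_int (k i))" using Mb by blast
      have e: "lincomb (Suc m) b' (\<lambda>i. of_int ((k(m := q)) i)) = x"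
      proof -
        have "lincomb m b (\<lambda>i. of_int ((k(m := q)) i)) = x'"
          unfolding k by (rule lincomb_cong) simp
        then show ?thesis unfolding comb' by (simp add: x'_def)
      qed
      show "x \<in> range (\<lambda>k. lincomb (Suc m) b' (\<lambda>i. of_int (k i)))"
        using rangeI [of "\<lambda>k. lincomb (Suc m) b' (\<lambda>i. of_int (k i))" "k(m := q)"] by (simp only: e)
    qed
  qed
  ultimately show ?case by blast
qed

lemma quad_form_lincomb: "quad_form m (\<lambda>i j. b i \<bullet> b j) c = (norm (lincomb m b c))\<^sup>2"
proof -
  have "lincomb m b c \<bullet> lincomb m b c = (\<Sum>i<m. \<Sum>j<m. (c i *\<^sub>R b i) \<bullet> (c j *\<^sub>R b j))"
    unfolding lincomb_def inner_sum_left inner_sum_right by (rule sum.swap)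
  then show ?thesis
    by (simp add: quad_form_def power2_norm_eq_inner ac_simps)
qed

text \<open>V is the largest linear subspace in K and W its orthogonal complement. K \<inter> W is
  discrete, since the directions of ever shorter vectors would accumulate at a line contained in
  both K and W. Bounded distance to K makes this lattice span W: a vector of W orthogonal to the
  lattice is orthogonal to K, and its multiples would move arbitrarily far from K.\<close>

lemma closed_subgroup_decomp:
  fixes K :: "'e::euclidean_space set"
  assumes "closed K" "0 \<in> K" and sub: "\<And>a b. a \<in> K \<Longrightarrow> b \<in> K \<Longrightarrow> a - b \<in> K"
    and cov: "\<And>x. infdist x K \<le> R"
  shows "\<exists>m b V. m \<le> DIM('e) \<and> (\<forall>c. lincomb m b c = 0 \<longrightarrow> (\<forall>i<m. c i = 0)) \<and> V \<subseteq> K \<and>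
    (\<forall>a\<in>V. - a \<in> V) \<and> (\<forall>x. \<exists>c. x - lincomb m b c \<in> V) \<and>
    (\<forall>a\<in>V. \<forall>c. orthogonal a (lincomb m b c)) \<and>
    (\<forall>c. lincomb m b c \<in> K \<longleftrightarrow> lincomb m b c \<in> range (\<lambda>k. lincomb m b (\<lambda>i. of_int (k i)))) \<and>
    (\<forall>a\<in>K. \<exists>k. a - lincomb m b (\<lambda>i. of_int (k i)) \<in> V)"
proof -
  have neg: "- a \<in> K" if "a \<in> K" for a using sub [OF assms(2) that] by simp
  have add: "a + b \<in> K" if "a \<in> K" "b \<in> K" for a b using sub [OF that(1) neg [OF that(2)]] by simp
  define V where "V = {x. \<forall>t. t *\<^sub>R x \<in> K}"
  have subV: "subspace V"
    unfolding V_def using assms(2) add by (intro subspaceI) (auto simp: scaleR_add_right)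
  have VK: "V \<subseteq> K"
  proof
    fix x assume "x \<in> V"
    then have "1 *\<^sub>R x \<in> K" unfolding V_def by blast
    then show "x \<in> K" by simp
  qed
  define W where "W = {y. \<forall>x\<in>V. orthogonal x y}"
  have subW: "subspace W" unfolding W_def by (rule subspace_orthogonal_to_vectors)
  have VW: "\<exists>a w. a \<in> V \<and> w \<in> W \<and> x = a + w" for x
  proof -
    obtain a w where "a \<in> span V" "\<And>y. y \<in> span V \<Longrightarrow> orthogonal w y" "x = a + w"
      using orthogonal_subspace_decomp_exists [of V x] by metis
    note aw = this
    have "a \<in> V" using aw(1) subV by (simp only: span_eq_iff [THEN iffD2])
    moreover have "w \<in> W"
      unfolding W_def using aw(2) [OF span_base] by (simp add: orthogonal_commute)
    ultimately show ?thesis using aw(3) by (intro exI conjI)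
  qed
  define L where "L = K \<inter> W"
  have L: "0 \<in> L" "a \<in> L \<Longrightarrow> b \<in> L \<Longrightarrow> a - b \<in> L" for a b
    using assms(2) sub subW by (auto simp: L_def subspace_0 subspace_diff)
  have "\<exists>\<epsilon>>0. \<forall>x\<in>L. x \<noteq> 0 \<longrightarrow> \<epsilon> \<le> norm x"
  proof (rule ccontr)
    assume "\<not> ?thesis"
    then have "\<exists>x. x \<in> L \<and> x \<noteq> 0 \<and> norm x < e" if "0 < e" for e
      using that by (simp add: not_le) blast
    then have "\<forall>n::nat. \<exists>x. x \<in> L \<and> x \<noteq> 0 \<and> norm x < inverse (real (Suc n))"
      by simp
    from choice [OF this] obtain x where x: "\<And>n. x n \<in> L" "\<And>n. x n \<noteq> 0" "\<And>n. norm (x n) < inverse (real (Suc n))"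
      by blast
    define u where "u n = (1 / norm (x n)) *\<^sub>R x n" for n
    have u1: "norm (u n) = 1" for n using x(2) by (simp add: u_def)
    obtain U :: "nat filter" where U: "U \<le> sequentially" "ultrafilter U"
      using ultrafilter_exists [of sequentially] by auto
    have Ub: "U \<noteq> bot" using U(2) by (simp add: ultrafilter_def)
    have "eventually (\<lambda>n. u n \<in> cball 0 1) U" by (simp add: u1)
    from ultrafilter_limit_compact [OF U(2) compact_cball this]
    obtain l where l: "(u \<longlongrightarrow> l) U" by blast
    have "((\<lambda>n. norm (u n)) \<longlongrightarrow> norm l) U" by (rule tendsto_norm [OF l])
    then have "((\<lambda>n. 1) \<longlongrightarrow> norm l) U" by (simp add: u1)
    then have nl: "norm l = 1" by (rule tendsto_unique [OF Ub _ tendsto_const])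
    have x0: "((\<lambda>n. norm (x n)) \<longlongrightarrow> 0) U"
    proof (rule Lim_null_comparison)
      show "((\<lambda>n. inverse (real (Suc n))) \<longlongrightarrow> 0) U"
        by (rule tendsto_mono [OF U(1) LIMSEQ_inverse_real_of_nat])
      show "eventually (\<lambda>n. norm (norm (x n)) \<le> inverse (real (Suc n))) U"
        using x(3) by (intro always_eventually allI) (simp add: less_imp_le)
    qed
    have "l \<in> V"
      unfolding V_def
    proof (intro CollectI allI)
      fix t
      \<comment> \<open>An integer multiple of x n that differs from t u n by at most norm (x n); it
        therefore tends to t l, and K is closed.\<close>
      define y where "y n = of_int \<lfloor>t / norm (x n)\<rfloor> *\<^sub>R x n" for n
      have yK: "y n \<in> K" for n
        unfolding y_def using x(1) by (intro subgroup_int_multiple assms(2) sub) (simp_all add: L_def)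
      have "((\<lambda>n. y n - t *\<^sub>R u n) \<longlongrightarrow> 0) U"
      proof (rule Lim_null_comparison [OF always_eventually x0], rule allI)
        fix n
        have "y n - t *\<^sub>R u n = (of_int \<lfloor>t / norm (x n)\<rfloor> - t / norm (x n)) *\<^sub>R x n"
          by (simp add: y_def u_def scaleR_diff_left)
        moreover have "\<bar>of_int \<lfloor>t / norm (x n)\<rfloor> - t / norm (x n)\<bar> \<le> 1" by linarith
        ultimately show "norm (y n - t *\<^sub>R u n) \<le> norm (x n)"
          by (simp add: mult_left_le_one_le)
      qed
      moreover have "((\<lambda>n. t *\<^sub>R u n) \<longlongrightarrow> t *\<^sub>R l) U" by (intro tendsto_scaleR tendsto_const l)
      ultimately have "((\<lambda>n. (y n - t *\<^sub>R u n) + t *\<^sub>R u n) \<longlongrightarrow> 0 + t *\<^sub>R l) U" by (rule tendsto_add)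
      then have "(y \<longlongrightarrow> t *\<^sub>R l) U" by simp
      moreover have "eventually (\<lambda>n. y n \<in> K) U" by (simp add: yK)
      ultimately show "t *\<^sub>R l \<in> K" using Lim_in_closed_set [OF assms(1) _ Ub] by blast
    qed
    moreover have "l \<in> W"
    proof (rule Lim_in_closed_set [OF closed_subspace [OF subW] _ Ub l])
      have "u n \<in> W" for n using x(1) subW by (simp add: u_def L_def subspace_scale)
      then show "eventually (\<lambda>n. u n \<in> W) U" by simp
    qed
    ultimately have "orthogonal l l" unfolding W_def by blast
    then show False using nl by (auto simp: orthogonal_def)
  qed
  then obtain \<epsilon> where \<epsilon>: "0 < \<epsilon>" "\<And>x. x \<in> L \<Longrightarrow> x \<noteq> 0 \<Longrightarrow> \<epsilon> \<le> norm x" by blast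
  define m where "m = dim L"
  have "\<exists>b. (\<forall>c. lincomb m b c = 0 \<longrightarrow> (\<forall>i<m. c i = 0)) \<and> L = range (\<lambda>k. lincomb m b (\<lambda>i. of_int (k i)))"
    by (rule discrete_subgroup_basis [of L m \<epsilon>]) (use m_def L \<epsilon> in simp_all)
  then obtain b where indep: "\<forall>c. lincomb m b c = 0 \<longrightarrow> (\<forall>i<m. c i = 0)"
    and Lb: "L = range (\<lambda>k. lincomb m b (\<lambda>i. of_int (k i)))" by blast
  have "m \<le> DIM('e)" unfolding m_def by (rule dim_subset_UNIV)
  have bW: "lincomb m b c \<in> W" for c
  proof -
    have "b i \<in> W" if "i < m" for i
    proof -
      have "lincomb m b (\<lambda>j. of_int (if j = i then 1 else 0)) = (\<Sum>j<m. if i = j then b j else 0)"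
        unfolding lincomb_def by (intro sum.cong) auto
      also have "\<dots> = b i" using that by simp
      finally have "lincomb m b (\<lambda>j. of_int (if j = i then 1 else 0)) = b i" .
      then have "b i \<in> L"
        using rangeI [of "\<lambda>k. lincomb m b (\<lambda>i. of_int (k i))" "\<lambda>j. if j = i then 1 else 0"]
        by (simp only: Lb)
      then show ?thesis by (simp add: L_def)
    qed
    then show ?thesis unfolding lincomb_def using subW by (intro subspace_sum subspace_scale) auto
  qed
  have KL: "\<exists>k. a - lincomb m b (\<lambda>i. of_int (k i)) \<in> V" if aK: "a \<in> K" for a
  proof -
    obtain a' w where aw: "a' \<in> V" "w \<in> W" "a = a' + w" using VW by blast
    have "w = a - a'" using aw by simp
    moreover have "a - a' \<in> K" by (rule sub [OF aK]) (use aw VK in blast)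
    ultimately have "w \<in> L" using aw(2) by (simp add: L_def)
    then obtain k where "w = lincomb m b (\<lambda>i. of_int (k i))" unfolding Lb by blast
    then show ?thesis using aw by (intro exI [of _ k]) simp
  qed
  have "W \<subseteq> range (lincomb m b)"
  proof
    fix w assume w: "w \<in> W"
    obtain y z where ys: "y \<in> span (range (lincomb m b))" and zo: "\<And>x. x \<in> span (range (lincomb m b)) \<Longrightarrow> orthogonal z x"
      and wyz: "w = y + z"
      using orthogonal_subspace_decomp_exists [of "range (lincomb m b)" w] by metis
    have y: "y \<in> range (lincomb m b)"
      using ys by (simp only: span_eq_iff [THEN iffD2, OF subspace_range_lincomb])
    then have "y \<in> W" using bW by blast
    then have zW: "z \<in> W" using w wyz subspace_diff [OF subW w \<open>y \<in> W\<close>] by simp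
    have zK: "z \<bullet> a = 0" if "a \<in> K" for a
    proof -
      obtain k where "a - lincomb m b (\<lambda>i. of_int (k i)) \<in> V" using KL [OF \<open>a \<in> K\<close>] by blast
      then have "z \<bullet> (a - lincomb m b (\<lambda>i. of_int (k i))) = 0"
        using zW by (auto simp: W_def orthogonal_def inner_commute)
      moreover have "z \<bullet> lincomb m b (\<lambda>i. of_int (k i)) = 0"
        using zo [OF span_base [OF rangeI]] by (simp add: orthogonal_def)
      ultimately show ?thesis by (simp add: inner_diff_right)
    qed
    have "z = 0"
    proof (rule ccontr)
      assume "z \<noteq> 0"
      \<comment> \<open>At this scale the component along z alone keeps t z at distance R + 1 from
        K.\<close>
      define t where "t = (R + 1) / norm z"
      have K: "K \<noteq> {}" using assms(2) by blast
      have "R + 1 \<le> infdist (t *\<^sub>R z) K"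
        unfolding infdist_notempty [OF K]
      proof (rule cINF_greatest [OF K])
        fix a assume "a \<in> K"
        have "(R + 1) * norm z = z \<bullet> (t *\<^sub>R z - a)"
          using \<open>z \<noteq> 0\<close> zK [OF \<open>a \<in> K\<close>] by (simp add: inner_diff_right t_def dot_square_norm power2_eq_square)
        also have "\<dots> \<le> norm z * norm (t *\<^sub>R z - a)" by (rule norm_cauchy_schwarz)
        finally show "R + 1 \<le> dist (t *\<^sub>R z) a" using \<open>z \<noteq> 0\<close> by (simp add: dist_norm mult.commute)
      qed
      then show False using cov [of "t *\<^sub>R z"] by simp
    qed
    then show "w \<in> range (lincomb m b)" using wyz y by simp
  qed
  then have proj: "\<exists>c. x - lincomb m b c \<in> V" for x
  proof -
    obtain a w where aw: "a \<in> V" "w \<in> W" "x = a + w" using VW by blast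
    then obtain c where "w = lincomb m b c" using \<open>W \<subseteq> _\<close> by blast
    then show ?thesis using aw by (intro exI [of _ c]) simp
  qed
  have "lincomb m b c \<in> K \<longleftrightarrow> lincomb m b c \<in> range (\<lambda>k. lincomb m b (\<lambda>i. of_int (k i)))" for c
    unfolding Lb [symmetric] using bW by (simp add: L_def)
  moreover have "\<forall>a\<in>V. \<forall>c. orthogonal a (lincomb m b c)" using bW unfolding W_def by blast
  moreover have "\<forall>a\<in>V. - a \<in> V" using subspace_neg [OF subV] by blast
  ultimately show ?thesis
    using \<open>m \<le> _\<close> indep VK proj KL by (intro exI [of _ m] exI [of _ b] exI [of _ V] conjI allI ballI) blast+
qed

text \<open>Coordinates along the lattice basis describe the quotient, and Q is the Gram matrix of
  that basis. By Pythagoras, an element of K is no closer to a combination of the basis than its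
  projection to the lattice, so distances to K and to the lattice agree there.\<close>

lemma isometric_flat_torus:
  fixes K :: "'e::euclidean_space set" and G :: "'e \<Rightarrow> 'x"
  assumes X: "Metric_space X d" and K: "closed K" "0 \<in> K" and sub: "\<And>a b. a \<in> K \<Longrightarrow> b \<in> K \<Longrightarrow> a - b \<in> K"
    and G: "range G = X" and dG: "\<And>x y. d (G x) (G y) = infdist (y - x) K"
    and cov: "\<And>x. infdist x K \<le> R"
  shows "\<exists>m \<le> DIM('e). \<exists>Q. flat_torus_metric m Q \<and> isometric X d (torus m) (flat_torus_dist m Q)"
proof -
  interpret Metric_space X d by (rule X)
  have GX: "G x \<in> X" for x using G by blast
  have "\<exists>m b V. m \<le> DIM('e) \<and> (\<forall>c. lincomb m b c = 0 \<longrightarrow> (\<forall>i<m. c i = 0)) \<and> V \<subseteq> K \<and>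
    (\<forall>a\<in>V. - a \<in> V) \<and> (\<forall>x. \<exists>c. x - lincomb m b c \<in> V) \<and>
    (\<forall>a\<in>V. \<forall>c. orthogonal a (lincomb m b c)) \<and>
    (\<forall>c. lincomb m b c \<in> K \<longleftrightarrow> lincomb m b c \<in> range (\<lambda>k. lincomb m b (\<lambda>i. of_int (k i)))) \<and>
    (\<forall>a\<in>K. \<exists>k. a - lincomb m b (\<lambda>i. of_int (k i)) \<in> V)"
    by (rule closed_subgroup_decomp [OF K sub cov])
  then obtain m and b :: "nat \<Rightarrow> 'e" and V where m: "m \<le> DIM('e)"
    and indep: "\<forall>c. lincomb m b c = 0 \<longrightarrow> (\<forall>i<m. c i = 0)"
    and V: "V \<subseteq> K" "\<forall>a\<in>V. - a \<in> V" and proj: "\<forall>x. \<exists>c. x - lincomb m b c \<in> V"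
    and orth: "\<forall>a\<in>V. \<forall>c. orthogonal a (lincomb m b c)"
    and latc: "\<forall>c. lincomb m b c \<in> K \<longleftrightarrow> lincomb m b c \<in> range (\<lambda>k. lincomb m b (\<lambda>i. of_int (k i)))"
    and KV: "\<forall>a\<in>K. \<exists>k. a - lincomb m b (\<lambda>i. of_int (k i)) \<in> V"
    by (elim exE conjE)
  define lin where "lin = lincomb m b"
  define lat where "lat k = lin (\<lambda>i. of_int (k i))" for k :: "nat \<Rightarrow> int"
  define Q where "Q = (\<lambda>i j. b i \<bullet> b j)"
  define cls where "cls c = {y \<in> euclidean_carrier m. \<forall>i<m. y i - c i \<in> \<int>}" for c :: "nat \<Rightarrow> real"
  have lin_diff: "lin (\<lambda>i. c i - c' i) = lin c - lin c'" for c c' unfolding lin_def by (rule lincomb_diff)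
  have lin_cong: "lin c = lin c'" if "\<And>i. i < m \<Longrightarrow> c i = c' i" for c c'
    unfolding lin_def by (rule lincomb_cong) (rule that)
  have latK: "lat k \<in> K" for k
    unfolding lat_def lin_def latc [rule_format] by (rule rangeI)
  have quad: "sqrt (quad_form m Q c) = norm (lin c)" for c
    by (simp add: Q_def lin_def quad_form_lincomb)
  have inf_eq: "infdist (lin c) K = infdist (lin c) (range lat)" for c
  proof (rule antisym)
    show "infdist (lin c) K \<le> infdist (lin c) (range lat)"
      by (rule infdist_mono) (use latK in auto)
    have "infdist (lin c) (range lat) \<le> dist (lin c) a" if aK: "a \<in> K" for a
    proof -
      obtain k where "a - lat k \<in> V" using KV [rule_format, OF aK] unfolding lat_def lin_def by blast
      then have "orthogonal (lin (\<lambda>i. c i - of_int (k i))) (lat k - a)"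
        using orth [rule_format, of "a - lat k" "\<lambda>i. c i - of_int (k i)"]
        by (simp add: lin_def orthogonal_def inner_diff_left inner_diff_right inner_commute)
      then have "(norm (lin c - lat k + (lat k - a)))\<^sup>2 = (norm (lin c - lat k))\<^sup>2 + (norm (lat k - a))\<^sup>2"
        unfolding lin_diff lat_def by (rule norm_add_Pythagorean)
      then have "(dist (lin c) (lat k))\<^sup>2 \<le> (dist (lin c) a)\<^sup>2" by (simp add: dist_norm)
      then have "dist (lin c) (lat k) \<le> dist (lin c) a" by (rule power2_le_imp_le) simp
      moreover have "infdist (lin c) (range lat) \<le> dist (lin c) (lat k)" by (rule infdist_le) simp
      ultimately show ?thesis by linarith
    qed
    then show "infdist (lin c) (range lat) \<le> infdist (lin c) K"
      using K(2) by (subst (2) infdist_notempty) (auto intro: cINF_greatest)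
  qed
  have ftd: "flat_torus_dist m Q (cls c) (cls c') = d (G (lin c)) (G (lin c'))"
    if c: "c \<in> euclidean_carrier m" for c c'
  proof -
    \<comment> \<open>Representatives of the two classes differ from c and c' by integer vectors, so
      their differences are, up to sign, c' - c modulo integers.\<close>
    have "{sqrt (quad_form m Q (\<lambda>i. x i - y i)) | x y. x \<in> cls c \<and> y \<in> cls c'} =
        dist (lin (\<lambda>i. c' i - c i)) ` range lat" (is "?S = ?T")
    proof (intro equalityI subsetI)
      fix s assume "s \<in> ?S"
      then obtain x y where s: "s = norm (lin (\<lambda>i. x i - y i))" and xy: "x \<in> cls c" "y \<in> cls c'"
        unfolding quad by blast
      have "c' i - c i + x i - y i \<in> \<int>" if "i < m" for i
      proof -
        have "(x i - c i) - (y i - c' i) \<in> \<int>" using xy that by (intro Ints_diff [of "x i - c i"]) (auto simp: cls_def)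
        then show ?thesis by (simp add: algebra_simps)
      qed
      then have k: "of_int \<lfloor>c' i - c i + x i - y i\<rfloor> = c' i - c i + x i - y i" if "i < m" for i
        using that by simp
      define k where "k i = \<lfloor>c' i - c i + x i - y i\<rfloor>" for i
      have "lin (\<lambda>i. of_int (k i)) = lin (\<lambda>i. (c' i - c i) - (y i - x i))"
        by (rule lin_cong) (simp add: k k_def)
      then have "lat k = lin (\<lambda>i. c' i - c i) - (lin y - lin x)"
        unfolding lat_def by (simp add: lin_diff)
      then have "s = dist (lin (\<lambda>i. c' i - c i)) (lat k)"
        by (simp add: s lin_diff dist_norm norm_minus_commute)
      then show "s \<in> ?T" by blast
    next
      fix s assume "s \<in> ?T"
      then obtain k where s: "s = dist (lin (\<lambda>i. c' i - c i)) (lat k)" by blast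
      \<comment> \<open>The first representative can be kept at c; the second absorbs the whole
        integer vector.\<close>
      define y where "y i = (if i < m then c' i - of_int (k i) else 0)" for i
      have "lin y = lin (\<lambda>i. c' i - of_int (k i))" by (rule lin_cong) (simp add: y_def)
      then have "lin (\<lambda>i. c i - y i) = - (lin (\<lambda>i. c' i - c i) - lat k)"
        by (simp only: lin_diff lat_def) (simp add: algebra_simps)
      then have "s = norm (lin (\<lambda>i. c i - y i))" by (simp only: s dist_norm norm_minus_cancel)
      moreover have "c \<in> cls c" using c by (simp add: cls_def)
      moreover have "y \<in> cls c'" by (auto simp: cls_def y_def euclidean_carrier_def)
      ultimately show "s \<in> ?S" unfolding quad by blast
    qed
    then have "flat_torus_dist m Q (cls c) (cls c') = infdist (lin (\<lambda>i. c' i - c i)) (range lat)"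
      by (simp add: flat_torus_dist_def infdist_notempty image_image)
    also have "\<dots> = infdist (lin (\<lambda>i. c' i - c i)) K" by (rule inf_eq [symmetric])
    also have "\<dots> = d (G (lin c)) (G (lin c'))" unfolding dG lin_diff ..
    finally show ?thesis .
  qed
  have "\<exists>c. c \<in> euclidean_carrier m \<and> G (lin c) = p" if pX: "p \<in> X" for p
  proof -
    obtain x where x: "p = G x" using pX G by blast
    obtain c where "x - lin c \<in> V" using proj unfolding lin_def by blast
    moreover have "lin (\<lambda>i. if i < m then c i else 0) = lin c" by (rule lin_cong) simp
    ultimately have "d (G (lin (\<lambda>i. if i < m then c i else 0))) (G x) = 0"
      using V(1) dG [of "lin c" x] by auto
    then have "G (lin (\<lambda>i. if i < m then c i else 0)) = p" using zero GX x by blast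
    then show ?thesis by (intro exI [of _ "\<lambda>i. if i < m then c i else 0"]) (simp add: euclidean_carrier_def)
  qed
  then have "\<forall>p. \<exists>c. p \<in> X \<longrightarrow> c \<in> euclidean_carrier m \<and> G (lin c) = p" by blast
  from choice [OF this] obtain C where C: "\<And>p. p \<in> X \<Longrightarrow> C p \<in> euclidean_carrier m" "\<And>p. p \<in> X \<Longrightarrow> G (lin (C p)) = p"
    by blast
  define f where "f p = cls (C p)" for p
  have emb: "flat_torus_dist m Q (f p) (f q) = d p q" if "p \<in> X" "q \<in> X" for p q
    using ftd [of "C p" "C q"] C that by (simp add: f_def)
  have tor: "torus m = cls ` euclidean_carrier m" by (simp add: torus_def cls_def)
  have "inj_on f X"
  proof (rule inj_onI)
    fix p q assume pq: "p \<in> X" "q \<in> X" "f p = f q"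
    then have "d p q = d p p" using emb [of p q] emb [of p p] by simp
    then show "p = q" using pq by simp
  qed
  moreover have "f ` X = torus m"
  proof
    show "f ` X \<subseteq> torus m" using C(1) by (auto simp: tor f_def)
    show "torus m \<subseteq> f ` X"
    proof
      fix A assume "A \<in> torus m"
      then obtain c where A: "A = cls c" and c: "c \<in> euclidean_carrier m" by (auto simp: tor)
      define p where "p = G (lin c)"
      have p: "p \<in> X" unfolding p_def by (rule GX)
      \<comment> \<open>C p and c yield the same point of X, so the difference of their combinations
        lies in the closed set K, hence in the lattice; by independence the coordinates differ by
        integers.\<close>
      have "infdist (lin (\<lambda>i. C p i - c i)) K = d p p"
        using dG [of "lin c" "lin (C p)"] C(2) [OF p] by (simp add: lin_diff p_def)
      then have "lin (\<lambda>i. C p i - c i) \<in> K"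
        using p in_closed_iff_infdist_zero [OF K(1)] K(2) by auto
      then obtain k where "lin (\<lambda>i. C p i - c i) = lin (\<lambda>i. of_int (k i))"
        unfolding lin_def latc [rule_format] by blast
      then have "lin (\<lambda>i. C p i - c i - of_int (k i)) = 0" by (simp add: lin_diff)
      then have e0: "C p i - c i - of_int (k i) = 0" if "i < m" for i
        using indep [rule_format, of "\<lambda>i. C p i - c i - of_int (k i)"] that unfolding lin_def by simp
      have "y i - C p i \<in> \<int> \<longleftrightarrow> y i - c i \<in> \<int>" if "i < m" for y i
      proof -
        have e: "y i - c i = (y i - C p i) + of_int (k i)" using e0 [OF that] by simp
        show ?thesis
        proof
          assume "y i - C p i \<in> \<int>"
          then show "y i - c i \<in> \<int>" unfolding e by (rule Ints_add) simp
        next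
          assume "y i - c i \<in> \<int>"
          then have "(y i - c i) - of_int (k i) \<in> \<int>" by (rule Ints_diff) simp
          then show "y i - C p i \<in> \<int>" by (simp add: e)
        qed
      qed
      then have "cls (C p) = cls c" unfolding cls_def by blast
      then show "A \<in> f ` X" using p by (auto simp: A f_def)
    qed
  qed
  ultimately have "isometric X d (torus m) (flat_torus_dist m Q)"
    unfolding isometric_def isometric_embedding_def using emb by (intro exI [of _ f]) (simp add: bij_betw_def)
  moreover have "flat_torus_metric m Q"
    unfolding flat_torus_metric_def
  proof (intro conjI allI ballI impI)
    fix i j show "Q i j = Q j i" by (simp add: Q_def inner_commute)
  next
    fix x :: "nat \<Rightarrow> real" assume x: "x \<in> euclidean_carrier m" "x \<noteq> (\<lambda>_. 0)"
    have "lin x \<noteq> 0"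
    proof
      assume "lin x = 0"
      then have "x i = 0" for i
        using indep [rule_format, of x i] x(1) unfolding lin_def euclidean_carrier_def by (cases "i < m") auto
      then show False using x(2) by blast
    qed
    then show "0 < quad_form m Q x" by (simp add: Q_def quad_form_lincomb flip: lin_def)
  qed
  ultimately show ?thesis using m by blast
qed

section \<open>From the approximating tori to the limit space\<close>

lemma close_to_euclidean_quotient:
  fixes \<Gamma> :: "nat \<Rightarrow> 'n::finite heis set" and X :: "'x set"
  assumes lat: "\<And>k. heis_lattice (\<Gamma> k)" and sr: "\<And>k. subriemannian (v k) (g k)"
    and lim: "(\<lambda>k. gromov_hausdorff_distance (rcosets\<^bsub>heis_group\<^esub> (\<Gamma> k)) (quotient_dist (v k) (g k)) X d)
           \<longlonglongrightarrow> 0"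
    and "D > 0"
    and diam: "\<And>k. metric_diameter (rcosets\<^bsub>heis_group\<^esub> (\<Gamma> k)) (quotient_dist (v k) (g k)) \<le> ennreal D"
    and vol: "(\<lambda>k. total_mvol (\<Gamma> k) (v k) (g k)) \<longlonglongrightarrow> 0"
    and "0 < e"
  shows "\<exists>(L :: (real ^ ('n + 'n)) set) F. 0 \<in> L \<and> (\<forall>a\<in>L. \<forall>b\<in>L. a - b \<in> L) \<and> (\<forall>x. F x \<in> X) \<and>
    (\<forall>x y. \<bar>d (F x) (F y) - infdist (y - x) L\<bar> \<le> e) \<and> (\<forall>p\<in>X. \<exists>x. d (F x) p \<le> e)"
proof -
  \<comment> \<open>Error budget: the torus model contributes e/4 and two Hausdorff radii less than
    e/8 each, so that e/2 is never exceeded.\<close>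
  have e4: "0 < e / 4" using \<open>0 < e\<close> by simp
  from small_volume_almost_flat [OF \<open>D > 0\<close> e4]
  obtain \<psi> where "0 < \<psi>" and \<psi>: "\<forall>(\<Gamma>::'n heis set) v g. heis_lattice \<Gamma> \<and> subriemannian v g \<and>
      metric_diameter (rcosets\<^bsub>heis_group\<^esub> \<Gamma>) (quotient_dist v g) \<le> ennreal D \<and> total_mvol \<Gamma> v g < ennreal \<psi> \<longrightarrow>
      (\<exists>(L :: (real ^ ('n + 'n)) set) s. 0 \<in> L \<and> (\<forall>a\<in>L. \<forall>b\<in>L. a - b \<in> L) \<and> (\<forall>x. s x \<in> rcosets\<^bsub>heis_group\<^esub> \<Gamma>) \<and>
        (\<forall>x y. \<bar>quotient_dist v g (s x) (s y) - infdist (y - x) L\<bar> \<le> e / 4) \<and>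
        (\<forall>A\<in>rcosets\<^bsub>heis_group\<^esub> \<Gamma>. \<exists>x. \<bar>quotient_dist v g A (s x)\<bar> \<le> e / 4))"
    by (elim exE conjE)
  have "eventually (\<lambda>k. total_mvol (\<Gamma> k) (v k) (g k) < ennreal \<psi>) sequentially"
    using \<open>0 < \<psi>\<close> by (intro order_tendstoD(2) [OF vol]) simp
  moreover have "eventually (\<lambda>k. gromov_hausdorff_distance (rcosets\<^bsub>heis_group\<^esub> (\<Gamma> k)) (quotient_dist (v k) (g k)) X d
      < ennreal (e / 8)) sequentially"
    using \<open>0 < e\<close> by (intro order_tendstoD(2) [OF lim]) simp
  ultimately have "eventually (\<lambda>k. total_mvol (\<Gamma> k) (v k) (g k) < ennreal \<psi> \<and>
      gromov_hausdorff_distance (rcosets\<^bsub>heis_group\<^esub> (\<Gamma> k)) (quotient_dist (v k) (g k)) X d < ennreal (e / 8)) sequentially"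
    by (rule eventually_conj)
  from eventually_happens' [OF sequentially_bot this] obtain k where small: "total_mvol (\<Gamma> k) (v k) (g k) < ennreal \<psi>"
    and gh: "gromov_hausdorff_distance (rcosets\<^bsub>heis_group\<^esub> (\<Gamma> k)) (quotient_dist (v k) (g k)) X d < ennreal (e / 8)"
    by (elim exE conjE)
  define M where "M = rcosets\<^bsub>heis_group\<^esub> (\<Gamma> k)"
  define q where "q = quotient_dist (v k) (g k)"
  have "\<exists>(L :: (real ^ ('n + 'n)) set) s. 0 \<in> L \<and> (\<forall>a\<in>L. \<forall>b\<in>L. a - b \<in> L) \<and> (\<forall>x. s x \<in> M) \<and>
        (\<forall>x y. \<bar>q (s x) (s y) - infdist (y - x) L\<bar> \<le> e / 4) \<and> (\<forall>A\<in>M. \<exists>x. \<bar>q A (s x)\<bar> \<le> e / 4)"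
    unfolding M_def q_def by (rule \<psi> [rule_format]) (intro conjI lat sr diam small)
  then obtain L :: "(real ^ ('n + 'n)) set" and s where L: "0 \<in> L" "\<forall>a\<in>L. \<forall>b\<in>L. a - b \<in> L"
    and sM: "\<forall>x. s x \<in> M" and s: "\<forall>x y. \<bar>q (s x) (s y) - infdist (y - x) L\<bar> \<le> e / 4"
    and sA: "\<forall>A\<in>M. \<exists>x. \<bar>q A (s x)\<bar> \<le> e / 4"
    by (elim exE conjE)
  note sM = sM [rule_format] and s = s [rule_format] and sA = sA [rule_format]
  have "\<exists>(Z :: ('n heis set + 'x) metric) f f'. isometric_embedding M q (mspace Z) (mdist Z) f \<and>
      isometric_embedding X d (mspace Z) (mdist Z) f' \<and> hausdorff_distance Z (f ` M) (f' ` X) < ennreal (e / 8)"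
    using gh unfolding gromov_hausdorff_distance_def Inf_less_iff M_def q_def
    by (elim bexE CollectE exE conjE, hypsubst, intro exI conjI) assumption+
  then obtain Z :: "('n heis set + 'x) metric" and f f' where
    f: "isometric_embedding M q (mspace Z) (mdist Z) f" and f': "isometric_embedding X d (mspace Z) (mdist Z) f'"
    and hd: "hausdorff_distance Z (f ` M) (f' ` X) < ennreal (e / 8)"
    by (elim exE conjE)
  have "\<exists>r. 0 < r \<and> ennreal r < ennreal (e / 8) \<and>
      f ` M \<subseteq> (\<Union>b\<in>f' ` X. mball_of Z b r) \<and> f' ` X \<subseteq> (\<Union>a\<in>f ` M. mball_of Z a r)"
    using hd unfolding hausdorff_distance_def Inf_less_iff
    by (elim bexE CollectE exE conjE, hypsubst, intro exI conjI) assumption+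
  then obtain r where r: "0 < r" "ennreal r < ennreal (e / 8)"
    and rM: "f ` M \<subseteq> (\<Union>b\<in>f' ` X. mball_of Z b r)" and rX: "f' ` X \<subseteq> (\<Union>a\<in>f ` M. mball_of Z a r)"
    by (elim exE conjE)
  have r8: "r < e / 8" using r by (simp add: ennreal_less_iff)
  interpret Z: Metric_space "mspace Z" "mdist Z" by (rule Metric_space_mspace_mdist)
  have fM: "f A \<in> mspace Z" and fX: "f' p \<in> mspace Z" if "A \<in> M" "p \<in> X" for A p
    using f f' that by (auto simp: isometric_embedding_def)
  \<comment> \<open>The model is carried over to X by picking, for each x, a point of X whose copy
    in Z is within r of the copy of \<open>s x\<close>.\<close>
  have "\<forall>x. \<exists>p. p \<in> X \<and> mdist Z (f' p) (f (s x)) < r"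
  proof
    fix x
    have "f (s x) \<in> (\<Union>b\<in>f' ` X. mball_of Z b r)" by (rule subsetD [OF rM imageI [OF sM]])
    then show "\<exists>p. p \<in> X \<and> mdist Z (f' p) (f (s x)) < r" by (simp only: UN_iff Bex_def image_iff in_mball_of) metis
  qed
  from choice [OF this] obtain F where F0: "\<forall>x. F x \<in> X \<and> mdist Z (f' (F x)) (f (s x)) < r"
    by (elim exE)
  have FX: "F x \<in> X" and F: "mdist Z (f' (F x)) (f (s x)) < r" for x using F0 by simp_all
  have qf: "q A B = mdist Z (f A) (f B)" if "A \<in> M" "B \<in> M" for A B
    using f that by (simp add: isometric_embedding_def)
  have df: "d a b = mdist Z (f' a) (f' b)" if "a \<in> X" "b \<in> X" for a b
    using f' that by (simp add: isometric_embedding_def)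
  have fFZ: "f' (F x) \<in> mspace Z" and fsZ: "f (s x) \<in> mspace Z" for x
    using f f' FX sM by (auto simp: isometric_embedding_def)
  have "\<bar>d (F x) (F y) - infdist (y - x) L\<bar> \<le> e" for x y
  proof -
    have "\<bar>d (F x) (F y) - q (s x) (s y)\<bar> \<le> mdist Z (f' (F x)) (f (s x)) + mdist Z (f' (F y)) (f (s y))"
      unfolding df [OF FX FX] qf [OF sM sM] by (rule Z.dist_diff_le) (rule fFZ fsZ)+
    then show ?thesis using F [of x] F [of y] r8 s [of x y] by linarith
  qed
  moreover have "\<exists>x. d (F x) p \<le> e" if p: "p \<in> X" for p
  proof -
    have "f' p \<in> (\<Union>a\<in>f ` M. mball_of Z a r)" by (rule subsetD [OF rX imageI [OF p]])
    then have "\<exists>A. A \<in> M \<and> mdist Z (f A) (f' p) < r" by (simp only: UN_iff Bex_def image_iff in_mball_of) metis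
    then obtain A where A: "A \<in> M" "mdist Z (f A) (f' p) < r" by (elim exE conjE)
    obtain x where x: "\<bar>q A (s x)\<bar> \<le> e / 4" using sA [OF A(1)] by blast
    have fA: "f A \<in> mspace Z" and fp: "f' p \<in> mspace Z" using fM fX A(1) p by blast+
    have "d (F x) p \<le> mdist Z (f' (F x)) (f A) + mdist Z (f A) (f' p)"
      unfolding df [OF FX p] by (rule Z.triangle [OF fFZ fA fp])
    also have "mdist Z (f' (F x)) (f A) \<le> mdist Z (f' (F x)) (f (s x)) + mdist Z (f (s x)) (f A)"
      by (rule Z.triangle [OF fFZ fsZ fA])
    finally have "d (F x) p \<le> e"
      using F [of x] A(2) x r8 qf [OF A(1) sM, of x] Z.commute [of "f A" "f (s x)"] by linarith
    then show ?thesis ..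
  qed
  ultimately show ?thesis using L FX by (intro exI [of _ L] exI [of _ F] conjI allI ballI) blast+
qed

theorem theorem1p1:
  fixes \<Gamma> :: "nat \<Rightarrow> 'n::finite heis set"
    and v :: "nat \<Rightarrow> 'n heis set"
    and g :: "nat \<Rightarrow> 'n heis \<Rightarrow> 'n heis \<Rightarrow> real"
    and D :: real
    and X :: "'x set" and d :: "'x \<Rightarrow> 'x \<Rightarrow> real"
  assumes "\<And>k. heis_lattice (\<Gamma> k)"
    and "\<And>k. subriemannian (v k) (g k)"
    and "Metric_space X d" and "compact_space (Metric_space.mtopology X d)"
    and "(\<lambda>k. gromov_hausdorff_distance (rcosets\<^bsub>heis_group\<^esub> (\<Gamma> k)) (quotient_dist (v k) (g k)) X d)
           \<longlonglongrightarrow> 0"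
    and "D > 0"
    and "\<And>k. metric_diameter (rcosets\<^bsub>heis_group\<^esub> (\<Gamma> k)) (quotient_dist (v k) (g k)) \<le> ennreal D"
    and "(\<lambda>k. total_mvol (\<Gamma> k) (v k) (g k)) \<longlonglongrightarrow> 0"
  shows "\<exists>m < 2 * CARD('n) + 1. \<exists>Q. flat_torus_metric m Q \<and>
           isometric X d (torus m) (flat_torus_dist m Q)"
proof -
  interpret Metric_space X d by (rule assms(3))
  have "\<forall>j. \<exists>(L :: (real ^ ('n + 'n)) set) F. 0 \<in> L \<and> (\<forall>a\<in>L. \<forall>b\<in>L. a - b \<in> L) \<and> (\<forall>x. F x \<in> X) \<and>
    (\<forall>x y. \<bar>d (F x) (F y) - infdist (y - x) L\<bar> \<le> inverse (real (Suc j))) \<and>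
    (\<forall>p\<in>X. \<exists>x. d (F x) p \<le> inverse (real (Suc j)))"
    by (intro allI close_to_euclidean_quotient [OF assms(1,2,5-8)]) simp
  from choice [OF this] obtain L :: "nat \<Rightarrow> (real ^ ('n + 'n)) set" where
    "\<forall>j. \<exists>F. 0 \<in> L j \<and> (\<forall>a\<in>L j. \<forall>b\<in>L j. a - b \<in> L j) \<and> (\<forall>x. F x \<in> X) \<and>
    (\<forall>x y. \<bar>d (F x) (F y) - infdist (y - x) (L j)\<bar> \<le> inverse (real (Suc j))) \<and>
    (\<forall>p\<in>X. \<exists>x. d (F x) p \<le> inverse (real (Suc j)))" by (elim exE)
  from choice [OF this] obtain F where LF:
    "\<forall>j. 0 \<in> L j \<and> (\<forall>a\<in>L j. \<forall>b\<in>L j. a - b \<in> L j) \<and> (\<forall>x. F j x \<in> X) \<and>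
    (\<forall>x y. \<bar>d (F j x) (F j y) - infdist (y - x) (L j)\<bar> \<le> inverse (real (Suc j))) \<and>
    (\<forall>p\<in>X. \<exists>x. d (F j x) p \<le> inverse (real (Suc j)))" by (elim exE)
  have "\<exists>(K :: (real ^ ('n + 'n)) set) G. closed K \<and> 0 \<in> K \<and> (\<forall>a\<in>K. \<forall>b\<in>K. a - b \<in> K) \<and> range G = X \<and>
    (\<forall>x y. d (G x) (G y) = infdist (y - x) K)"
    by (rule limit_of_quotients [of L F]) (use LF assms(4) in blast)+
  then obtain K :: "(real ^ ('n + 'n)) set" and G where K: "closed K" "0 \<in> K"
    and sub: "\<forall>a\<in>K. \<forall>b\<in>K. a - b \<in> K" and G: "range G = X" and dG: "\<forall>x y. d (G x) (G y) = infdist (y - x) K"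
    by (elim exE conjE)
  \<comment> \<open>Compactness bounds the diameter of X, and this bound becomes the covering radius
    of K, which makes the quotient by K a torus without Euclidean factors.\<close>
  have "compactin mtopology X" using assms(4) by (simp add: compact_space_def)
  then have "mbounded X" by (rule compactin_imp_mbounded)
  then obtain R where R: "\<forall>x\<in>X. \<forall>y\<in>X. d x y \<le> R" unfolding mbounded_alt by blast
  have cov: "infdist x K \<le> R" for x
  proof -
    have "infdist x K = d (G 0) (G x)" using dG by simp
    also have "\<dots> \<le> R" using R G by blast
    finally show ?thesis .
  qed
  have "\<exists>m \<le> DIM(real ^ ('n + 'n)). \<exists>Q. flat_torus_metric m Q \<and> isometric X d (torus m) (flat_torus_dist m Q)"
    by (rule isometric_flat_torus [OF assms(3) K _ G _ cov]) (use sub dG in auto)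
  \<comment> \<open>The base has dimension 2n, one less than the group: the fibre direction is lost
    in the limit.\<close>
  moreover have "m < 2 * CARD('n) + 1" if "m \<le> DIM(real ^ ('n + 'n))" for m
    using that by simp
  ultimately show ?thesis by blast
qed

end
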